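(* Let $(R,\mathfrak m)$ be a commutative Artinian local ring with canonical module $\omega$, and let $I\subsetneq R$ be an ideal such that $\mathfrak m^2I=0$. Assume that (i) $b_0(I)>2$ and (ii) $b_2(\omega)\le b_1(\omega)$. Suppose there exist a finitely generated non-free $R$-module $M$ with $\mathfrak m I M=0$ and an integer $i>1$ such that $\operatorname{Tor}^R_{i}(M,\omega)=\operatorname{Tor}^R_{i+1}(M,\omega)=\operatorname{Tor}^R_{i+2}(M,\omega)=0$, the modules $M_t$ are $I$-free for all $i\le t\le i+3$, and $\omega_1,\omega_2,\omega_3$ are $I$-free. Then $R$ is Gorenstein.
   Context: For a finitely generated $R$-module $L$, $b_i(L)$ is the $i$-th Betti number (rank of the $i$-th free module in the minimal free resolution of $L$), so $b_0(L)$ is the minimal number of generators. $L_i$ is the $i$-th syzygy of $L$ in its minimal free resolution: $L_0=L$, and for $i\ge1$ there is an exact sequence $0\to L_i\to R^{b_{i-1}(L)}\to L_{i-1}\to 0$ with $L_i\subset \mathfrak m R^{b_{i-1}(L)}$. $L$ is called $I$-free if $L/IL$ is a free $R/I$-module. The canonical (dualizing) module $\omega$ of an Artinian local ring is the injective hull of the residue field. *)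

theory Defs
  imports "HOL-Algebra.Module" "HOL-Algebra.Ideal_Product" "HOL-Algebra.QuotRing" "HOL-Algebra.Ring_Divisibility"
begin

section \<open>Local and Artinian rings\<close>

definition local_ring :: "('a, 'b) ring_scheme \<Rightarrow> 'a set \<Rightarrow> bool" where
  "local_ring R \<mm> \<longleftrightarrow> cring R \<and> maximalideal \<mm> R \<and> (\<forall>J. maximalideal J R \<longrightarrow> J = \<mm>)"

definition artinian_ring :: "('a, 'b) ring_scheme \<Rightarrow> bool" where
  "artinian_ring R \<longleftrightarrow> ring R \<and>
     (\<forall>J :: nat \<Rightarrow> 'a set. (\<forall>n. ideal (J n) R) \<and> (\<forall>n. J (Suc n) \<subseteq> J n)
        \<longrightarrow> (\<exists>n. \<forall>k\<ge>n. J k = J n))"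


section \<open>Modules\<close>

text \<open>The library's module record extends the ring record; the fields \<open>mult\<close> and \<open>one\<close> play no
  role for modules and are left undefined in the modules constructed below.\<close>

definition self_module :: "('a, 'b) ring_scheme \<Rightarrow> ('a, 'a) module" where
  "self_module R = \<lparr>carrier = carrier R, monoid.mult = (\<otimes>\<^bsub>R\<^esub>), one = \<one>\<^bsub>R\<^esub>,
     zero = \<zero>\<^bsub>R\<^esub>, add = (\<oplus>\<^bsub>R\<^esub>), smult = (\<otimes>\<^bsub>R\<^esub>)\<rparr>"

definition mod_hom ::
    "('a, 'b) ring_scheme \<Rightarrow> ('a, 'm) module \<Rightarrow> ('a, 'n) module \<Rightarrow> ('m \<Rightarrow> 'n) set" where
  "mod_hom R M N = {h. h \<in> carrier M \<rightarrow> carrier N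
     \<and> (\<forall>x\<in>carrier M. \<forall>y\<in>carrier M. h (x \<oplus>\<^bsub>M\<^esub> y) = h x \<oplus>\<^bsub>N\<^esub> h y)
     \<and> (\<forall>a\<in>carrier R. \<forall>x\<in>carrier M. h (a \<odot>\<^bsub>M\<^esub> x) = a \<odot>\<^bsub>N\<^esub> h x)}"

definition module_isomorphic ::
    "('a, 'b) ring_scheme \<Rightarrow> ('a, 'm) module \<Rightarrow> ('a, 'n) module \<Rightarrow> bool" where
  "module_isomorphic R M N \<longleftrightarrow> (\<exists>h\<in>mod_hom R M N. bij_betw h (carrier M) (carrier N))"

definition module_span ::
    "('a, 'b) ring_scheme \<Rightarrow> ('a, 'm) module \<Rightarrow> 'm set \<Rightarrow> 'm set" where
  "module_span R M A = \<Inter> {N. submodule N R M \<and> A \<subseteq> N}"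

definition finitely_generated :: "('a, 'b) ring_scheme \<Rightarrow> ('a, 'm) module \<Rightarrow> bool" where
  "finitely_generated R M \<longleftrightarrow>
     (\<exists>A. finite A \<and> A \<subseteq> carrier M \<and> module_span R M A = carrier M)"

definition ideal_smult ::
    "('a, 'b) ring_scheme \<Rightarrow> 'a set \<Rightarrow> ('a, 'm) module \<Rightarrow> 'm set" where
  "ideal_smult R I M = module_span R M {a \<odot>\<^bsub>M\<^esub> x |a x. a \<in> I \<and> x \<in> carrier M}"

text \<open>The quotient \<open>M/K\<close> by a submodule, in the style of \<^const>\<open>FactRing\<close>.\<close>

definition quotient_module :: "('a, 'm) module \<Rightarrow> 'm set \<Rightarrow> ('a, 'm set) module" where
  "quotient_module M K = \<lparr>carrier = a_rcosets\<^bsub>M\<^esub> K, monoid.mult = undefined, one = undefined,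
     zero = K, add = set_add M,
     smult = (\<lambda>a X. \<Union>x\<in>X. K +>\<^bsub>M\<^esub> (a \<odot>\<^bsub>M\<^esub> x))\<rparr>"

text \<open>\<open>L/IL\<close> as a module over \<open>R/I\<close>.\<close>

definition reduction ::
    "('a, 'b) ring_scheme \<Rightarrow> 'a set \<Rightarrow> ('a, 'm) module \<Rightarrow> ('a set, 'm set) module" where
  "reduction R I L = (let K = ideal_smult R I L in
     \<lparr>carrier = a_rcosets\<^bsub>L\<^esub> K, monoid.mult = undefined, one = undefined,
      zero = K, add = set_add L,
      smult = (\<lambda>A X. \<Union>a\<in>A. \<Union>x\<in>X. K +>\<^bsub>L\<^esub> (a \<odot>\<^bsub>L\<^esub> x))\<rparr>)"

text \<open>\<open>N\<^sup>n\<close>: families indexed by \<open>{..<n}\<close>, extended by zero.\<close>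

definition power_module :: "('a, 'm) module \<Rightarrow> nat \<Rightarrow> ('a, nat \<Rightarrow> 'm) module" where
  "power_module N n =
     \<lparr>carrier = {f. (\<forall>k<n. f k \<in> carrier N) \<and> (\<forall>k\<ge>n. f k = \<zero>\<^bsub>N\<^esub>)},
      monoid.mult = undefined, one = undefined,
      zero = (\<lambda>_. \<zero>\<^bsub>N\<^esub>), add = (\<lambda>f g k. f k \<oplus>\<^bsub>N\<^esub> g k),
      smult = (\<lambda>a f k. a \<odot>\<^bsub>N\<^esub> f k)\<rparr>"

definition free_module :: "('a, 'b) ring_scheme \<Rightarrow> nat \<Rightarrow> ('a, nat \<Rightarrow> 'a) module" where
  "free_module R n = power_module (self_module R) n"

definition unit_vector :: "('a, 'b) ring_scheme \<Rightarrow> nat \<Rightarrow> nat \<Rightarrow> 'a" where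
  "unit_vector R k = (\<lambda>j. if j = k then \<one>\<^bsub>R\<^esub> else \<zero>\<^bsub>R\<^esub>)"

text \<open>Free of finite rank; for a finitely generated module over a nonzero ring this is the same
  as being free.\<close>

definition fg_free :: "('a, 'b) ring_scheme \<Rightarrow> ('a, 'm) module \<Rightarrow> bool" where
  "fg_free R M \<longleftrightarrow> (\<exists>n. module_isomorphic R M (free_module R n))"

definition ideal_free ::
    "('a, 'b) ring_scheme \<Rightarrow> 'a set \<Rightarrow> ('a, 'm) module \<Rightarrow> bool" where
  "ideal_free R I L \<longleftrightarrow> fg_free (R Quot I) (reduction R I L)"


section \<open>Injective modules, canonical module, Gorenstein rings\<close>

text \<open>HOL cannot quantify over all types, so the test modules \<open>B\<close> live in the type
  \<^typ>\<open>nat \<Rightarrow> 'a\<close>. It contains a copy of every finitely generated \<open>R\<close>-module (in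
  particular \<open>R\<^sup>1\<close> and the ideals inside it), so by Baer's criterion nothing is lost.\<close>

definition injective_module :: "('a, 'b) ring_scheme \<Rightarrow> ('a, 'm) module \<Rightarrow> bool" where
  "injective_module R E \<longleftrightarrow> module R E \<and>
     (\<forall>(B :: ('a, nat \<Rightarrow> 'a) module) A f.
        module R B \<and> submodule A R B \<and> f \<in> mod_hom R (B\<lparr>carrier := A\<rparr>) E
        \<longrightarrow> (\<exists>g\<in>mod_hom R B E. \<forall>x\<in>A. g x = f x))"

definition injective_hull ::
    "('a, 'b) ring_scheme \<Rightarrow> ('a, 'm) module \<Rightarrow> ('a, 'n) module \<Rightarrow> bool" where
  "injective_hull R K E \<longleftrightarrow> injective_module R E \<and>
     (\<exists>j\<in>mod_hom R K E. inj_on j (carrier K) \<and>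
        (\<forall>N. submodule N R E \<and> N \<noteq> {\<zero>\<^bsub>E\<^esub>} \<longrightarrow> N \<inter> j ` carrier K \<noteq> {\<zero>\<^bsub>E\<^esub>}))"

definition canonical_module ::
    "('a, 'b) ring_scheme \<Rightarrow> 'a set \<Rightarrow> ('a, 'm) module \<Rightarrow> bool" where
  "canonical_module R \<mm> W \<longleftrightarrow> injective_hull R (quotient_module (self_module R) \<mm>) W"

text \<open>An exact sequence \<open>0 \<rightarrow> M \<rightarrow> E\<^sub>0 \<rightarrow> E\<^sub>1 \<rightarrow> \<dots>\<close> of injective modules that are eventually zero.
  The modules \<open>E\<^sub>i\<close> are again sought in \<^typ>\<open>nat \<Rightarrow> 'a\<close>; this suffices for finitely generated
  modules over an Artinian local ring, whose injective hulls are finitely generated.\<close>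

definition finite_injective_dimension ::
    "('a, 'b) ring_scheme \<Rightarrow> ('a, 'm) module \<Rightarrow> bool" where
  "finite_injective_dimension R M \<longleftrightarrow>
     (\<exists>(E :: nat \<Rightarrow> ('a, nat \<Rightarrow> 'a) module) \<eta> d.
        (\<forall>i. injective_module R (E i)) \<and>
        \<eta> \<in> mod_hom R M (E 0) \<and> (\<forall>i. d i \<in> mod_hom R (E i) (E (Suc i))) \<and>
        inj_on \<eta> (carrier M) \<and>
        \<eta> ` carrier M = a_kernel (E 0) (E 1) (d 0) \<and>
        (\<forall>i. d i ` carrier (E i) = a_kernel (E (Suc i)) (E (Suc (Suc i))) (d (Suc i))) \<and>
        (\<exists>n. \<forall>i>n. carrier (E i) = {\<zero>\<^bsub>E i\<^esub>}))"

definition gorenstein_local_ring :: "('a, 'b) ring_scheme \<Rightarrow> bool" where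
  "gorenstein_local_ring R \<longleftrightarrow> noetherian_ring R \<and> (\<exists>\<mm>. local_ring R \<mm>) \<and>
     finite_injective_dimension R (self_module R)"


section \<open>Minimal free resolutions, Betti numbers, syzygies\<close>

text \<open>\<open>\<dots> \<rightarrow> R\<^bsup>\<beta> 2\<^esup> \<rightarrow> R\<^bsup>\<beta> 1\<^esup> \<rightarrow> R\<^bsup>\<beta> 0\<^esup> \<rightarrow> L \<rightarrow> 0\<close> with augmentation \<open>\<epsilon>\<close> and
  differentials \<open>d i : R\<^bsup>\<beta> (i+1)\<^esup> \<rightarrow> R\<^bsup>\<beta> i\<^esup>\<close>.\<close>

definition minimal_free_resolution ::
    "('a, 'b) ring_scheme \<Rightarrow> 'a set \<Rightarrow> ('a, 'm) module \<Rightarrow> (nat \<Rightarrow> nat) \<Rightarrow>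
     ((nat \<Rightarrow> 'a) \<Rightarrow> 'm) \<Rightarrow> (nat \<Rightarrow> (nat \<Rightarrow> 'a) \<Rightarrow> nat \<Rightarrow> 'a) \<Rightarrow> bool" where
  "minimal_free_resolution R \<mm> L \<beta> \<epsilon> d \<longleftrightarrow>
     (let F = (\<lambda>i. free_module R (\<beta> i)) in
        \<epsilon> \<in> mod_hom R (F 0) L \<and> (\<forall>i. d i \<in> mod_hom R (F (Suc i)) (F i)) \<and>
        \<epsilon> ` carrier (F 0) = carrier L \<and>
        d 0 ` carrier (F 1) = a_kernel (F 0) L \<epsilon> \<and>
        (\<forall>i. d (Suc i) ` carrier (F (Suc (Suc i))) = a_kernel (F (Suc i)) (F i) (d i)) \<and>
        (\<forall>i. d i ` carrier (F (Suc i)) \<subseteq> ideal_smult R \<mm> (F i)))"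

text \<open>A finitely generated module over a Noetherian local ring has a minimal free resolution,
  unique up to isomorphism; we fix one.\<close>

definition min_res ::
    "('a, 'b) ring_scheme \<Rightarrow> 'a set \<Rightarrow> ('a, 'm) module \<Rightarrow>
     (nat \<Rightarrow> nat) \<times> ((nat \<Rightarrow> 'a) \<Rightarrow> 'm) \<times> (nat \<Rightarrow> (nat \<Rightarrow> 'a) \<Rightarrow> nat \<Rightarrow> 'a)" where
  "min_res R \<mm> L = (SOME (\<beta>, \<epsilon>, d). minimal_free_resolution R \<mm> L \<beta> \<epsilon> d)"

definition betti :: "('a, 'b) ring_scheme \<Rightarrow> 'a set \<Rightarrow> ('a, 'm) module \<Rightarrow> nat \<Rightarrow> nat" where
  "betti R \<mm> L = fst (min_res R \<mm> L)"

definition res_diff ::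
    "('a, 'b) ring_scheme \<Rightarrow> 'a set \<Rightarrow> ('a, 'm) module \<Rightarrow> nat \<Rightarrow> (nat \<Rightarrow> 'a) \<Rightarrow> nat \<Rightarrow> 'a" where
  "res_diff R \<mm> L = snd (snd (min_res R \<mm> L))"

text \<open>The syzygy \<open>L\<^sub>i \<subseteq> R\<^bsup>\<beta> (i-1)\<^esup>\<close>, only meaningful for \<open>i \<ge> 1\<close> (\<open>L\<^sub>0 = L\<close> has a different type).\<close>

definition syzygy ::
    "('a, 'b) ring_scheme \<Rightarrow> 'a set \<Rightarrow> ('a, 'm) module \<Rightarrow> nat \<Rightarrow> ('a, nat \<Rightarrow> 'a) module" where
  "syzygy R \<mm> L i = (free_module R (betti R \<mm> L (i - 1)))
     \<lparr>carrier := res_diff R \<mm> L (i - 1) ` carrier (free_module R (betti R \<mm> L i))\<rparr>"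


section \<open>Tensor products with free modules, and Tor\<close>

text \<open>\<open>R\<^sup>n \<otimes> N\<close> is realised as \<open>N\<^sup>n\<close> with \<open>v \<otimes> x = (v\<^sub>k x)\<^sub>k\<close>; the lemmas
  \<open>pure_tensor_bilinear\<close> and \<open>tensor_universal\<close> below show that this is a tensor product.
  For a linear \<open>\<phi> : R\<^sup>n \<rightarrow> R\<^sup>m\<close> the map \<open>\<phi> \<otimes> 1 : N\<^sup>n \<rightarrow> N\<^sup>m\<close> is given by the matrix of \<open>\<phi>\<close>
  (lemma \<open>tensor_map_pure\<close>).\<close>

definition pure_tensor :: "('a, 'n) module \<Rightarrow> (nat \<Rightarrow> 'a) \<Rightarrow> 'n \<Rightarrow> nat \<Rightarrow> 'n" where
  "pure_tensor N v x = (\<lambda>k. v k \<odot>\<^bsub>N\<^esub> x)"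

definition tensor_map ::
    "('a, 'b) ring_scheme \<Rightarrow> ('a, 'n) module \<Rightarrow> nat \<Rightarrow> ((nat \<Rightarrow> 'a) \<Rightarrow> nat \<Rightarrow> 'a) \<Rightarrow>
     (nat \<Rightarrow> 'n) \<Rightarrow> nat \<Rightarrow> 'n" where
  "tensor_map R N n \<phi> y = (\<lambda>j. \<Oplus>\<^bsub>N\<^esub>k\<in>{..<n}. \<phi> (unit_vector R k) j \<odot>\<^bsub>N\<^esub> y k)"

text \<open>\<open>Tor\<^sub>i(M, N) = H\<^sub>i(F \<otimes> N)\<close> for the minimal free resolution \<open>F\<close> of \<open>M\<close>.\<close>

definition tor_diff ::
    "('a, 'b) ring_scheme \<Rightarrow> 'a set \<Rightarrow> ('a, 'm) module \<Rightarrow> ('a, 'n) module \<Rightarrow> nat \<Rightarrow>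
     (nat \<Rightarrow> 'n) \<Rightarrow> nat \<Rightarrow> 'n" where
  "tor_diff R \<mm> M N i = tensor_map R N (betti R \<mm> M (Suc i)) (res_diff R \<mm> M i)"

definition tor_cycles ::
    "('a, 'b) ring_scheme \<Rightarrow> 'a set \<Rightarrow> ('a, 'm) module \<Rightarrow> ('a, 'n) module \<Rightarrow> nat \<Rightarrow>
     (nat \<Rightarrow> 'n) set" where
  "tor_cycles R \<mm> M N i = (case i of
       0 \<Rightarrow> carrier (power_module N (betti R \<mm> M 0))
     | Suc j \<Rightarrow> a_kernel (power_module N (betti R \<mm> M (Suc j)))
                  (power_module N (betti R \<mm> M j)) (tor_diff R \<mm> M N j))"

definition Tor ::
    "('a, 'b) ring_scheme \<Rightarrow> 'a set \<Rightarrow> nat \<Rightarrow> ('a, 'm) module \<Rightarrow> ('a, 'n) module \<Rightarrow>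
     ('a, (nat \<Rightarrow> 'n) set) module" where
  "Tor R \<mm> i M N = quotient_module
     ((power_module N (betti R \<mm> M i))\<lparr>carrier := tor_cycles R \<mm> M N i\<rparr>)
     (tor_diff R \<mm> M N i ` carrier (power_module N (betti R \<mm> M (Suc i))))"

definition zero_module :: "('a, 'm) module \<Rightarrow> bool" where
  "zero_module M \<longleftrightarrow> carrier M = {\<zero>\<^bsub>M\<^esub>}"


section \<open>The realisation of the tensor product is correct\<close>

lemma mod_homD:
  assumes "h \<in> mod_hom R M N"
  shows "\<And>x. x \<in> carrier M \<Longrightarrow> h x \<in> carrier N"
    and "\<And>x y. x \<in> carrier M \<Longrightarrow> y \<in> carrier M \<Longrightarrow> h (x \<oplus>\<^bsub>M\<^esub> y) = h x \<oplus>\<^bsub>N\<^esub> h y"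
    and "\<And>a x. a \<in> carrier R \<Longrightarrow> x \<in> carrier M \<Longrightarrow> h (a \<odot>\<^bsub>M\<^esub> x) = a \<odot>\<^bsub>N\<^esub> h x"
  using assms unfolding mod_hom_def by auto

lemma power_module_simps [simp]:
  "f \<in> carrier (power_module N n) \<longleftrightarrow> (\<forall>k<n. f k \<in> carrier N) \<and> (\<forall>k\<ge>n. f k = \<zero>\<^bsub>N\<^esub>)"
  "\<zero>\<^bsub>power_module N n\<^esub> = (\<lambda>_. \<zero>\<^bsub>N\<^esub>)"
  "f \<oplus>\<^bsub>power_module N n\<^esub> g = (\<lambda>k. f k \<oplus>\<^bsub>N\<^esub> g k)"
  "a \<odot>\<^bsub>power_module N n\<^esub> f = (\<lambda>k. a \<odot>\<^bsub>N\<^esub> f k)"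
  by (simp_all add: power_module_def)

lemma self_module_simps [simp]:
  "carrier (self_module R) = carrier R"
  "\<zero>\<^bsub>self_module R\<^esub> = \<zero>\<^bsub>R\<^esub>"
  "a \<oplus>\<^bsub>self_module R\<^esub> b = a \<oplus>\<^bsub>R\<^esub> b"
  "a \<odot>\<^bsub>self_module R\<^esub> b = a \<otimes>\<^bsub>R\<^esub> b"
  by (simp_all add: self_module_def)

lemma power_carrier:
  assumes "module R M" "f \<in> carrier (power_module M n)"
  shows "f k \<in> carrier M"
proof -
  interpret module R M by fact
  show ?thesis using assms(2) by (cases "k < n") auto
qed

lemma power_module_is_module:
  assumes M: "module R M" shows "module R (power_module M n)"
proof -
  interpret module R M by fact
  note power_carrier = power_carrier[OF M]
  show ?thesis
  proof (rule moduleI)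
    show "cring R" by (rule R.is_cring)
    show "abelian_group (power_module M n)"
    proof (rule abelian_groupI)
      fix f assume f: "f \<in> carrier (power_module M n)"
      show "\<exists>g\<in>carrier (power_module M n). g \<oplus>\<^bsub>power_module M n\<^esub> f = \<zero>\<^bsub>power_module M n\<^esub>"
        by (rule bexI[of _ "\<lambda>k. \<ominus>\<^bsub>M\<^esub> f k"])
          (use f power_carrier[OF f] in \<open>auto simp: M.l_neg\<close>)
    next
      fix f g h
      assume *: "f \<in> carrier (power_module M n)" "g \<in> carrier (power_module M n)"
        "h \<in> carrier (power_module M n)"
      show "f \<oplus>\<^bsub>power_module M n\<^esub> g \<oplus>\<^bsub>power_module M n\<^esub> h =
          f \<oplus>\<^bsub>power_module M n\<^esub> (g \<oplus>\<^bsub>power_module M n\<^esub> h)"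
        using *[THEN power_carrier] by (simp add: M.a_assoc)
    next
      fix f g assume *: "f \<in> carrier (power_module M n)" "g \<in> carrier (power_module M n)"
      show "f \<oplus>\<^bsub>power_module M n\<^esub> g = g \<oplus>\<^bsub>power_module M n\<^esub> f"
        using *[THEN power_carrier] by (simp add: M.a_comm)
      show "f \<oplus>\<^bsub>power_module M n\<^esub> g \<in> carrier (power_module M n)" using * by simp
    next
      fix f assume *: "f \<in> carrier (power_module M n)"
      show "\<zero>\<^bsub>power_module M n\<^esub> \<oplus>\<^bsub>power_module M n\<^esub> f = f"
        using power_carrier[OF *] by simp
    qed simp
  next
    fix a b f g
    assume a: "a \<in> carrier R" and b: "b \<in> carrier R"
      and f: "f \<in> carrier (power_module M n)" and g: "g \<in> carrier (power_module M n)"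
    note c = a b power_carrier[OF f] power_carrier[OF g]
    show "(a \<oplus>\<^bsub>R\<^esub> b) \<odot>\<^bsub>power_module M n\<^esub> f =
        a \<odot>\<^bsub>power_module M n\<^esub> f \<oplus>\<^bsub>power_module M n\<^esub> b \<odot>\<^bsub>power_module M n\<^esub> f"
      using c by (simp add: smult_l_distr)
    show "a \<odot>\<^bsub>power_module M n\<^esub> (f \<oplus>\<^bsub>power_module M n\<^esub> g) =
        a \<odot>\<^bsub>power_module M n\<^esub> f \<oplus>\<^bsub>power_module M n\<^esub> a \<odot>\<^bsub>power_module M n\<^esub> g"
      using c by (simp add: smult_r_distr)
    show "(a \<otimes>\<^bsub>R\<^esub> b) \<odot>\<^bsub>power_module M n\<^esub> f =
        a \<odot>\<^bsub>power_module M n\<^esub> (b \<odot>\<^bsub>power_module M n\<^esub> f)"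
      using c by (simp add: smult_assoc1)
  next
    fix a f assume "a \<in> carrier R" and f: "f \<in> carrier (power_module M n)"
    then show "a \<odot>\<^bsub>power_module M n\<^esub> f \<in> carrier (power_module M n)" by simp
  next
    fix f assume "f \<in> carrier (power_module M n)"
    from power_carrier[OF this] show "\<one>\<^bsub>R\<^esub> \<odot>\<^bsub>power_module M n\<^esub> f = f" by simp
  qed
qed

lemma self_module_is_module:
  assumes "cring R" shows "module R (self_module R)"
proof -
  interpret cring R by fact
  show ?thesis
  proof (rule moduleI)
    show "cring R" by fact
    show "abelian_group (self_module R)"
      by (rule abelian_groupI) (auto simp: a_ac intro: bexI[of _ "\<ominus>\<^bsub>R\<^esub> x" for x] l_neg)
  qed (auto simp: l_distr r_distr m_assoc)
qed

lemma unit_vector_carrier: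
  assumes "cring R" "k < n" shows "unit_vector R k \<in> carrier (free_module R n)"
proof -
  interpret cring R by fact
  show ?thesis using assms(2) by (auto simp: free_module_def unit_vector_def)
qed

lemma hom_power_decompose:
  assumes N: "module R N" and P: "module R P" and h: "h \<in> mod_hom R (power_module N n) P"
    and y: "y \<in> carrier (power_module N n)"
  shows "h y = (\<Oplus>\<^bsub>P\<^esub>k\<in>{..<n}. h (\<lambda>j. if j = k then y k else \<zero>\<^bsub>N\<^esub>))"
proof -
  interpret N: module R N by fact
  interpret P: module R P by fact
  interpret NP: module R "power_module N n" by (rule power_module_is_module[OF N])
  have yc: "y k \<in> carrier N" for k using power_carrier[OF N y] .
  let ?t = "\<lambda>m j. if j < m then y j else \<zero>\<^bsub>N\<^esub>"
  let ?s = "\<lambda>k j. if j = k then y k else \<zero>\<^bsub>N\<^esub>"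
  have sc: "?s k \<in> carrier (power_module N n)" if "k < n" for k using that yc by simp
  have "m \<le> n \<Longrightarrow> h (?t m) = (\<Oplus>\<^bsub>P\<^esub>k\<in>{..<m}. h (?s k))" for m
  proof (induction m)
    case 0
    have z: "(\<lambda>_. \<zero>\<^bsub>N\<^esub>) \<in> carrier (power_module N n)" by simp
    from mod_homD(3)[OF h N.R.zero_closed z]
    have "h (\<lambda>_. \<zero>\<^bsub>N\<^esub>) = \<zero>\<^bsub>R\<^esub> \<odot>\<^bsub>P\<^esub> h (\<lambda>_. \<zero>\<^bsub>N\<^esub>)" by simp
    then have "h (\<lambda>_. \<zero>\<^bsub>N\<^esub>) = \<zero>\<^bsub>P\<^esub>" using mod_homD(1)[OF h z] by simp
    then show ?case by simp
  next
    case (Suc m)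
    have tc: "?t m \<in> carrier (power_module N n)" using Suc.prems yc by auto
    have "?t (Suc m) = ?s m \<oplus>\<^bsub>power_module N n\<^esub> ?t m"
      using yc by (auto simp: fun_eq_iff less_Suc_eq)
    then have "h (?t (Suc m)) = h (?s m) \<oplus>\<^bsub>P\<^esub> h (?t m)"
      using mod_homD(2)[OF h sc tc] Suc.prems by simp
    moreover have "(\<Oplus>\<^bsub>P\<^esub>k\<in>{..<Suc m}. h (?s k)) = h (?s m) \<oplus>\<^bsub>P\<^esub> (\<Oplus>\<^bsub>P\<^esub>k\<in>{..<m}. h (?s k))"
      unfolding lessThan_Suc using mod_homD(1)[OF h sc] Suc.prems
      by (intro P.finsum_insert) auto
    ultimately show ?case using Suc by simp
  qed
  from this[of n] have "h (?t n) = (\<Oplus>\<^bsub>P\<^esub>k\<in>{..<n}. h (?s k))" by simp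
  moreover have "?t n = y" using y by (auto simp: fun_eq_iff)
  ultimately show ?thesis by simp
qed

lemma free_carrier:
  assumes "cring R" "v \<in> carrier (free_module R n)" shows "v k \<in> carrier R"
  using power_carrier[OF self_module_is_module[OF assms(1)]] assms(2)
  by (simp add: free_module_def)

lemma pure_tensor_bilinear:
  assumes N: "module R N"
  shows "v \<in> carrier (free_module R n) \<Longrightarrow> pure_tensor N v \<in> mod_hom R N (power_module N n)"
    and "x \<in> carrier N \<Longrightarrow> (\<lambda>v. pure_tensor N v x) \<in> mod_hom R (free_module R n) (power_module N n)"
proof -
  interpret N: module R N by fact
  { assume v: "v \<in> carrier (free_module R n)"
    then have "v k \<in> carrier R" for k by (rule free_carrier[OF N.R.is_cring])
    moreover have "v k = \<zero>\<^bsub>R\<^esub>" if "k \<ge> n" for k using v that by (simp add: free_module_def)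
    ultimately show "pure_tensor N v \<in> mod_hom R N (power_module N n)"
      unfolding mod_hom_def pure_tensor_def
      by (auto simp: N.smult_r_distr fun_eq_iff N.R.m_comm simp flip: N.smult_assoc1) }
  { assume x: "x \<in> carrier N"
    have "v k \<in> carrier R" if "v \<in> carrier (free_module R n)" for v k
      using free_carrier[OF N.R.is_cring that] .
    then show "(\<lambda>v. pure_tensor N v x) \<in> mod_hom R (free_module R n) (power_module N n)"
      using x unfolding mod_hom_def pure_tensor_def
      by (auto simp: free_module_def fun_eq_iff N.smult_l_distr N.smult_assoc1) }
qed

lemma unit_tensor:
  assumes N: "module R N" and "x \<in> carrier N"
  shows "pure_tensor N (unit_vector R k) x = (\<lambda>j. if j = k then x else \<zero>\<^bsub>N\<^esub>)"
proof -
  interpret N: module R N by fact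
  show ?thesis using assms(2) by (auto simp: pure_tensor_def unit_vector_def fun_eq_iff)
qed

lemma hom_free_decompose:
  assumes P: "module R P" and h: "h \<in> mod_hom R (free_module R n) P"
    and v: "v \<in> carrier (free_module R n)"
  shows "h v = (\<Oplus>\<^bsub>P\<^esub>k\<in>{..<n}. v k \<odot>\<^bsub>P\<^esub> h (unit_vector R k))"
proof -
  interpret P: module R P by fact
  have vc: "v k \<in> carrier R" for k using free_carrier[OF P.R.is_cring v] .
  have eq: "h (\<lambda>j. if j = k then v k else \<zero>\<^bsub>R\<^esub>) = v k \<odot>\<^bsub>P\<^esub> h (unit_vector R k)" if "k < n" for k
  proof -
    have "(\<lambda>j. if j = k then v k else \<zero>\<^bsub>R\<^esub>) = v k \<odot>\<^bsub>free_module R n\<^esub> unit_vector R k"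
      using vc by (auto simp: free_module_def unit_vector_def fun_eq_iff)
    then show ?thesis
      using mod_homD(3)[OF h vc unit_vector_carrier[OF P.R.is_cring that]] by simp
  qed
  have "h v = (\<Oplus>\<^bsub>P\<^esub>k\<in>{..<n}. h (\<lambda>j. if j = k then v k else \<zero>\<^bsub>R\<^esub>))"
    using hom_power_decompose[OF self_module_is_module[OF P.R.is_cring] P, of h n v] h v
    unfolding free_module_def self_module_simps(2) by blast
  also have "\<dots> = (\<Oplus>\<^bsub>P\<^esub>k\<in>{..<n}. v k \<odot>\<^bsub>P\<^esub> h (unit_vector R k))"
    using mod_homD(1)[OF h unit_vector_carrier[OF P.R.is_cring]] vc
    by (intro P.finsum_cong') (auto simp: eq)
  finally show ?thesis .
qed

lemma tensor_universal:
  assumes N: "module R N" and P: "module R P"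
    and l: "\<And>x. x \<in> carrier N \<Longrightarrow> (\<lambda>v. b v x) \<in> mod_hom R (free_module R n) P"
    and r: "\<And>v. v \<in> carrier (free_module R n) \<Longrightarrow> b v \<in> mod_hom R N P"
  shows "\<exists>g\<in>mod_hom R (power_module N n) P.
       \<forall>v\<in>carrier (free_module R n). \<forall>x\<in>carrier N. g (pure_tensor N v x) = b v x"
    and "\<lbrakk>g \<in> mod_hom R (power_module N n) P; g' \<in> mod_hom R (power_module N n) P;
        \<And>v x. \<lbrakk>v \<in> carrier (free_module R n); x \<in> carrier N\<rbrakk> \<Longrightarrow> g (pure_tensor N v x) = b v x;
        \<And>v x. \<lbrakk>v \<in> carrier (free_module R n); x \<in> carrier N\<rbrakk> \<Longrightarrow> g' (pure_tensor N v x) = b v x;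
        y \<in> carrier (power_module N n)\<rbrakk> \<Longrightarrow> g y = g' y"
proof -
  interpret N: module R N by fact
  interpret P: module R P by fact
  note uc = unit_vector_carrier[OF N.R.is_cring]
  define g where "g = (\<lambda>y. \<Oplus>\<^bsub>P\<^esub>k\<in>{..<n}. b (unit_vector R k) (y k))"
  have bc: "b v x \<in> carrier P" if "v \<in> carrier (free_module R n)" "x \<in> carrier N" for v x
    using mod_homD(1)[OF r[OF that(1)] that(2)] .
  have "g \<in> mod_hom R (power_module N n) P"
    unfolding mod_hom_def
  proof (intro CollectI conjI ballI)
    show "g \<in> carrier (power_module N n) \<rightarrow> carrier P"
      unfolding g_def using bc[OF uc] by (auto intro!: P.finsum_closed)
  next
    fix x y assume x: "x \<in> carrier (power_module N n)" and y: "y \<in> carrier (power_module N n)"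
    have "g (x \<oplus>\<^bsub>power_module N n\<^esub> y)
        = (\<Oplus>\<^bsub>P\<^esub>k\<in>{..<n}. b (unit_vector R k) (x k) \<oplus>\<^bsub>P\<^esub> b (unit_vector R k) (y k))"
      unfolding g_def using x y bc[OF uc] mod_homD(2)[OF r[OF uc]]
      by (intro P.finsum_cong') auto
    also have "\<dots> = g x \<oplus>\<^bsub>P\<^esub> g y"
      unfolding g_def using x y bc[OF uc] by (intro P.finsum_addf) auto
    finally show "g (x \<oplus>\<^bsub>power_module N n\<^esub> y) = g x \<oplus>\<^bsub>P\<^esub> g y" .
  next
    fix a x assume a: "a \<in> carrier R" and x: "x \<in> carrier (power_module N n)"
    have "g (a \<odot>\<^bsub>power_module N n\<^esub> x)
        = (\<Oplus>\<^bsub>P\<^esub>k\<in>{..<n}. a \<odot>\<^bsub>P\<^esub> b (unit_vector R k) (x k))"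
      unfolding g_def using a x bc[OF uc] mod_homD(3)[OF r[OF uc]]
      by (intro P.finsum_cong') auto
    also have "\<dots> = a \<odot>\<^bsub>P\<^esub> g x"
      unfolding g_def using a x bc[OF uc] by (intro P.finsum_smult_ldistr[symmetric]) auto
    finally show "g (a \<odot>\<^bsub>power_module N n\<^esub> x) = a \<odot>\<^bsub>P\<^esub> g x" .
  qed
  moreover have "g (pure_tensor N v x) = b v x"
    if v: "v \<in> carrier (free_module R n)" and x: "x \<in> carrier N" for v x
  proof -
    have vc: "v k \<in> carrier R" for k using free_carrier[OF N.R.is_cring v] .
    have "b v x = (\<Oplus>\<^bsub>P\<^esub>k\<in>{..<n}. v k \<odot>\<^bsub>P\<^esub> b (unit_vector R k) x)"
      using hom_free_decompose[OF P l[OF x] v] .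
    also have "\<dots> = g (pure_tensor N v x)"
      unfolding g_def pure_tensor_def using vc x bc[OF uc] mod_homD(3)[OF r[OF uc]]
      by (intro P.finsum_cong') auto
    finally show ?thesis by simp
  qed
  ultimately show "\<exists>g\<in>mod_hom R (power_module N n) P.
       \<forall>v\<in>carrier (free_module R n). \<forall>x\<in>carrier N. g (pure_tensor N v x) = b v x" by blast
  fix g g' y
  assume g: "g \<in> mod_hom R (power_module N n) P" and g': "g' \<in> mod_hom R (power_module N n) P"
    and 1: "\<And>v x. \<lbrakk>v \<in> carrier (free_module R n); x \<in> carrier N\<rbrakk> \<Longrightarrow> g (pure_tensor N v x) = b v x"
    and 2: "\<And>v x. \<lbrakk>v \<in> carrier (free_module R n); x \<in> carrier N\<rbrakk> \<Longrightarrow> g' (pure_tensor N v x) = b v x"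
    and y: "y \<in> carrier (power_module N n)"
  have yc: "y k \<in> carrier N" for k using power_carrier[OF N y] .
  have "f y = (\<Oplus>\<^bsub>P\<^esub>k\<in>{..<n}. b (unit_vector R k) (y k))"
    if f: "f \<in> mod_hom R (power_module N n) P"
      and "\<And>v x. \<lbrakk>v \<in> carrier (free_module R n); x \<in> carrier N\<rbrakk> \<Longrightarrow> f (pure_tensor N v x) = b v x" for f
    unfolding hom_power_decompose[OF N P f y]
    using that(2)[OF uc yc] bc[OF uc yc] unit_tensor[OF N yc]
    by (intro P.finsum_cong') auto
  from this[OF g 1] this[OF g' 2] show "g y = g' y" by simp
qed

lemma tensor_map_pure:
  assumes N: "module R N" and \<phi>: "\<phi> \<in> mod_hom R (free_module R n) (free_module R m)"
    and v: "v \<in> carrier (free_module R n)" and x: "x \<in> carrier N"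
  shows "tensor_map R N n \<phi> (pure_tensor N v x) = pure_tensor N (\<phi> v) x"
proof
  fix j
  interpret N: module R N by fact
  note cr = N.R.is_cring
  have vc: "v k \<in> carrier R" for k using free_carrier[OF cr v] .
  have "free_module R m = power_module (self_module R) m" by (simp add: free_module_def)
  have \<phi>c: "\<phi> w j \<in> carrier R" if "w \<in> carrier (free_module R n)" for w
    using free_carrier[OF cr mod_homD(1)[OF \<phi> that]] .
  have h: "(\<lambda>w. \<phi> w j \<odot>\<^bsub>N\<^esub> x) \<in> mod_hom R (free_module R n) N"
    unfolding mod_hom_def
    using \<phi>c x mod_homD(2,3)[OF \<phi>]
    by (auto simp: N.smult_l_distr N.smult_assoc1 free_module_def)
  have "\<phi> v j \<odot>\<^bsub>N\<^esub> x = (\<Oplus>\<^bsub>N\<^esub>k\<in>{..<n}. v k \<odot>\<^bsub>N\<^esub> (\<phi> (unit_vector R k) j \<odot>\<^bsub>N\<^esub> x))"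
    using hom_free_decompose[OF N h v] .
  also have "\<dots> = (\<Oplus>\<^bsub>N\<^esub>k\<in>{..<n}. \<phi> (unit_vector R k) j \<odot>\<^bsub>N\<^esub> (v k \<odot>\<^bsub>N\<^esub> x))"
    using vc x \<phi>c[OF unit_vector_carrier[OF cr]]
    by (intro N.finsum_cong') (auto simp: N.R.m_comm simp flip: N.smult_assoc1)
  finally show "tensor_map R N n \<phi> (pure_tensor N v x) j = pure_tensor N (\<phi> v) x j"
    by (simp add: tensor_map_def pure_tensor_def)
qed

end

(*
  Let W be the canonical module, W' its first syzygy, A_j the matrices of the minimal resolution of
  M, b_j = b_j(M), c_j = b_j(W) and s = length(I W'). If a syzygy is I-free, then the next matrix has
  entries in I. Exactness of W (x) F at F_{i+1} then shows that A_{i+1} maps (W'/mW')^{b_{i+1}} onto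
  a module containing (I W')^{b_i}, so b_i s <= b_{i+1} c_1. Over W the transposed complex is exact
  because W is injective, and its analogue over R reaches all of m I R^{b_{i+2}} because W is a
  cogenerator and Tor_{i+2}(M, W) = 0; the same argument gives b_{i+2} s <= b_{i+1} c_1. On the other
  hand b_0(I) c_1 <= c_2 + s, so s >= 2 c_1. If c_1 > 0, then 2 b_i <= b_{i+1} and
  2 b_{i+2} <= b_{i+1}, which contradicts the count of lengths in the exact sequence
  R^{b_{i+2}} -> R^{b_{i+1}} -> m R^{b_i}, because b_i > 0 for non-free M. Hence c_1 = 0, so W is free
  and R is self-injective.
*)

theory Submission
  imports Defs "HOL-Library.Extended_Nat"
begin

section \<open>Submodules and homomorphisms\<close>

text \<open>Entries in I reduce the counts to vector spaces over R/\<mm>: I times \<mm> lies in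
  \<mm>I, and \<mm>I is annihilated by \<mm>. So a matrix with entries in I sees the syzygy W' only
  modulo \<mm>W', and \<mm>I R^n lies in the kernel of every minimal map. Two bounds are needed
  because the length count compares b_{i+1} with b_i + b_{i+2}. The bound for b_i follows the
  differentials; the bound for b_{i+2} runs against them, where the dual of F over R need not be
  exact. All that is required over R is that an image contains \<mm>I R^{b_{i+2}}, and this can be
  tested with maps to W. The factor 2 is what remains of the at least 3 generators of I after c_2
  \<le> c_1 has absorbed one c_1; it is just enough for b_i + b_{i+2} \<le> b_{i+1}. The strictness
  behind the contradiction comes from minimality: an image inside \<mm>R^{b_i} loses length
  b_i.\<close>

lemma (in module) submodule_zero:
  assumes "submodule H R M" shows "\<zero>\<^bsub>M\<^esub> \<in> H"
  using submodule.axioms(1)[OF assms] subgroup.one_closed by fastforce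

lemma (in module) submodule_diff:
  assumes "submodule H R M" "x \<in> H" "y \<in> H" shows "x \<ominus>\<^bsub>M\<^esub> y \<in> H"
  using submoduleE(3,5)[OF assms(1)] assms(2,3) by (simp add: a_minus_def)

lemma (in module) submodule_zero_set: "submodule {\<zero>\<^bsub>M\<^esub>} R M"
  by (rule submoduleI) auto

lemma (in module) submodule_Int:
  assumes "submodule A R M" "submodule B R M" shows "submodule (A \<inter> B) R M"
  by (rule submoduleI)
     (use submoduleE[OF assms(1)] submoduleE[OF assms(2)] assms[THEN submodule_zero] in auto)

lemma set_add_mem: "x \<in> A <+>\<^bsub>G\<^esub> B \<longleftrightarrow> (\<exists>a\<in>A. \<exists>b\<in>B. x = a \<oplus>\<^bsub>G\<^esub> b)"
  by (auto simp: set_add_def set_mult_def)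

lemma (in module) submodule_sum:
  assumes A: "submodule A R M" and B: "submodule B R M"
  shows "submodule (A <+>\<^bsub>M\<^esub> B) R M"
    and "A \<subseteq> A <+>\<^bsub>M\<^esub> B" and "B \<subseteq> A <+>\<^bsub>M\<^esub> B"
    and "\<And>U. submodule U R M \<Longrightarrow> A \<subseteq> U \<Longrightarrow> B \<subseteq> U \<Longrightarrow> A <+>\<^bsub>M\<^esub> B \<subseteq> U"
proof -
  note A' = submoduleE[OF A] and B' = submoduleE[OF B]
  note mem = set_add_mem[of _ M A B]
  have c: "a \<in> carrier M" if "a \<in> A \<or> a \<in> B" for a using that A'(1) B'(1) by auto
  show "submodule (A <+>\<^bsub>M\<^esub> B) R M"
  proof (rule submoduleI)
    show "A <+>\<^bsub>M\<^esub> B \<subseteq> carrier M" using c by (auto simp: mem)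
    show "\<zero>\<^bsub>M\<^esub> \<in> A <+>\<^bsub>M\<^esub> B"
      unfolding mem using submodule_zero[OF A] submodule_zero[OF B] by force
  next
    fix x assume "x \<in> A <+>\<^bsub>M\<^esub> B"
    then obtain a b where ab: "a \<in> A" "b \<in> B" "x = a \<oplus>\<^bsub>M\<^esub> b" by (auto simp: mem)
    then have "\<ominus>\<^bsub>M\<^esub> x = \<ominus>\<^bsub>M\<^esub> a \<oplus>\<^bsub>M\<^esub> \<ominus>\<^bsub>M\<^esub> b" using c by (simp add: M.minus_add)
    then show "\<ominus>\<^bsub>M\<^esub> x \<in> A <+>\<^bsub>M\<^esub> B" using ab A'(3) B'(3) by (auto simp: mem)
  next
    fix x y assume "x \<in> A <+>\<^bsub>M\<^esub> B" "y \<in> A <+>\<^bsub>M\<^esub> B"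
    then obtain a b a' b' where ab: "a \<in> A" "b \<in> B" "x = a \<oplus>\<^bsub>M\<^esub> b"
      "a' \<in> A" "b' \<in> B" "y = a' \<oplus>\<^bsub>M\<^esub> b'" by (auto simp: mem)
    then have "x \<oplus>\<^bsub>M\<^esub> y = (a \<oplus>\<^bsub>M\<^esub> a') \<oplus>\<^bsub>M\<^esub> (b \<oplus>\<^bsub>M\<^esub> b')" using c by (simp add: M.a_ac)
    then show "x \<oplus>\<^bsub>M\<^esub> y \<in> A <+>\<^bsub>M\<^esub> B" unfolding mem using ab A'(5) B'(5) by blast
  next
    fix r x assume r: "r \<in> carrier R" and "x \<in> A <+>\<^bsub>M\<^esub> B"
    then obtain a b where ab: "a \<in> A" "b \<in> B" "x = a \<oplus>\<^bsub>M\<^esub> b" by (auto simp: mem)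
    then have "r \<odot>\<^bsub>M\<^esub> x = r \<odot>\<^bsub>M\<^esub> a \<oplus>\<^bsub>M\<^esub> r \<odot>\<^bsub>M\<^esub> b" using c r by (simp add: smult_r_distr)
    then show "r \<odot>\<^bsub>M\<^esub> x \<in> A <+>\<^bsub>M\<^esub> B" unfolding mem using ab A'(4) B'(4) r by blast
  qed
  show "A \<subseteq> A <+>\<^bsub>M\<^esub> B"
  proof
    fix a assume "a \<in> A"
    then show "a \<in> A <+>\<^bsub>M\<^esub> B" unfolding mem using c submodule_zero[OF B]
      by (intro bexI[of _ a] bexI[of _ "\<zero>\<^bsub>M\<^esub>"]) auto
  qed
  show "B \<subseteq> A <+>\<^bsub>M\<^esub> B"
  proof
    fix b assume "b \<in> B"
    then show "b \<in> A <+>\<^bsub>M\<^esub> B" unfolding mem using c submodule_zero[OF A]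
      by (intro bexI[of _ b] bexI[of _ "\<zero>\<^bsub>M\<^esub>"]) auto
  qed
  show "A <+>\<^bsub>M\<^esub> B \<subseteq> U" if "submodule U R M" "A \<subseteq> U" "B \<subseteq> U" for U
    using submoduleE(5)[OF that(1)] that(2,3) mem by (metis subset_iff)
qed

section \<open>Homomorphisms: images, preimages, inverses\<close>

lemma mod_hom_zero:
  assumes "module R N" "module R P" "f \<in> mod_hom R N P"
  shows "f \<zero>\<^bsub>N\<^esub> = \<zero>\<^bsub>P\<^esub>"
proof -
  interpret N: module R N by fact
  interpret P: module R P by fact
  have "f \<zero>\<^bsub>N\<^esub> = f (\<zero>\<^bsub>R\<^esub> \<odot>\<^bsub>N\<^esub> \<zero>\<^bsub>N\<^esub>)" by simp
  also have "\<dots> = \<zero>\<^bsub>R\<^esub> \<odot>\<^bsub>P\<^esub> f \<zero>\<^bsub>N\<^esub>" using mod_homD(3)[OF assms(3)] by blast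
  also have "\<dots> = \<zero>\<^bsub>P\<^esub>" using mod_homD(1)[OF assms(3)] by simp
  finally show ?thesis .
qed

lemma mod_hom_minus:
  assumes "module R N" "module R P" "f \<in> mod_hom R N P" "x \<in> carrier N"
  shows "f (\<ominus>\<^bsub>N\<^esub> x) = \<ominus>\<^bsub>P\<^esub> f x"
proof -
  interpret N: module R N by fact
  interpret P: module R P by fact
  have "f x \<oplus>\<^bsub>P\<^esub> f (\<ominus>\<^bsub>N\<^esub> x) = f (x \<oplus>\<^bsub>N\<^esub> \<ominus>\<^bsub>N\<^esub> x)"
    using mod_homD(2)[OF assms(3)] assms(4) by simp
  also have "\<dots> = \<zero>\<^bsub>P\<^esub>" using assms(4) mod_hom_zero[OF assms(1-3)] by (simp add: N.M.r_neg)
  finally show ?thesis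
    using mod_homD(1)[OF assms(3)] assms(4) by (metis N.M.a_inv_closed P.M.minus_equality P.M.a_comm)
qed

lemma mod_hom_diff:
  assumes "module R N" "module R P" "f \<in> mod_hom R N P" "x \<in> carrier N" "y \<in> carrier N"
  shows "f (x \<ominus>\<^bsub>N\<^esub> y) = f x \<ominus>\<^bsub>P\<^esub> f y"
proof -
  interpret N: module R N by fact
  show ?thesis using mod_homD(2)[OF assms(3)] mod_hom_minus[OF assms(1-3)] assms(4,5)
    by (simp add: a_minus_def)
qed

lemma mod_hom_comp:
  assumes "f \<in> mod_hom R N P" "g \<in> mod_hom R P Q"
  shows "(\<lambda>x. g (f x)) \<in> mod_hom R N Q"
  using assms unfolding mod_hom_def by (auto simp: Pi_iff)

lemma mod_hom_finsum:
  assumes N: "module R N" and P: "module R P" and f: "f \<in> mod_hom R N P"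
    and u: "\<And>k. k \<in> A \<Longrightarrow> u k \<in> carrier N"
  shows "f (\<Oplus>\<^bsub>N\<^esub>k\<in>A. u k) = (\<Oplus>\<^bsub>P\<^esub>k\<in>A. f (u k))"
proof -
  interpret N: module R N by fact
  interpret P: module R P by fact
  show ?thesis
  proof (cases "finite A")
    case True
    then show ?thesis using u
    proof (induction A)
      case empty
      show ?case using mod_hom_zero[OF N P f] by simp
    next
      case (insert a A)
      have s: "(\<Oplus>\<^bsub>N\<^esub>k\<in>A. u k) \<in> carrier N" using insert.prems by (auto intro!: N.finsum_closed)
      have "f (\<Oplus>\<^bsub>N\<^esub>k\<in>insert a A. u k) = f (u a \<oplus>\<^bsub>N\<^esub> (\<Oplus>\<^bsub>N\<^esub>k\<in>A. u k))"
        using insert by (subst N.finsum_insert) auto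
      also have "\<dots> = f (u a) \<oplus>\<^bsub>P\<^esub> (\<Oplus>\<^bsub>P\<^esub>k\<in>A. f (u k))"
        using insert s mod_homD(2)[OF f] by simp
      also have "\<dots> = (\<Oplus>\<^bsub>P\<^esub>k\<in>insert a A. f (u k))"
        using insert mod_homD(1)[OF f] by (subst P.finsum_insert) auto
      finally show ?case .
    qed
  qed (simp add: mod_hom_zero[OF N P f])
qed

lemma submodule_image:
  assumes N: "module R N" and P: "module R P" and f: "f \<in> mod_hom R N P" and X: "submodule X R N"
  shows "submodule (f ` X) R P"
proof -
  interpret N: module R N by fact
  interpret P: module R P by fact
  note X' = N.submoduleE[OF X]
  have c: "x \<in> carrier N" if "x \<in> X" for x using that X'(1) by auto
  show ?thesis
  proof (rule P.submoduleI)
    show "f ` X \<subseteq> carrier P" using c mod_homD(1)[OF f] by auto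
    show "\<zero>\<^bsub>P\<^esub> \<in> f ` X"
      using N.submodule_zero[OF X] mod_hom_zero[OF N P f] by (metis imageI)
    show "\<ominus>\<^bsub>P\<^esub> a \<in> f ` X" if "a \<in> f ` X" for a
      using that X'(3) c by (auto simp: mod_hom_minus[OF N P f, symmetric])
    show "a \<oplus>\<^bsub>P\<^esub> b \<in> f ` X" if "a \<in> f ` X" "b \<in> f ` X" for a b
      using that X'(5) c by (auto simp: mod_homD(2)[OF f, symmetric])
    show "a \<odot>\<^bsub>P\<^esub> b \<in> f ` X" if "a \<in> carrier R" "b \<in> f ` X" for a b
      using that X'(4) c by (auto simp: mod_homD(3)[OF f, symmetric])
  qed
qed

lemma submodule_preimage:
  assumes N: "module R N" and P: "module R P" and f: "f \<in> mod_hom R N P"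
    and X: "submodule X R N" and U: "submodule U R P"
  shows "submodule {x \<in> X. f x \<in> U} R N"
proof -
  interpret N: module R N by fact
  interpret P: module R P by fact
  note X' = N.submoduleE[OF X] and U' = P.submoduleE[OF U]
  have c: "x \<in> carrier N" if "x \<in> X" for x using that X'(1) by auto
  show ?thesis
    by (rule N.submoduleI)
       (use X' U' c N.submodule_zero[OF X] P.submodule_zero[OF U] mod_hom_zero[OF N P f]
         mod_hom_minus[OF N P f] mod_homD[OF f] in auto)
qed

lemma submodule_kernel:
  assumes N: "module R N" and P: "module R P" and f: "f \<in> mod_hom R N P"
  shows "submodule (a_kernel N P f) R N"
proof -
  interpret N: module R N by fact
  interpret P: module R P by fact
  have "a_kernel N P f = {x \<in> carrier N. f x \<in> {\<zero>\<^bsub>P\<^esub>}}" by (auto simp: a_kernel_def')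
  then show ?thesis
    using submodule_preimage[OF N P f N.carrier_is_submodule P.submodule_zero_set] by simp
qed

lemma restrict_module:
  assumes "module R N" "submodule S R N" shows "module R (N\<lparr>carrier := S\<rparr>)"
  by (rule submodule.submodule_is_module[OF assms(2,1)])

lemma mod_hom_corestrict:
  assumes "f \<in> mod_hom R N P" "f ` carrier N \<subseteq> S"
  shows "f \<in> mod_hom R N (P\<lparr>carrier := S\<rparr>)"
  using assms unfolding mod_hom_def by auto

lemma mod_hom_inverse:
  assumes N: "module R N" and P: "module R P" and f: "f \<in> mod_hom R N P"
    and b: "bij_betw f (carrier N) (carrier P)"
  shows "the_inv_into (carrier N) f \<in> mod_hom R P N"
    and "bij_betw (the_inv_into (carrier N) f) (carrier P) (carrier N)"
proof -
  interpret N: module R N by fact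
  interpret P: module R P by fact
  let ?g = "the_inv_into (carrier N) f"
  have inj: "inj_on f (carrier N)" and im: "f ` carrier N = carrier P" using b by (auto simp: bij_betw_def)
  have gc: "?g y \<in> carrier N" and fg: "f (?g y) = y" if "y \<in> carrier P" for y
    using that the_inv_into_into[OF inj] f_the_inv_into_f[OF inj] im by auto
  have gf: "?g (f x) = x" if "x \<in> carrier N" for x using the_inv_into_f_f[OF inj that] .
  show "?g \<in> mod_hom R P N"
    unfolding mod_hom_def
  proof (intro CollectI conjI ballI)
    fix x y assume "x \<in> carrier P" "y \<in> carrier P"
    then show "?g (x \<oplus>\<^bsub>P\<^esub> y) = ?g x \<oplus>\<^bsub>N\<^esub> ?g y"
      using gf[of "?g x \<oplus>\<^bsub>N\<^esub> ?g y"] mod_homD(2)[OF f] gc fg by simp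
  next
    fix a x assume "a \<in> carrier R" "x \<in> carrier P"
    then show "?g (a \<odot>\<^bsub>P\<^esub> x) = a \<odot>\<^bsub>N\<^esub> ?g x"
      using gf[of "a \<odot>\<^bsub>N\<^esub> ?g x"] mod_homD(3)[OF f] gc fg by simp
  qed (use gc in auto)
  show "bij_betw ?g (carrier P) (carrier N)" by (rule bij_betw_the_inv_into[OF b])
qed

lemma mod_hom_inj:
  assumes N: "module R N" and P: "module R P" and f: "f \<in> mod_hom R N P"
    and k: "\<And>x. x \<in> carrier N \<Longrightarrow> f x = \<zero>\<^bsub>P\<^esub> \<Longrightarrow> x = \<zero>\<^bsub>N\<^esub>"
  shows "inj_on f (carrier N)"
proof (rule inj_onI)
  interpret N: module R N by fact
  interpret P: module R P by fact
  fix x y assume xy: "x \<in> carrier N" "y \<in> carrier N" "f x = f y"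
  then have "f (x \<ominus>\<^bsub>N\<^esub> y) = \<zero>\<^bsub>P\<^esub>"
    using mod_hom_diff[OF N P f] mod_homD(1)[OF f] by (simp add: a_minus_def P.r_neg)
  then have "x \<ominus>\<^bsub>N\<^esub> y = \<zero>\<^bsub>N\<^esub>" using k xy by simp
  then show "x = y" using xy by (metis N.M.add.inv_solve_right' N.M.l_zero N.M.zero_closed a_minus_def)
qed


section \<open>Length\<close>

text \<open>The length of \<open>X/Y\<close>, as the supremum of the lengths of the chains of submodules of \<open>N\<close>
  between \<open>Y\<close> and \<open>X\<close>; this avoids quotient modules.\<close>

definition sub_chain ::
    "('a, 'b) ring_scheme \<Rightarrow> ('a, 'n) module \<Rightarrow> 'n set \<Rightarrow> 'n set \<Rightarrow> nat \<Rightarrow> (nat \<Rightarrow> 'n set) \<Rightarrow> bool" where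
  "sub_chain R N Y X n c \<longleftrightarrow>
     (\<forall>i\<le>n. submodule (c i) R N \<and> Y \<subseteq> c i \<and> c i \<subseteq> X) \<and> (\<forall>i<n. c i \<subset> c (Suc i))"

definition len :: "('a, 'b) ring_scheme \<Rightarrow> ('a, 'n) module \<Rightarrow> 'n set \<Rightarrow> 'n set \<Rightarrow> enat" where
  "len R N Y X = Sup (enat ` {n. \<exists>c. sub_chain R N Y X n c})"

text \<open>A finite bound k forces a to be finite, and the claim becomes Sup S \<le> k - a over the
  naturals. An element of S is what bounds a itself: over the empty set the supremum is 0 and says
  nothing about a.\<close>

lemma enat_add_Sup_le:
  assumes "S \<noteq> {}" "\<And>n. n \<in> S \<Longrightarrow> a + enat n \<le> k"
  shows "a + Sup (enat ` S) \<le> (k :: enat)"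
proof (cases k)
  case (enat k')
  from assms obtain n where n: "n \<in> S" by auto
  obtain a' where a: "a = enat a'"
    using assms(2)[OF n] enat by (cases a) auto
  have "Sup (enat ` S) \<le> enat (k' - a')"
  proof (rule Sup_least)
    fix x assume "x \<in> enat ` S"
    then obtain m where m: "m \<in> S" "x = enat m" by auto
    then have "a' + m \<le> k'" using assms(2)[OF m(1)] enat a by simp
    then show "x \<le> enat (k' - a')" using m by simp
  qed
  then have "a + Sup (enat ` S) \<le> a + enat (k' - a')" by (rule add_left_mono)
  also have "\<dots> = k" using assms(2)[OF n] enat a by auto
  finally show ?thesis .
qed simp

lemma len_ge: "sub_chain R N Y X n c \<Longrightarrow> enat n \<le> len R N Y X"
  unfolding len_def by (auto intro: Sup_upper)

lemma len_le: "(\<And>n c. sub_chain R N Y X n c \<Longrightarrow> enat n \<le> k) \<Longrightarrow> len R N Y X \<le> k"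
  unfolding len_def by (auto intro: Sup_least)

text \<open>The chain consisting of Y alone has length 0, so the set of chain lengths is nonempty
  and a bound on every a + n passes to the supremum.\<close>

lemma add_len_le:
  assumes Y: "submodule Y R N" and YX: "Y \<subseteq> X"
    and *: "\<And>n c. sub_chain R N Y X n c \<Longrightarrow> a + enat n \<le> k"
  shows "a + len R N Y X \<le> k"
  unfolding len_def
proof (rule enat_add_Sup_le)
  have "sub_chain R N Y X 0 (\<lambda>_. Y)" using Y YX by (simp add: sub_chain_def)
  then show "{n. \<exists>c. sub_chain R N Y X n c} \<noteq> {}" by blast
qed (use * in auto)

text \<open>Comparisons of length under inclusions and homomorphisms reduce to this: a strictly
  increasing map g between the two intervals of submodules carries chains to chains with equally
  many steps.\<close>

lemma len_transfer:
  assumes "\<And>U. submodule U R N \<Longrightarrow> Y \<subseteq> U \<Longrightarrow> U \<subseteq> X \<Longrightarrow>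
             submodule (g U) R P \<and> Y' \<subseteq> g U \<and> g U \<subseteq> X'"
    and "\<And>U V. \<lbrakk>submodule U R N; submodule V R N; Y \<subseteq> U; U \<subset> V; V \<subseteq> X\<rbrakk> \<Longrightarrow> g U \<subset> g V"
  shows "len R N Y X \<le> len R P Y' X'"
proof (rule len_le)
  fix n c assume c: "sub_chain R N Y X n c"
  have "sub_chain R P Y' X' n (\<lambda>i. g (c i))"
    unfolding sub_chain_def
  proof (intro conjI allI impI)
    fix i assume "i \<le> n"
    then have "submodule (c i) R N" "Y \<subseteq> c i" "c i \<subseteq> X" using c by (auto simp: sub_chain_def)
    from assms(1)[OF this] show "submodule (g (c i)) R P" "Y' \<subseteq> g (c i)" "g (c i) \<subseteq> X'" by auto
  next
    fix i assume "i < n"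
    then have "submodule (c i) R N" "submodule (c (Suc i)) R N" "Y \<subseteq> c i" "c i \<subset> c (Suc i)"
      "c (Suc i) \<subseteq> X" using c by (auto simp: sub_chain_def)
    from assms(2)[OF this] show "g (c i) \<subset> g (c (Suc i))" .
  qed
  then show "enat n \<le> len R P Y' X'" by (rule len_ge)
qed

lemma len_mono:
  assumes "Y' \<subseteq> Y" "X \<subseteq> X'" shows "len R N Y X \<le> len R N Y' X'"
  by (rule len_transfer[of _ _ _ _ "\<lambda>U. U"]) (use assms in auto)

lemma len_refl [simp]: "len R N X X = 0"
proof -
  have "len R N X X \<le> 0"
  proof (rule len_le)
    fix n c assume c: "sub_chain R N X X n c"
    have "n = 0"
    proof (rule ccontr)
      assume "n \<noteq> 0"
      then have "c 0 \<subset> c (Suc 0)" "X \<subseteq> c 0" "c (Suc 0) \<subseteq> X" using c by (auto simp: sub_chain_def)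
      then show False by auto
    qed
    then show "enat n \<le> 0" by (simp add: zero_enat_def)
  qed
  then show ?thesis by simp
qed

text \<open>A chain of submodules inside A can be prolonged by B as its top member, since its last
  term is contained in A and so is strictly smaller than B.\<close>

lemma len_strict:
  assumes Y: "submodule Y R N" and B: "submodule B R N" and "Y \<subseteq> A" and AB: "A \<subset> B"
  shows "len R N Y A + 1 \<le> len R N Y B"
proof -
  have "1 + len R N Y A \<le> len R N Y B"
  proof (rule add_len_le[OF Y \<open>Y \<subseteq> A\<close>])
    fix n c assume c: "sub_chain R N Y A n c"
    have "sub_chain R N Y B (Suc n) (\<lambda>i. if i \<le> n then c i else B)"
      unfolding sub_chain_def
    proof (intro conjI allI impI)
      fix i assume "i < Suc n"
      then consider "i < n" | "i = n" by linarith
      then show "(if i \<le> n then c i else B) \<subset> (if Suc i \<le> n then c (Suc i) else B)"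
        by cases (use c AB in \<open>auto simp: sub_chain_def\<close>)
    next
      fix i assume "i \<le> Suc n"
      have "submodule (c i) R N" "Y \<subseteq> c i" "c i \<subseteq> A" if "i \<le> n"
        using c that by (auto simp: sub_chain_def)
      then show "submodule (if i \<le> n then c i else B) R N"
        and "Y \<subseteq> (if i \<le> n then c i else B)" and "(if i \<le> n then c i else B) \<subseteq> B"
        using B AB \<open>Y \<subseteq> A\<close> by auto
    qed
    from len_ge[OF this] show "1 + enat n \<le> len R N Y B" by (simp add: one_enat_def)
  qed
  then show ?thesis by (simp add: add.commute)
qed

text \<open>For \<le>, a chain c from Y to Z is split into c_j \<inter> X and c_j + X: both increase
  weakly, and at each step one of them increases strictly. For \<ge>, each step of a chain above X
  adds at least 1 to the length over Y, starting from the length of X over Y.\<close>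

lemma len_additive:
  assumes N: "module R N" and Y: "submodule Y R N" and X: "submodule X R N" and Z: "submodule Z R N"
    and YX: "Y \<subseteq> X" and XZ: "X \<subseteq> Z"
  shows "len R N Y Z = len R N Y X + len R N X Z"
proof (rule antisym)
  interpret N: module R N by fact
  have step: "a + b + 1 \<le> a' + b'" if "a + 1 \<le> a' \<or> b + 1 \<le> b'" "a \<le> a'" "b \<le> b'"
    for a b a' b' :: enat
    using that by (cases a; cases b; cases a'; cases b') (auto simp: one_enat_def)
  show "len R N Y Z \<le> len R N Y X + len R N X Z"
  proof (rule len_le)
    fix n c assume c: "sub_chain R N Y Z n c"
    have cs: "submodule (c j) R N" "Y \<subseteq> c j" "c j \<subseteq> Z" if "j \<le> n" for j
      using c that by (auto simp: sub_chain_def)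
    have "j \<le> n \<Longrightarrow> enat j \<le> len R N Y (c j \<inter> X) + len R N X (c j <+>\<^bsub>N\<^esub> X)" for j
    proof (induction j)
      case 0
      then show ?case by (simp add: zero_enat_def[symmetric])
    next
      case (Suc j)
      let ?A = "c j" and ?B = "c (Suc j)"
      have A: "submodule ?A R N" "Y \<subseteq> ?A" and B: "submodule ?B R N" "Y \<subseteq> ?B" and AB: "?A \<subset> ?B"
        using Suc.prems cs c by (auto simp: sub_chain_def)
      note sA = N.submodule_sum[OF A(1) X] and sB = N.submodule_sum[OF B(1) X]
      have le1: "len R N Y (?A \<inter> X) \<le> len R N Y (?B \<inter> X)" using AB by (intro len_mono) auto
      have sub: "?A <+>\<^bsub>N\<^esub> X \<subseteq> ?B <+>\<^bsub>N\<^esub> X" using AB by (fastforce simp: set_add_mem)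
      then have le2: "len R N X (?A <+>\<^bsub>N\<^esub> X) \<le> len R N X (?B <+>\<^bsub>N\<^esub> X)" by (intro len_mono) auto
      \<comment> \<open>Modular law: if both traces agree, b \<in> c_{j+1} is a + x with a \<in> c_j
        and x \<in> X, so x = b - a lies in c_{j+1} \<inter> X = c_j \<inter> X, and b lies in
        c_j.\<close>
      have "?A \<inter> X \<noteq> ?B \<inter> X \<or> ?A <+>\<^bsub>N\<^esub> X \<noteq> ?B <+>\<^bsub>N\<^esub> X"
      proof (rule ccontr)
        assume eq: "\<not> ?thesis"
        obtain b where b: "b \<in> ?B" "b \<notin> ?A" using AB by auto
        then have "b \<in> ?A <+>\<^bsub>N\<^esub> X" using eq sB(2) by auto
        then obtain a x where ax: "a \<in> ?A" "x \<in> X" "b = a \<oplus>\<^bsub>N\<^esub> x" by (auto simp: set_add_mem)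
        have car: "a \<in> carrier N" "x \<in> carrier N" using ax A X N.submoduleE(1) by blast+
        have "x = b \<ominus>\<^bsub>N\<^esub> a" using ax car by (simp add: a_minus_def N.M.a_comm[of a x] N.M.a_assoc N.M.r_neg)
        then have "x \<in> ?B" using N.submodule_diff[OF B(1) b(1), of a] ax AB by auto
        then have "x \<in> ?A" using eq ax by auto
        then show False using b ax N.submoduleE(5)[OF A(1)] by auto
      qed
      then have "?A \<inter> X \<subset> ?B \<inter> X \<or> ?A <+>\<^bsub>N\<^esub> X \<subset> ?B <+>\<^bsub>N\<^esub> X"
        using sub AB by blast
      moreover have "Y \<subseteq> ?A \<inter> X" using A YX by blast
      ultimately have "len R N Y (?A \<inter> X) + 1 \<le> len R N Y (?B \<inter> X) \<or>
          len R N X (?A <+>\<^bsub>N\<^esub> X) + 1 \<le> len R N X (?B <+>\<^bsub>N\<^esub> X)"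
        using len_strict[OF Y N.submodule_Int[OF B(1) X], of "?A \<inter> X"]
          len_strict[OF X sB(1), of "?A <+>\<^bsub>N\<^esub> X"] sA(3) by blast
      then have "len R N Y (?A \<inter> X) + len R N X (?A <+>\<^bsub>N\<^esub> X) + 1
          \<le> len R N Y (?B \<inter> X) + len R N X (?B <+>\<^bsub>N\<^esub> X)"
        using le1 le2 by (rule step)
      moreover have "enat (Suc j) \<le> len R N Y (?A \<inter> X) + len R N X (?A <+>\<^bsub>N\<^esub> X) + 1"
        using add_right_mono[OF Suc.IH[OF Suc_leD[OF Suc.prems]], of 1] by (simp add: one_enat_def)
      ultimately show ?case by (rule order_trans[rotated])
    qed
    from this[of n] have "enat n \<le> len R N Y (c n \<inter> X) + len R N X (c n <+>\<^bsub>N\<^esub> X)" by simp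
    also have "\<dots> \<le> len R N Y X + len R N X Z"
      using N.submodule_sum(4)[OF cs(1)[of n] X Z] cs[of n] XZ by (intro add_mono len_mono) auto
    finally show "enat n \<le> len R N Y X + len R N X Z" .
  qed
  show "len R N Y X + len R N X Z \<le> len R N Y Z"
  proof (rule add_len_le[OF X XZ])
    fix n c assume c: "sub_chain R N X Z n c"
    have cs: "submodule (c j) R N" "X \<subseteq> c j" "c j \<subseteq> Z" if "j \<le> n" for j
      using c that by (auto simp: sub_chain_def)
    have "j \<le> n \<Longrightarrow> len R N Y X + enat j \<le> len R N Y (c j)" for j
    proof (induction j)
      case 0
      then show ?case using cs[of 0] by (simp add: zero_enat_def[symmetric] len_mono)
    next
      case (Suc j)
      have "len R N Y X + enat (Suc j) = len R N Y X + enat j + 1"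
        by (simp add: add.assoc one_enat_def)
      also have "\<dots> \<le> len R N Y (c j) + 1" using Suc by (intro add_right_mono) auto
      also have "\<dots> \<le> len R N Y (c (Suc j))"
      proof (rule len_strict[OF Y])
        show "submodule (c (Suc j)) R N" using Suc.prems by (rule cs(1))
        show "Y \<subseteq> c j" using order_trans[OF YX cs(2)] Suc.prems by simp
        show "c j \<subset> c (Suc j)" using Suc.prems c by (simp add: sub_chain_def)
      qed
      finally show ?case .
    qed
    from this[of n] show "len R N Y X + enat n \<le> len R N Y Z"
      using cs[of n] len_mono[of Y Y "c n" Z R N] by (meson order.refl order.trans)
  qed
qed

text \<open>The assumptions express that f induces a map out of X/Y whose image contains X'/Y'.
  Taking preimages in X is then strictly increasing on the submodules between Y' and X'.\<close>

lemma len_surj: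
  assumes N: "module R N" and P: "module R P" and f: "f \<in> mod_hom R N P"
    and X: "submodule X R N" and Y': "submodule Y' R P"
    and Y: "\<And>x. x \<in> Y \<Longrightarrow> x \<in> X \<and> f x \<in> Y'"
    and X': "\<And>z. z \<in> X' \<Longrightarrow> \<exists>x\<in>X. \<exists>y\<in>Y'. z = f x \<oplus>\<^bsub>P\<^esub> y"
  shows "len R P Y' X' \<le> len R N Y X"
proof (rule len_transfer[of _ _ _ _ "\<lambda>U. {x \<in> X. f x \<in> U}"])
  interpret N: module R N by fact
  interpret P: module R P by fact
  fix U assume U: "submodule U R P" "Y' \<subseteq> U"
  show "submodule {x \<in> X. f x \<in> U} R N \<and> Y \<subseteq> {x \<in> X. f x \<in> U} \<and> {x \<in> X. f x \<in> U} \<subseteq> X"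
    using submodule_preimage[OF N P f X U(1)] Y U(2) by auto
  fix V assume V: "submodule V R P" "U \<subset> V" "V \<subseteq> X'"
  from V obtain v where v: "v \<in> V" "v \<notin> U" by auto
  with V X' obtain x y where xy: "x \<in> X" "y \<in> Y'" "v = f x \<oplus>\<^bsub>P\<^esub> y" by blast
  have fx: "f x \<in> carrier P" "y \<in> carrier P"
    using xy mod_homD(1)[OF f] N.submoduleE(1)[OF X] P.submoduleE(1)[OF Y'] by auto
  have "f x = v \<ominus>\<^bsub>P\<^esub> y" using xy fx by (simp add: a_minus_def P.M.a_assoc P.M.r_neg)
  moreover have "y \<in> V" using xy U V by blast
  ultimately have "f x \<in> V" using P.submodule_diff[OF V(1) v(1)] by metis
  moreover have "f x \<notin> U" using xy v U P.submoduleE(5)[OF U(1)] by auto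
  ultimately show "{x \<in> X. f x \<in> U} \<subset> {x \<in> X. f x \<in> V}" using V xy by auto
qed

text \<open>The last assumption bounds the kernel of the induced map X \<rightarrow> X'/Y' by Y.
  Hence U \<mapsto> f(U) + Y' is strictly increasing on submodules U containing Y: an equation f v =
  f u + y with y \<in> Y' puts v - u into Y \<subseteq> U.\<close>

lemma len_inj:
  assumes N: "module R N" and P: "module R P" and f: "f \<in> mod_hom R N P"
    and X: "submodule X R N" and X': "submodule X' R P" and Y': "submodule Y' R P" and "Y' \<subseteq> X'"
    and fX: "\<And>x. x \<in> X \<Longrightarrow> f x \<in> X'" and Y: "\<And>x. x \<in> X \<Longrightarrow> f x \<in> Y' \<Longrightarrow> x \<in> Y"
  shows "len R N Y X \<le> len R P Y' X'"
proof (rule len_transfer[of _ _ _ _ "\<lambda>U. f ` U <+>\<^bsub>P\<^esub> Y'"])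
  interpret N: module R N by fact
  interpret P: module R P by fact
  fix U assume U: "submodule U R N" "Y \<subseteq> U"
  note sU = P.submodule_sum[OF submodule_image[OF N P f U(1)] Y']
  show "submodule (f ` U <+>\<^bsub>P\<^esub> Y') R P \<and> Y' \<subseteq> f ` U <+>\<^bsub>P\<^esub> Y' \<and> f ` U <+>\<^bsub>P\<^esub> Y' \<subseteq> X'" if "U \<subseteq> X"
    using sU(1,3) sU(4)[OF X'] fX that \<open>Y' \<subseteq> X'\<close> by blast
  fix V assume V: "submodule V R N" "U \<subset> V" "V \<subseteq> X"
  note sV = P.submodule_sum[OF submodule_image[OF N P f V(1)] Y']
  from V obtain v where v: "v \<in> V" "v \<notin> U" by auto
  have "f v \<notin> f ` U <+>\<^bsub>P\<^esub> Y'"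
  proof
    assume "f v \<in> f ` U <+>\<^bsub>P\<^esub> Y'"
    then obtain u y where uy: "u \<in> U" "y \<in> Y'" "f v = f u \<oplus>\<^bsub>P\<^esub> y" by (auto simp: set_add_mem)
    have car: "u \<in> carrier N" "v \<in> carrier N" "y \<in> carrier P"
      using uy v V U N.submoduleE(1) P.submoduleE(1)[OF Y'] by blast+
    then have "f (v \<ominus>\<^bsub>N\<^esub> u) = y"
      using mod_hom_diff[OF N P f] uy mod_homD(1)[OF f]
      by (simp add: a_minus_def P.M.a_ac P.M.r_neg P.M.r_neg1 P.M.r_neg2)
    then have "v \<ominus>\<^bsub>N\<^esub> u \<in> Y"
      using Y[of "v \<ominus>\<^bsub>N\<^esub> u"] N.submodule_diff[OF V(1) v(1), of u] uy V by blast
    then have "v \<ominus>\<^bsub>N\<^esub> u \<oplus>\<^bsub>N\<^esub> u \<in> U" using U uy N.submoduleE(5)[OF U(1)] by auto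
    then show False using car v by (simp add: a_minus_def N.M.a_assoc N.M.l_neg)
  qed
  moreover have "f v \<in> f ` V <+>\<^bsub>P\<^esub> Y'" using sV(2) v by auto
  moreover have "f ` U <+>\<^bsub>P\<^esub> Y' \<subseteq> f ` V <+>\<^bsub>P\<^esub> Y'" using V by (fastforce simp: set_add_mem)
  ultimately show "f ` U <+>\<^bsub>P\<^esub> Y' \<subset> f ` V <+>\<^bsub>P\<^esub> Y'" by auto
qed

section \<open>Powers of modules and matrices\<close>

text \<open>Additive inverses come for free, as multiplication by -1.\<close>

lemma (in module) submoduleI':
  assumes "H \<subseteq> carrier M" "\<zero>\<^bsub>M\<^esub> \<in> H"
    and "\<And>a b. \<lbrakk>a \<in> H; b \<in> H\<rbrakk> \<Longrightarrow> a \<oplus>\<^bsub>M\<^esub> b \<in> H"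
    and s: "\<And>a x. \<lbrakk>a \<in> carrier R; x \<in> H\<rbrakk> \<Longrightarrow> a \<odot>\<^bsub>M\<^esub> x \<in> H"
  shows "submodule H R M"
proof (rule submoduleI)
  fix a assume a: "a \<in> H"
  then have "\<ominus>\<^bsub>M\<^esub> a = (\<ominus>\<^bsub>R\<^esub> \<one>\<^bsub>R\<^esub>) \<odot>\<^bsub>M\<^esub> a" using assms(1) by (auto simp: smult_l_minus)
  then show "\<ominus>\<^bsub>M\<^esub> a \<in> H" using s a by simp
qed (use assms in auto)

text \<open>The factors may vary with the coordinate because the length of a power is counted along
  submodules with X in the leading slots and Y in the remaining ones.\<close>

definition prod_sub :: "('a, 'n) module \<Rightarrow> nat \<Rightarrow> (nat \<Rightarrow> 'n set) \<Rightarrow> (nat \<Rightarrow> 'n) set" where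
  "prod_sub N n S = {f \<in> carrier (power_module N n). \<forall>k<n. f k \<in> S k}"

abbreviation pow_sub :: "('a, 'n) module \<Rightarrow> nat \<Rightarrow> 'n set \<Rightarrow> (nat \<Rightarrow> 'n) set" where
  "pow_sub N n X \<equiv> prod_sub N n (\<lambda>_. X)"

lemma pow_sub_mem:
  "f \<in> pow_sub N n X \<longleftrightarrow> (\<forall>k<n. f k \<in> carrier N \<and> f k \<in> X) \<and> (\<forall>k\<ge>n. f k = \<zero>\<^bsub>N\<^esub>)"
  by (auto simp: prod_sub_def)

lemma pow_sub_carrier: "pow_sub N n (carrier N) = carrier (power_module N n)"
  by (auto simp: prod_sub_def)

lemma pow_sub_zero:
  assumes "module R N" shows "pow_sub N n {\<zero>\<^bsub>N\<^esub>} = {\<zero>\<^bsub>power_module N n\<^esub>}"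
proof -
  interpret module R N by fact
  show ?thesis
  proof
    show "pow_sub N n {\<zero>\<^bsub>N\<^esub>} \<subseteq> {\<zero>\<^bsub>power_module N n\<^esub>}"
    proof
      fix f assume "f \<in> pow_sub N n {\<zero>\<^bsub>N\<^esub>}"
      then have "f k = \<zero>\<^bsub>N\<^esub>" for k by (cases "k < n") (auto simp: pow_sub_mem)
      then show "f \<in> {\<zero>\<^bsub>power_module N n\<^esub>}" by (auto simp: power_module_def)
    qed
  qed (auto simp: pow_sub_mem power_module_def)
qed

lemma prod_sub_submodule:
  assumes N: "module R N" and S: "\<And>k. k < n \<Longrightarrow> submodule (S k) R N"
  shows "submodule (prod_sub N n S) R (power_module N n)"
proof -
  interpret N: module R N by fact
  interpret P: module R "power_module N n" by (rule power_module_is_module[OF N])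
  show ?thesis
    by (rule P.submoduleI')
       (use N.submodule_zero[OF S] N.submoduleE(4,5)[OF S] in \<open>auto simp: prod_sub_def\<close>)
qed

lemma coord_hom:
  assumes "module R N" shows "(\<lambda>f. f k) \<in> mod_hom R (power_module N n) N"
  using power_carrier[OF assms] by (auto simp: mod_hom_def)

lemma slot_hom:
  assumes "module R N" "k < n"
  shows "(\<lambda>x j. if j = k then x else \<zero>\<^bsub>N\<^esub>) \<in> mod_hom R N (power_module N n)"
proof -
  interpret module R N by fact
  show ?thesis using assms(2) by (auto simp: mod_hom_def fun_eq_iff)
qed

lemma pointwise_hom:
  assumes N: "module R N" and P: "module R P" and f: "f \<in> mod_hom R N P"
  shows "(\<lambda>y k. f (y k)) \<in> mod_hom R (power_module N n) (power_module P n)"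
  using mod_homD[OF f] mod_hom_zero[OF N P f] power_carrier[OF N]
  by (auto simp: mod_hom_def fun_eq_iff)

text \<open>Filter by the submodules S_j with X in the first j slots and Y in the others; the j-th
  coordinate identifies S_{j+1}/S_j with X/Y, so each of the n steps contributes the length of
  X/Y.\<close>

lemma len_pow_sub:
  assumes N: "module R N" and Y: "submodule Y R N" and X: "submodule X R N" and YX: "Y \<subseteq> X"
  shows "len R (power_module N n) (pow_sub N n Y) (pow_sub N n X) = enat n * len R N Y X"
proof -
  interpret N: module R N by fact
  note PM = power_module_is_module[OF N, of n]
  interpret P: module R "power_module N n" by (rule PM)
  define S where "S j = prod_sub N n (\<lambda>k. if k < j then X else Y)" for j
  have S: "submodule (S j) R (power_module N n)" for j
    unfolding S_def using X Y by (intro prod_sub_submodule[OF N]) auto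
  have Smono: "S i \<subseteq> S j" if "i \<le> j" for i j
    using that YX by (fastforce simp: S_def prod_sub_def split: if_splits)
  have step: "len R (power_module N n) (S j) (S (Suc j)) = len R N Y X" if j: "j < n" for j
  proof (rule antisym)
    show "len R (power_module N n) (S j) (S (Suc j)) \<le> len R N Y X"
    proof (rule len_inj[OF PM N coord_hom[OF N] S X Y YX])
      show "x j \<in> X" if "x \<in> S (Suc j)" for x using that j by (auto simp: S_def prod_sub_def)
      show "x \<in> S j" if "x \<in> S (Suc j)" "x j \<in> Y" for x
      proof -
        have "x k \<in> (if k < j then X else Y)" if "k < n" for k
        proof (cases "k = j")
          case False
          then show ?thesis
            using \<open>x \<in> S (Suc j)\<close> that by (auto simp: S_def prod_sub_def less_Suc_eq dest!: spec[of _ k])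
        qed (use \<open>x j \<in> Y\<close> in simp)
        then show ?thesis using that(1) by (simp add: S_def prod_sub_def)
      qed
    qed
    show "len R N Y X \<le> len R (power_module N n) (S j) (S (Suc j))"
    proof (rule len_surj[OF PM N coord_hom[OF N] S Y])
      show "x \<in> S (Suc j) \<and> x j \<in> Y" if "x \<in> S j" for x
      proof
        show "x \<in> S (Suc j)" using that Smono[of j "Suc j"] by auto
        show "x j \<in> Y" using that j by (auto simp: S_def prod_sub_def)
      qed
      fix z assume z: "z \<in> X"
      have zc: "z \<in> carrier N" using z N.submoduleE(1)[OF X] by auto
      have "(\<lambda>i. if i = j then z else \<zero>\<^bsub>N\<^esub>) \<in> S (Suc j)"
        using z zc j N.submodule_zero[OF X] N.submodule_zero[OF Y] by (auto simp: S_def prod_sub_def)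
      then show "\<exists>x\<in>S (Suc j). \<exists>y\<in>Y. z = x j \<oplus>\<^bsub>N\<^esub> y"
        using zc N.submodule_zero[OF Y]
        by (intro bexI[of _ "\<lambda>i. if i = j then z else \<zero>\<^bsub>N\<^esub>"] bexI[of _ "\<zero>\<^bsub>N\<^esub>"]) auto
    qed
  qed
  have "j \<le> n \<Longrightarrow> len R (power_module N n) (S 0) (S j) = enat j * len R N Y X" for j
  proof (induction j)
    case 0
    show ?case by (simp add: zero_enat_def[symmetric])
  next
    case (Suc j)
    have "len R (power_module N n) (S 0) (S (Suc j)) =
        len R (power_module N n) (S 0) (S j) + len R (power_module N n) (S j) (S (Suc j))"
      by (rule len_additive[OF PM S S S]) (auto intro: Smono[THEN subsetD, rotated])
    also have "\<dots> = enat (Suc j) * len R N Y X"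
      using Suc step[of j] by (simp add: eSuc_enat[symmetric] mult_eSuc add.commute)
    finally show ?case .
  qed
  from this[of n] show ?thesis by (simp add: S_def prod_sub_def cong: conj_cong)
qed

text \<open>The matrix is explicit data, not a map of free modules, so that transposed matrices of a
  resolution can act too. Rows from m on are cut off, which makes the value an element of
  \<open>power_module N m\<close>.\<close>

definition mat_act ::
    "('a, 'n) module \<Rightarrow> nat \<Rightarrow> nat \<Rightarrow> (nat \<Rightarrow> nat \<Rightarrow> 'a) \<Rightarrow> (nat \<Rightarrow> 'n) \<Rightarrow> nat \<Rightarrow> 'n" where
  "mat_act N n m t y = (\<lambda>j. if j < m then \<Oplus>\<^bsub>N\<^esub>k\<in>{..<n}. t j k \<odot>\<^bsub>N\<^esub> y k else \<zero>\<^bsub>N\<^esub>)"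

lemma mat_act_hom:
  assumes N: "module R N" and t: "\<And>j k. j < m \<Longrightarrow> k < n \<Longrightarrow> t j k \<in> carrier R"
  shows "mat_act N n m t \<in> mod_hom R (power_module N n) (power_module N m)"
  unfolding mod_hom_def
proof (intro CollectI conjI ballI)
  interpret N: module R N by fact
  have s: "t j k \<odot>\<^bsub>N\<^esub> y k \<in> carrier N" if "j < m" "k < n" "y \<in> carrier (power_module N n)" for j k y
    using t that power_carrier[OF N that(3)] by simp
  show "mat_act N n m t \<in> carrier (power_module N n) \<rightarrow> carrier (power_module N m)"
    using s by (auto simp: mat_act_def intro!: N.finsum_closed)
  { fix x y assume x: "x \<in> carrier (power_module N n)" and y: "y \<in> carrier (power_module N n)"
    have "(\<Oplus>\<^bsub>N\<^esub>k\<in>{..<n}. t j k \<odot>\<^bsub>N\<^esub> (x k \<oplus>\<^bsub>N\<^esub> y k)) =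
       (\<Oplus>\<^bsub>N\<^esub>k\<in>{..<n}. t j k \<odot>\<^bsub>N\<^esub> x k) \<oplus>\<^bsub>N\<^esub> (\<Oplus>\<^bsub>N\<^esub>k\<in>{..<n}. t j k \<odot>\<^bsub>N\<^esub> y k)" if j: "j < m" for j
    proof -
      have "(\<Oplus>\<^bsub>N\<^esub>k\<in>{..<n}. t j k \<odot>\<^bsub>N\<^esub> (x k \<oplus>\<^bsub>N\<^esub> y k)) =
        (\<Oplus>\<^bsub>N\<^esub>k\<in>{..<n}. t j k \<odot>\<^bsub>N\<^esub> x k \<oplus>\<^bsub>N\<^esub> t j k \<odot>\<^bsub>N\<^esub> y k)"
        using s[OF j _ x] s[OF j _ y] t[OF j] power_carrier[OF N x] power_carrier[OF N y]
        by (intro N.finsum_cong') (auto simp: N.smult_r_distr)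
      also have "\<dots> = (\<Oplus>\<^bsub>N\<^esub>k\<in>{..<n}. t j k \<odot>\<^bsub>N\<^esub> x k) \<oplus>\<^bsub>N\<^esub> (\<Oplus>\<^bsub>N\<^esub>k\<in>{..<n}. t j k \<odot>\<^bsub>N\<^esub> y k)"
        using s[OF j _ x] s[OF j _ y] by (intro N.finsum_addf) auto
      finally show ?thesis .
    qed
    then show "mat_act N n m t (x \<oplus>\<^bsub>power_module N n\<^esub> y) =
        mat_act N n m t x \<oplus>\<^bsub>power_module N m\<^esub> mat_act N n m t y"
      by (auto simp: mat_act_def fun_eq_iff) }
  { fix a x assume a: "a \<in> carrier R" and x: "x \<in> carrier (power_module N n)"
    have "(\<Oplus>\<^bsub>N\<^esub>k\<in>{..<n}. t j k \<odot>\<^bsub>N\<^esub> (a \<odot>\<^bsub>N\<^esub> x k)) = a \<odot>\<^bsub>N\<^esub> (\<Oplus>\<^bsub>N\<^esub>k\<in>{..<n}. t j k \<odot>\<^bsub>N\<^esub> x k)"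
      if j: "j < m" for j
    proof -
      have "a \<odot>\<^bsub>N\<^esub> (\<Oplus>\<^bsub>N\<^esub>k\<in>{..<n}. t j k \<odot>\<^bsub>N\<^esub> x k) = (\<Oplus>\<^bsub>N\<^esub>k\<in>{..<n}. a \<odot>\<^bsub>N\<^esub> (t j k \<odot>\<^bsub>N\<^esub> x k))"
        using s[OF j _ x] a by (intro N.finsum_smult_ldistr) auto
      also have "\<dots> = (\<Oplus>\<^bsub>N\<^esub>k\<in>{..<n}. t j k \<odot>\<^bsub>N\<^esub> (a \<odot>\<^bsub>N\<^esub> x k))"
        using t[OF j] a power_carrier[OF N x]
        by (intro N.finsum_cong') (auto simp: N.R.m_comm simp flip: N.smult_assoc1)
      finally show ?thesis by simp
    qed
    then show "mat_act N n m t (a \<odot>\<^bsub>power_module N n\<^esub> x) =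
        a \<odot>\<^bsub>power_module N m\<^esub> mat_act N n m t x"
      using a by (auto simp: mat_act_def fun_eq_iff) }
qed

text \<open>Used in two ways: with f a coordinate R^g \<rightarrow> R, a matrix acting on tuples of
  vectors is computed one coordinate at a time; with f the augmentation, the action on R^g is pushed
  down to the module it covers.\<close>

lemma mat_act_natural:
  assumes N: "module R N" and P: "module R P" and f: "f \<in> mod_hom R N P"
    and t: "\<And>j k. j < m \<Longrightarrow> k < n \<Longrightarrow> t j k \<in> carrier R"
    and y: "\<And>k. k < n \<Longrightarrow> y k \<in> carrier N"
  shows "mat_act P n m t (\<lambda>k. f (y k)) = (\<lambda>j. f (mat_act N n m t y j))"
proof
  fix j
  interpret N: module R N by fact
  interpret P: module R P by fact
  show "mat_act P n m t (\<lambda>k. f (y k)) j = f (mat_act N n m t y j)"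
  proof (cases "j < m")
    case True
    have "f (\<Oplus>\<^bsub>N\<^esub>k\<in>{..<n}. t j k \<odot>\<^bsub>N\<^esub> y k) = (\<Oplus>\<^bsub>P\<^esub>k\<in>{..<n}. f (t j k \<odot>\<^bsub>N\<^esub> y k))"
      using t[OF True] y by (intro mod_hom_finsum[OF N P f]) auto
    also have "\<dots> = (\<Oplus>\<^bsub>P\<^esub>k\<in>{..<n}. t j k \<odot>\<^bsub>P\<^esub> f (y k))"
      using t[OF True] y mod_homD[OF f] by (intro P.finsum_cong') auto
    finally show ?thesis using True by (simp add: mat_act_def)
  qed (simp add: mat_act_def mod_hom_zero[OF N P f])
qed

lemma mod_hom_scalar_mult:
  assumes "module R N" "a \<in> carrier R"
  shows "(\<lambda>x. a \<odot>\<^bsub>N\<^esub> x) \<in> mod_hom R N N"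
proof -
  interpret module R N by fact
  show ?thesis using assms(2)
    by (auto simp: mod_hom_def smult_r_distr R.m_comm simp flip: smult_assoc1)
qed

lemma mod_hom_smult_vector:
  assumes "module R N" "x \<in> carrier N"
  shows "(\<lambda>a. a \<odot>\<^bsub>N\<^esub> x) \<in> mod_hom R (self_module R) N"
proof -
  interpret module R N by fact
  show ?thesis using assms(2)
    by (auto simp: mod_hom_def smult_l_distr smult_assoc1)
qed

lemma lin_comb_hom:
  assumes N: "module R N" and y: "\<And>k. k < n \<Longrightarrow> y k \<in> carrier N"
  shows "(\<lambda>v. \<Oplus>\<^bsub>N\<^esub>k\<in>{..<n}. v k \<odot>\<^bsub>N\<^esub> y k) \<in> mod_hom R (free_module R n) N"
  unfolding mod_hom_def
proof (intro CollectI conjI ballI)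
  interpret N: module R N by fact
  have vc: "v k \<in> carrier R" if "v \<in> carrier (free_module R n)" for v k
    using free_carrier[OF N.R.is_cring that] .
  show "(\<lambda>v. \<Oplus>\<^bsub>N\<^esub>k\<in>{..<n}. v k \<odot>\<^bsub>N\<^esub> y k) \<in> carrier (free_module R n) \<rightarrow> carrier N"
    using vc y by (auto intro!: N.finsum_closed)
  { fix v w assume v: "v \<in> carrier (free_module R n)" and w: "w \<in> carrier (free_module R n)"
    have "(\<Oplus>\<^bsub>N\<^esub>k\<in>{..<n}. (v \<oplus>\<^bsub>free_module R n\<^esub> w) k \<odot>\<^bsub>N\<^esub> y k) =
        (\<Oplus>\<^bsub>N\<^esub>k\<in>{..<n}. v k \<odot>\<^bsub>N\<^esub> y k \<oplus>\<^bsub>N\<^esub> w k \<odot>\<^bsub>N\<^esub> y k)"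
      using vc[OF v] vc[OF w] y by (intro N.finsum_cong') (auto simp: free_module_def N.smult_l_distr)
    also have "\<dots> = (\<Oplus>\<^bsub>N\<^esub>k\<in>{..<n}. v k \<odot>\<^bsub>N\<^esub> y k) \<oplus>\<^bsub>N\<^esub> (\<Oplus>\<^bsub>N\<^esub>k\<in>{..<n}. w k \<odot>\<^bsub>N\<^esub> y k)"
      using vc[OF v] vc[OF w] y by (intro N.finsum_addf) auto
    finally show "(\<Oplus>\<^bsub>N\<^esub>k\<in>{..<n}. (v \<oplus>\<^bsub>free_module R n\<^esub> w) k \<odot>\<^bsub>N\<^esub> y k) =
       (\<Oplus>\<^bsub>N\<^esub>k\<in>{..<n}. v k \<odot>\<^bsub>N\<^esub> y k) \<oplus>\<^bsub>N\<^esub> (\<Oplus>\<^bsub>N\<^esub>k\<in>{..<n}. w k \<odot>\<^bsub>N\<^esub> y k)" . }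
  { fix a v assume a: "a \<in> carrier R" and v: "v \<in> carrier (free_module R n)"
    have "a \<odot>\<^bsub>N\<^esub> (\<Oplus>\<^bsub>N\<^esub>k\<in>{..<n}. v k \<odot>\<^bsub>N\<^esub> y k) = (\<Oplus>\<^bsub>N\<^esub>k\<in>{..<n}. a \<odot>\<^bsub>N\<^esub> (v k \<odot>\<^bsub>N\<^esub> y k))"
      using vc[OF v] y a by (intro N.finsum_smult_ldistr) auto
    also have "\<dots> = (\<Oplus>\<^bsub>N\<^esub>k\<in>{..<n}. (a \<odot>\<^bsub>free_module R n\<^esub> v) k \<odot>\<^bsub>N\<^esub> y k)"
      using vc[OF v] y a by (intro N.finsum_cong') (auto simp: free_module_def N.smult_assoc1)
    finally show "(\<Oplus>\<^bsub>N\<^esub>k\<in>{..<n}. (a \<odot>\<^bsub>free_module R n\<^esub> v) k \<odot>\<^bsub>N\<^esub> y k) =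
        a \<odot>\<^bsub>N\<^esub> (\<Oplus>\<^bsub>N\<^esub>k\<in>{..<n}. v k \<odot>\<^bsub>N\<^esub> y k)" by simp }
qed

lemma lin_comb_unit:
  assumes N: "module R N" and y: "\<And>k. k < n \<Longrightarrow> y k \<in> carrier N" and j: "j < n"
  shows "(\<Oplus>\<^bsub>N\<^esub>k\<in>{..<n}. unit_vector R j k \<odot>\<^bsub>N\<^esub> y k) = y j"
proof -
  interpret N: module R N by fact
  have "(\<Oplus>\<^bsub>N\<^esub>k\<in>{..<n}. unit_vector R j k \<odot>\<^bsub>N\<^esub> y k) = (\<Oplus>\<^bsub>N\<^esub>k\<in>{..<n}. if j = k then y k else \<zero>\<^bsub>N\<^esub>)"
    using y by (intro N.finsum_cong') (auto simp: unit_vector_def)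
  also have "\<dots> = y j" using y j by (intro N.finsum_singleton) auto
  finally show ?thesis .
qed

text \<open>The two could differ only in rows from m on, and there the matrix entries of \<phi>
  vanish because elements of R^m are extended by zero.\<close>

lemma mat_act_eq_tensor_map:
  assumes N: "module R N" and \<phi>: "\<phi> \<in> mod_hom R (free_module R n) (free_module R m)"
    and y: "y \<in> carrier (power_module N n)"
  shows "tensor_map R N n \<phi> y = mat_act N n m (\<lambda>j k. \<phi> (unit_vector R k) j) y"
proof
  fix j
  interpret N: module R N by fact
  show "tensor_map R N n \<phi> y j = mat_act N n m (\<lambda>j k. \<phi> (unit_vector R k) j) y j"
  proof (cases "j < m")
    case False
    have "\<phi> (unit_vector R k) j = \<zero>\<^bsub>R\<^esub>" if "k < n" for k
      using mod_homD(1)[OF \<phi> unit_vector_carrier[OF N.R.is_cring that]] False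
      by (simp add: free_module_def)
    then have "tensor_map R N n \<phi> y j = (\<Oplus>\<^bsub>N\<^esub>k\<in>{..<n}. \<zero>\<^bsub>N\<^esub>)"
      unfolding tensor_map_def using power_carrier[OF N y] by (intro N.finsum_cong') auto
    then show ?thesis using False by (simp add: mat_act_def)
  qed (simp add: tensor_map_def mat_act_def)
qed

text \<open>Over N = R every vector v is the pure tensor of v and 1, so
  \<open>tensor_map_pure\<close> applies.\<close>

lemma mat_act_free:
  assumes R: "cring R" and \<phi>: "\<phi> \<in> mod_hom R (free_module R n) (free_module R m)"
    and v: "v \<in> carrier (free_module R n)"
  shows "mat_act (self_module R) n m (\<lambda>j k. \<phi> (unit_vector R k) j) v = \<phi> v"
proof -
  interpret R: cring R by fact
  note S = self_module_is_module[OF R]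
  have pt: "pure_tensor (self_module R) w \<one>\<^bsub>R\<^esub> = w" if "\<And>k. w k \<in> carrier R" for w
    using that by (auto simp: pure_tensor_def)
  have "tensor_map R (self_module R) n \<phi> (pure_tensor (self_module R) v \<one>\<^bsub>R\<^esub>)
      = pure_tensor (self_module R) (\<phi> v) \<one>\<^bsub>R\<^esub>"
    by (rule tensor_map_pure[OF S \<phi> v]) simp
  then have "tensor_map R (self_module R) n \<phi> v = \<phi> v"
    using pt free_carrier[OF R v] free_carrier[OF R mod_homD(1)[OF \<phi> v]] by metis
  then show ?thesis using mat_act_eq_tensor_map[OF S \<phi>] v by (simp add: free_module_def)
qed

section \<open>Artinian local rings\<close>

text \<open>Any two members of a chain are comparable, so two elements of the union lie in a common
  member.\<close>

lemma (in module) chain_Union_submodule: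
  assumes ne: "C \<noteq> {}" and sub: "\<And>U. U \<in> C \<Longrightarrow> submodule U R M"
    and chain: "\<And>U V. U \<in> C \<Longrightarrow> V \<in> C \<Longrightarrow> U \<subseteq> V \<or> V \<subseteq> U"
  shows "submodule (\<Union>C) R M"
proof (rule submoduleI')
  show "\<Union>C \<subseteq> carrier M" using submoduleE(1)[OF sub] by auto
  show "\<zero>\<^bsub>M\<^esub> \<in> \<Union>C" using ne submodule_zero[OF sub] by auto
  show "a \<oplus>\<^bsub>M\<^esub> b \<in> \<Union>C" if ab: "a \<in> \<Union>C" "b \<in> \<Union>C" for a b
  proof -
    obtain U V where UV: "U \<in> C" "a \<in> U" "V \<in> C" "b \<in> V" using ab by auto
    then consider "a \<in> V" | "b \<in> U" using chain by blast
    then show ?thesis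
      by cases (use UV submoduleE(5)[OF sub] in blast)+
  qed
  show "a \<odot>\<^bsub>M\<^esub> x \<in> \<Union>C" if "a \<in> carrier R" "x \<in> \<Union>C" for a x
    using that submoduleE(4)[OF sub] by auto
qed

text \<open>Zorn's lemma among the submodules between Y and H that omit h. With h = 1 it yields
  maximal ideals; with h outside \<mm>H it yields a hyperplane of H.\<close>

lemma (in module) submodule_avoiding:
  assumes Y: "submodule Y R M" and H: "submodule H R M" and YH: "Y \<subseteq> H" and h: "h \<notin> Y"
  obtains C where "submodule C R M" "Y \<subseteq> C" "C \<subseteq> H" "h \<notin> C"
    "\<And>D. \<lbrakk>submodule D R M; C \<subset> D; D \<subseteq> H\<rbrakk> \<Longrightarrow> h \<in> D"
proof -
  let ?A = "{C. submodule C R M \<and> Y \<subseteq> C \<and> C \<subseteq> H \<and> h \<notin> C}"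
  have "\<exists>M\<in>?A. \<forall>X\<in>?A. M \<subseteq> X \<longrightarrow> X = M"
  proof (rule subset_Zorn_nonempty)
    show "?A \<noteq> {}" using Y YH h by auto
    fix \<C> assume ne: "\<C> \<noteq> {}" and ch: "subset.chain ?A \<C>"
    have sub: "\<C> \<subseteq> ?A" and lin: "\<And>U V. U \<in> \<C> \<Longrightarrow> V \<in> \<C> \<Longrightarrow> U \<subseteq> V \<or> V \<subseteq> U"
      using ch by (auto simp: subset_chain_def)
    have "submodule (\<Union>\<C>) R M"
      by (rule chain_Union_submodule[OF ne _ lin]) (use sub in auto)
    then show "\<Union>\<C> \<in> ?A" using sub ne by blast
  qed
  then obtain C where C: "C \<in> ?A" and max: "\<And>X. X \<in> ?A \<Longrightarrow> C \<subseteq> X \<Longrightarrow> X = C" by auto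
  show ?thesis
  proof (rule that[of C])
    fix D assume "submodule D R M" "C \<subset> D" "D \<subseteq> H"
    then show "h \<in> D" using max[of D] C by auto
  qed (use C in auto)
qed

text \<open>Lets lengths, spans and Zorn's lemma for submodules be applied to ideals.\<close>

lemma (in cring) ideal_iff_submodule: "ideal J R \<longleftrightarrow> submodule J R (self_module R)"
proof
  interpret S: module R "self_module R" by (rule self_module_is_module[OF is_cring])
  { assume J: "ideal J R"
    interpret J: ideal J R by (rule J)
    show "submodule J R (self_module R)"
      by (rule S.submoduleI') (use J.a_subset J.I_l_closed in auto) }
  { assume J: "submodule J R (self_module R)"
    note J' = S.submoduleE[OF J]
    have inv: "\<ominus> a \<in> J" if "a \<in> J" for a
    proof -
      have "\<ominus> a = (\<ominus> \<one>) \<otimes> a" using that J'(1) by (auto simp: l_minus)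
      then show ?thesis using J'(4)[of "\<ominus> \<one>" a] that by simp
    qed
    show "ideal J R"
    proof (rule idealI[OF ring_axioms])
      show "subgroup J (add_monoid R)"
        by unfold_locales (use J' S.submodule_zero[OF J] inv in \<open>auto simp: a_inv_def\<close>)
      fix a x assume "a \<in> J" "x \<in> carrier R"
      then show "x \<otimes> a \<in> J" "a \<otimes> x \<in> J" using J'(1) J'(4)[of x a] by (auto simp: m_comm)
    qed }
qed

locale artinian_local = cring R for R (structure) and \<mm> +
  assumes local: "local_ring R \<mm>" and artinian: "artinian_ring R"
begin

lemma self_mod: "module R (self_module R)"
  by (rule self_module_is_module[OF is_cring])

lemma m_maximal: "maximalideal \<mm> R"
  using local by (simp add: local_ring_def)

lemma m_ideal: "ideal \<mm> R"
  using m_maximal by (simp add: maximalideal_def)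

lemma one_notin_m: "\<one> \<notin> \<mm>"
  using maximalideal.I_notcarr[OF m_maximal] ideal.one_imp_carrier[OF m_ideal] by auto

lemma m_carrier: "a \<in> \<mm> \<Longrightarrow> a \<in> carrier R"
  using ideal.Icarr[OF m_ideal] .

lemma m_sub: "submodule \<mm> R (self_module R)"
  using m_ideal by (simp add: ideal_iff_submodule)

text \<open>An ideal above J that is maximal among those omitting 1 is a maximal ideal, and \<mm> is
  the only one.\<close>

lemma proper_ideal_sub_m:
  assumes J: "ideal J R" and n1: "\<one> \<notin> J" shows "J \<subseteq> \<mm>"
proof -
  interpret S: module R "self_module R" by (rule self_mod)
  obtain C where C: "ideal C R" "J \<subseteq> C" "\<one> \<notin> C"
    and max: "\<And>D. \<lbrakk>ideal D R; C \<subset> D\<rbrakk> \<Longrightarrow> \<one> \<in> D"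
    using S.submodule_avoiding[of J "carrier R" \<one>] J n1 S.carrier_is_submodule
    unfolding ideal_iff_submodule by (metis S.submoduleE(1) self_module_simps(1))
  have "maximalideal C R"
  proof (rule maximalidealI[OF C(1)])
    show "carrier R \<noteq> C" using C by auto
    fix K assume K: "ideal K R" "C \<subseteq> K" "K \<subseteq> carrier R"
    show "K = C \<or> K = carrier R"
      using max[of K] K ideal.one_imp_carrier[OF K(1)] by auto
  qed
  then show ?thesis using local C(2) by (auto simp: local_ring_def)
qed

text \<open>Otherwise the principal ideal of a would omit 1 and therefore lie in \<mm>.\<close>

lemma unit_if_notin_m:
  assumes a: "a \<in> carrier R" "a \<notin> \<mm>" shows "\<exists>b\<in>carrier R. b \<otimes> a = \<one>"
proof -
  have "ideal (PIdl a) R" using a by (simp add: cgenideal_ideal)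
  moreover have "a \<in> PIdl a" using a by (simp add: cgenideal_self)
  ultimately have "\<one> \<in> PIdl a" using proper_ideal_sub_m a(2) by blast
  then show ?thesis by (auto simp: cgenideal_def)
qed

text \<open>The source of all Nakayama arguments below: an equation x = j x with j \<in> \<mm> gives
  x = 0 after cancelling 1 - j.\<close>

lemma one_minus_unit:
  assumes j: "j \<in> \<mm>" shows "\<exists>b\<in>carrier R. b \<otimes> (\<one> \<ominus> j) = \<one>"
proof (rule unit_if_notin_m)
  show "\<one> \<ominus> j \<in> carrier R" using m_carrier[OF j] by simp
  show "\<one> \<ominus> j \<notin> \<mm>"
  proof
    assume "\<one> \<ominus> j \<in> \<mm>"
    then have "(\<one> \<ominus> j) \<oplus> j \<in> \<mm>" using j additive_subgroup.a_closed[OF ideal.axioms(1)[OF m_ideal]] by blast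
    then show False using one_notin_m m_carrier[OF j] by (simp add: a_minus_def a_assoc l_neg)
  qed
qed

section \<open>Descending chains, finite length and socles\<close>

lemma minimal_ideal:
  assumes ne: "J0 \<in> S" and S: "\<And>J. J \<in> S \<Longrightarrow> ideal J R"
  shows "\<exists>J\<in>S. \<forall>K\<in>S. K \<subseteq> J \<longrightarrow> K = J"
proof (rule ccontr)
  assume *: "\<not> ?thesis"
  have no: "\<exists>K\<in>S. K \<subset> J" if "J \<in> S" for J using * that by blast
  have "\<exists>f. \<forall>n. f n \<in> S \<and> f (Suc n) \<subset> f n"
    by (rule dependent_nat_choice) (use ne no in auto)
  then obtain f :: "nat \<Rightarrow> 'a set" where f: "\<And>n. f n \<in> S" "\<And>n. f (Suc n) \<subset> f n" by blast
  have "(\<forall>n. ideal (f n) R) \<and> (\<forall>n. f (Suc n) \<subseteq> f n)" using f S by blast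
  from mp[OF spec[OF conjunct2[OF artinian[unfolded artinian_ring_def]]] this]
  obtain n where n: "\<forall>k\<ge>n. f k = f n" ..
  have "f (Suc n) = f n" by (rule n[rule_format]) simp
  then show False using f(2)[of n] by simp
qed

lemma len_residue: "len R (self_module R) \<mm> (carrier R) = 1"
proof (rule antisym)
  interpret S: module R "self_module R" by (rule self_mod)
  show "len R (self_module R) \<mm> (carrier R) \<le> 1"
  proof (rule len_le)
    fix n c assume c: "sub_chain R (self_module R) \<mm> (carrier R) n c"
    show "enat n \<le> 1"
    proof (rule ccontr)
      assume "\<not> ?thesis"
      then have n: "1 < n" by (simp add: one_enat_def)
      then have "c 0 \<subset> c (Suc 0)" "c (Suc 0) \<subset> c (Suc (Suc 0))" "\<mm> \<subseteq> c 0"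
        "ideal (c (Suc 0)) R" "c (Suc (Suc 0)) \<subseteq> carrier R" "c (Suc 0) \<subseteq> carrier R"
        using c by (auto simp: sub_chain_def ideal_iff_submodule)
      then show False using maximalideal.I_maximal[OF m_maximal, of "c (Suc 0)"] by blast
    qed
  qed
  have "\<mm> \<subset> carrier R" using m_carrier one_notin_m by auto
  from len_strict[OF m_sub _ order.refl this]
  show "1 \<le> len R (self_module R) \<mm> (carrier R)"
    using S.carrier_is_submodule by simp
qed

text \<open>Modulo Y, the set X lies in the cyclic module generated by h, which is an image of
  R/\<mm>, a module of length 1.\<close>

lemma len_cyclic:
  assumes N: "module R N" and Y: "submodule Y R N" and h: "h \<in> carrier N"
    and mh: "\<And>a. a \<in> \<mm> \<Longrightarrow> a \<odot>\<^bsub>N\<^esub> h \<in> Y"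
    and X: "\<And>x. x \<in> X \<Longrightarrow> \<exists>a\<in>carrier R. \<exists>y\<in>Y. x = a \<odot>\<^bsub>N\<^esub> h \<oplus>\<^bsub>N\<^esub> y"
  shows "len R N Y X \<le> 1"
proof -
  interpret S: module R "self_module R" by (rule self_mod)
  have "len R N Y X \<le> len R (self_module R) \<mm> (carrier R)"
    by (rule len_surj[OF self_mod N mod_hom_smult_vector[OF N h] _ Y])
       (use S.carrier_is_submodule m_carrier mh X in auto)
  then show ?thesis by (simp add: len_residue)
qed

text \<open>Let \<open>H\<close> be minimal among the ideals of finite colength. A hyperplane of \<open>H/\<mm>H\<close>, which Zorn's
  lemma provides if \<open>\<mm>H \<noteq> H\<close>, would contradict minimality; and \<open>\<mm>H = H\<close> forces \<open>H = 0\<close>.\<close>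

lemma ring_finite_length: "len R (self_module R) {\<zero>} (carrier R) < \<infinity>"
proof -
  interpret S: module R "self_module R" by (rule self_mod)
  let ?len = "len R (self_module R)"
  let ?S = "{J. ideal J R \<and> ?len J (carrier R) < \<infinity>}"
  have "carrier R \<in> ?S" by (simp add: oneideal zero_enat_def)
  from minimal_ideal[OF this, simplified] obtain H where H: "ideal H R" "?len H (carrier R) < \<infinity>"
    and Hmin: "\<And>K. ideal K R \<Longrightarrow> ?len K (carrier R) < \<infinity> \<Longrightarrow> K \<subseteq> H \<Longrightarrow> K = H"
    by auto
  note Hsub = H(1)[unfolded ideal_iff_submodule]
  have Hc: "h \<in> carrier R" if "h \<in> H" for h using ideal.Icarr[OF H(1) that] .
  have mH: "ideal (\<mm> \<cdot> H) R" "\<mm> \<cdot> H \<subseteq> H"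
    using ideal_prod_is_ideal[OF m_ideal H(1)] ideal_prod_inter[OF m_ideal H(1)] by auto
  have "H \<subseteq> \<mm> \<cdot> H"
  proof
    fix h assume h: "h \<in> H"
    show "h \<in> \<mm> \<cdot> H"
    proof (rule ccontr)
      assume "h \<notin> \<mm> \<cdot> H"
      from S.submodule_avoiding[OF mH(1)[unfolded ideal_iff_submodule] Hsub mH(2) this]
      obtain C where C: "submodule C R (self_module R)" "\<mm> \<cdot> H \<subseteq> C" "C \<subseteq> H" "h \<notin> C"
        and Cmax: "\<And>D. \<lbrakk>submodule D R (self_module R); C \<subset> D; D \<subseteq> H\<rbrakk> \<Longrightarrow> h \<in> D" by metis
      note C' = S.submoduleE[OF C(1)]
      have Cc: "c \<in> carrier R" if "c \<in> C" for c using that C'(1) by auto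
      \<comment> \<open>The class of h generates H/C: for c outside C, maximality puts h into C +
        Rc, say h = c0 + r c; here r is outside \<mm> because \<mm>H \<subseteq> C, so r can be
        inverted.\<close>
      have "\<exists>a\<in>carrier R. \<exists>y\<in>C. c = a \<otimes> h \<oplus> y" if c: "c \<in> H" for c
      proof (cases "c \<in> C")
        case True
        then show ?thesis using Hc[OF h] Cc by (intro bexI[of _ \<zero>] bexI[of _ c]) auto
      next
        case False
        have P: "submodule (PIdl c) R (self_module R)"
          using Hc[OF c] by (simp add: cgenideal_ideal flip: ideal_iff_submodule)
        let ?D = "C <+>\<^bsub>self_module R\<^esub> PIdl c"
        note D = S.submodule_sum[OF C(1) P]
        have cP: "c \<in> PIdl c" using Hc[OF c] by (rule cgenideal_self)
        have "PIdl c \<subseteq> H" by (rule cgenideal_minimal[OF H(1) c])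
        then have "h \<in> ?D"
          using Cmax[OF D(1)] D(2,3) D(4)[OF Hsub C(3)] cP False by blast
        then obtain c0 r where r: "c0 \<in> C" "r \<in> carrier R" "h = c0 \<oplus> r \<otimes> c"
          by (auto simp: set_add_mem cgenideal_def)
        have "r \<notin> \<mm>"
        proof
          assume "r \<in> \<mm>"
          then have "r \<otimes> c \<in> C" using ideal_prod.prod[OF _ c] C(2) by blast
          then show False using r C'(5)[of c0 "r \<otimes> c"] C(4) by simp
        qed
        then obtain b where b: "b \<in> carrier R" "b \<otimes> r = \<one>" using unit_if_notin_m r by auto
        have "b \<otimes> h \<oplus> (\<ominus> b) \<otimes> c0 = (b \<otimes> r) \<otimes> c"
          using b(1) r Hc[OF c] Cc[OF r(1)] by algebra
        then have "c = b \<otimes> h \<oplus> (\<ominus> b) \<otimes> c0" using b Hc[OF c] by simp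
        moreover have "(\<ominus> b) \<otimes> c0 \<in> C" using C'(4)[of "\<ominus> b" c0] b r by simp
        ultimately show ?thesis using b by blast
      qed
      then have "?len C H \<le> 1"
        using subsetD[OF C(2) ideal_prod.prod[OF _ h]] Hc[OF h]
        by (intro len_cyclic[OF self_mod C(1)]) auto
      moreover have "?len C (carrier R) = ?len C H + ?len H (carrier R)"
        using len_additive[OF self_mod C(1) Hsub] S.carrier_is_submodule C(3) Hc by auto
      ultimately have "?len C (carrier R) < \<infinity>"
        using H(2) by (cases "?len C H") (auto simp: plus_eq_infty_iff_enat)
      then have "C = H" using Hmin[of C] C by (simp add: ideal_iff_submodule)
      then show False using C h by simp
    qed
  qed
  have "H = {\<zero>}"
  proof (rule ccontr)
    assume "H \<noteq> {\<zero>}"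
    then obtain h0 where h0: "h0 \<in> H" "h0 \<noteq> \<zero>"
      using additive_subgroup.zero_closed[OF ideal.axioms(1)[OF H(1)]] by auto
    \<comment> \<open>H is not known to be finitely generated, so Nakayama's lemma is replaced by a
      minimal choice: A is minimal among the ideals with AH \<noteq> 0. Since H = \<mm>H and aH
      \<noteq> 0, some a j with j \<in> \<mm> does not kill H either; hence A = (a j), a = r a j,
      and 1 - r j is a unit.\<close>
    let ?T = "{A. ideal A R \<and> (\<exists>a\<in>A. \<exists>h\<in>H. a \<otimes> h \<noteq> \<zero>)}"
    have "\<one> \<otimes> h0 \<noteq> \<zero>" using h0 Hc[OF h0(1)] by simp
    then have "carrier R \<in> ?T" using h0 oneideal by blast
    from minimal_ideal[OF this, simplified] obtain A where A: "ideal A R" "\<exists>a\<in>A. \<exists>h\<in>H. a \<otimes> h \<noteq> \<zero>"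
      and Amin: "\<And>K. K \<in> ?T \<Longrightarrow> K \<subseteq> A \<Longrightarrow> K = A" by auto
    then obtain a h where a: "a \<in> A" and h: "h \<in> H" "a \<otimes> h \<noteq> \<zero>" by auto
    have ac: "a \<in> carrier R" using ideal.Icarr[OF A(1) a] .
    have "\<exists>j\<in>\<mm>. \<exists>h'\<in>H. a \<otimes> (j \<otimes> h') \<noteq> \<zero>"
    proof (rule ccontr)
      assume no: "\<not> ?thesis"
      have "x \<in> carrier R \<and> a \<otimes> x = \<zero>" if "x \<in> \<mm> \<cdot> H" for x
        using that by induction (use no m_carrier Hc ac in \<open>auto simp: r_distr\<close>)
      then show False using h \<open>H \<subseteq> \<mm> \<cdot> H\<close> by blast
    qed
    then obtain j h' where j: "j \<in> \<mm>" "h' \<in> H" "a \<otimes> (j \<otimes> h') \<noteq> \<zero>" by auto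
    have jc: "j \<in> carrier R" using m_carrier[OF j(1)] .
    have "(a \<otimes> j) \<otimes> h' \<noteq> \<zero>" using j ac jc Hc[OF j(2)] by (simp add: m_assoc)
    then have "PIdl (a \<otimes> j) \<in> ?T"
      using j(2) ac jc cgenideal_ideal[of "a \<otimes> j"] cgenideal_self[of "a \<otimes> j"] by auto
    moreover have "PIdl (a \<otimes> j) \<subseteq> A"
      using ideal.I_r_closed[OF A(1) a jc] by (rule cgenideal_minimal[OF A(1)])
    ultimately have "a \<in> PIdl (a \<otimes> j)" using Amin a by blast
    then obtain r where r: "r \<in> carrier R" "a = r \<otimes> (a \<otimes> j)" by (auto simp: cgenideal_def)
    have "r \<otimes> j \<in> \<mm>" using ideal.I_l_closed[OF m_ideal j(1) r(1)] .
    then obtain b where b: "b \<in> carrier R" "b \<otimes> (\<one> \<ominus> r \<otimes> j) = \<one>" using one_minus_unit by auto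
    have "(b \<otimes> (\<one> \<ominus> r \<otimes> j)) \<otimes> a = b \<otimes> (a \<ominus> r \<otimes> (a \<otimes> j))" using b(1) r(1) ac jc by algebra
    also have "\<dots> = \<zero>" using r b(1) ac by (simp add: a_minus_def r_neg)
    finally have "a = \<zero>" using b ac by simp
    then show False using h Hc by simp
  qed
  then show ?thesis using H(2) by simp
qed

text \<open>x is taken from a minimal ideal K strictly above J. If a x were outside J, minimality
  would give K = J + (a x), so x = y + r a x with y \<in> J, and the unit 1 - r a would bring x into
  J.\<close>

lemma socle_above:
  assumes J: "ideal J R" and n1: "\<one> \<notin> J"
  obtains x where "x \<in> carrier R" "x \<notin> J" "\<And>a. a \<in> \<mm> \<Longrightarrow> a \<otimes> x \<in> J"
proof -
  interpret S: module R "self_module R" by (rule self_mod)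
  note J' = J[unfolded ideal_iff_submodule]
  have Jc: "y \<in> carrier R" if "y \<in> J" for y using ideal.Icarr[OF J that] .
  have "carrier R \<in> {K. ideal K R \<and> J \<subset> K}" using n1 Jc oneideal by auto
  from minimal_ideal[OF this, simplified] obtain K where K: "ideal K R" "J \<subset> K"
    and Kmin: "\<And>L. ideal L R \<Longrightarrow> J \<subset> L \<Longrightarrow> L \<subseteq> K \<Longrightarrow> L = K" by auto
  then obtain x where x: "x \<in> K" "x \<notin> J" by auto
  have xc: "x \<in> carrier R" using ideal.Icarr[OF K(1) x(1)] .
  show ?thesis
  proof (rule that[OF xc x(2)])
    fix a assume a: "a \<in> \<mm>"
    have ac: "a \<in> carrier R" using m_carrier[OF a] .
    show "a \<otimes> x \<in> J"
    proof (rule ccontr)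
      assume no: "a \<otimes> x \<notin> J"
      have P: "submodule (PIdl (a \<otimes> x)) R (self_module R)"
        using ac xc by (simp add: cgenideal_ideal flip: ideal_iff_submodule)
      let ?D = "J <+>\<^bsub>self_module R\<^esub> PIdl (a \<otimes> x)"
      note D = S.submodule_sum[OF J' P]
      have "a \<otimes> x \<in> ?D" using D(3) cgenideal_self[of "a \<otimes> x"] ac xc by auto
      moreover have "PIdl (a \<otimes> x) \<subseteq> K"
        using ideal.I_l_closed[OF K(1) x(1) ac] by (rule cgenideal_minimal[OF K(1)])
      ultimately have "?D = K"
        using Kmin[of ?D] D(1,2) D(4)[of K] K no by (auto simp: ideal_iff_submodule)
      then obtain y r where r: "y \<in> J" "r \<in> carrier R" "x = y \<oplus> r \<otimes> (a \<otimes> x)"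
        using x by (auto simp: set_add_mem cgenideal_def)
      have "r \<otimes> a \<in> \<mm>" using ideal.I_l_closed[OF m_ideal a r(2)] .
      then obtain b where b: "b \<in> carrier R" "b \<otimes> (\<one> \<ominus> r \<otimes> a) = \<one>" using one_minus_unit by auto
      have "(b \<otimes> (\<one> \<ominus> r \<otimes> a)) \<otimes> x = b \<otimes> (x \<ominus> r \<otimes> (a \<otimes> x))" using b(1) r(2) ac xc by algebra
      moreover have "x \<ominus> r \<otimes> (a \<otimes> x) = y"
        using r ac xc Jc[OF r(1)] by (metis a_assoc a_inv_closed a_minus_def m_closed r_neg r_zero)
      ultimately have "x = b \<otimes> y" using b xc by simp
      then show False using ideal.I_l_closed[OF J r(1) b(1)] x by simp
    qed
  qed
qed

end

section \<open>Finitely generated modules and minimal resolutions\<close>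

abbreviation lin_comb :: "('a, 'n) module \<Rightarrow> nat \<Rightarrow> (nat \<Rightarrow> 'n) \<Rightarrow> (nat \<Rightarrow> 'a) \<Rightarrow> 'n" where
  "lin_comb N n y \<equiv> \<lambda>v. \<Oplus>\<^bsub>N\<^esub>k\<in>{..<n}. v k \<odot>\<^bsub>N\<^esub> y k"

lemma (in module) submodule_finsum:
  assumes "submodule U R M" "\<And>k. k \<in> A \<Longrightarrow> u k \<in> U"
  shows "(\<Oplus>\<^bsub>M\<^esub>k\<in>A. u k) \<in> U"
proof (cases "finite A")
  case True
  note U = submoduleE[OF assms(1)]
  from True assms(2) have "(\<Oplus>\<^bsub>M\<^esub>k\<in>A. u k) \<in> U"
  proof (induction A)
    case (insert a A)
    have "(\<Oplus>\<^bsub>M\<^esub>k\<in>insert a A. u k) = u a \<oplus>\<^bsub>M\<^esub> (\<Oplus>\<^bsub>M\<^esub>k\<in>A. u k)"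
      using insert U(1) by (intro finsum_insert) auto
    then show ?case using insert U(5) by simp
  qed (simp add: submodule_zero[OF assms(1)])
  then show ?thesis .
qed (simp add: submodule_zero[OF assms(1)])

lemma free_module_is_module: "cring R \<Longrightarrow> module R (free_module R n)"
  unfolding free_module_def by (intro power_module_is_module self_module_is_module)

lemma lin_comb_image_least:
  assumes N: "module R N" and U: "submodule U R N" and y: "\<And>k. k < n \<Longrightarrow> y k \<in> U"
  shows "lin_comb N n y ` carrier (free_module R n) \<subseteq> U"
proof -
  interpret N: module R N by fact
  show ?thesis
    using N.submodule_finsum[OF U] N.submoduleE(4)[OF U] y free_carrier[OF N.R.is_cring]
    by (auto intro!: N.submodule_finsum[OF U])
qed

lemma lin_comb_gen:
  assumes N: "module R N" and y: "\<And>k. k < n \<Longrightarrow> y k \<in> carrier N" and k: "k < n"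
  shows "y k \<in> lin_comb N n y ` carrier (free_module R n)"
proof -
  interpret N: module R N by fact
  show ?thesis
    using lin_comb_unit[OF N y k] unit_vector_carrier[OF N.R.is_cring k]
    by (intro rev_image_eqI[of "unit_vector R k"]) auto
qed

lemma hom_eq_lin_comb:
  assumes "module R N" "f \<in> mod_hom R (free_module R n) N" "v \<in> carrier (free_module R n)"
  shows "f v = lin_comb N n (\<lambda>k. f (unit_vector R k)) v"
  using hom_free_decompose[OF assms] .

lemma hom_free_image_least:
  assumes N: "module R N" and U: "submodule U R N" and f: "f \<in> mod_hom R (free_module R n) N"
    and y: "\<And>k. k < n \<Longrightarrow> f (unit_vector R k) \<in> U"
  shows "f ` carrier (free_module R n) \<subseteq> U"
  using lin_comb_image_least[OF N U, of n "\<lambda>k. f (unit_vector R k)"] y hom_eq_lin_comb[OF N f]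
  by (auto simp: image_subset_iff)

lemma free_zero: "\<zero>\<^bsub>free_module R n\<^esub> = (\<lambda>_. \<zero>\<^bsub>R\<^esub>)"
  by (simp add: free_module_def power_module_def self_module_def)

text \<open>Turns the minimality clause of a resolution into a condition on coordinates. The harder
  inclusion expands v as the sum of v_k e_k with coefficients in J.\<close>

lemma ideal_smult_free:
  assumes R: "cring R" and J: "ideal J R"
  shows "ideal_smult R J (free_module R n) = pow_sub (self_module R) n J"
proof
  interpret R: cring R by fact
  interpret F: module R "free_module R n" by (rule free_module_is_module[OF R])
  note S = self_module_is_module[OF R]
  have Jsub: "submodule J R (self_module R)" using J by (simp add: R.ideal_iff_submodule)
  have P: "submodule (pow_sub (self_module R) n J) R (free_module R n)"
    unfolding free_module_def by (rule prod_sub_submodule[OF S Jsub])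
  have "a \<odot>\<^bsub>free_module R n\<^esub> x \<in> pow_sub (self_module R) n J"
    if "a \<in> J" "x \<in> carrier (free_module R n)" for a x
    using that free_carrier[OF R that(2)] ideal.Icarr[OF J that(1)] ideal.I_r_closed[OF J that(1)]
    by (auto simp: pow_sub_mem free_module_def)
  then show "ideal_smult R J (free_module R n) \<subseteq> pow_sub (self_module R) n J"
    using P unfolding ideal_smult_def module_span_def by blast
  show "pow_sub (self_module R) n J \<subseteq> ideal_smult R J (free_module R n)"
    unfolding ideal_smult_def module_span_def
  proof (intro subsetI InterI)
    fix v U assume v: "v \<in> pow_sub (self_module R) n J"
      and "U \<in> {N. submodule N R (free_module R n) \<and>
        {a \<odot>\<^bsub>free_module R n\<^esub> x |a x. a \<in> J \<and> x \<in> carrier (free_module R n)} \<subseteq> N}"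
    then have U: "submodule U R (free_module R n)"
      "\<And>a x. a \<in> J \<Longrightarrow> x \<in> carrier (free_module R n) \<Longrightarrow> a \<odot>\<^bsub>free_module R n\<^esub> x \<in> U" by auto
    have vc: "v \<in> carrier (free_module R n)" using v by (auto simp: prod_sub_def free_module_def)
    have id: "(\<lambda>x. x) \<in> mod_hom R (free_module R n) (free_module R n)" by (simp add: mod_hom_def)
    have "v = lin_comb (free_module R n) n (unit_vector R) v"
      using hom_eq_lin_comb[OF F.module_axioms id vc] .
    also have "\<dots> \<in> U"
      using v U(2) unit_vector_carrier[OF R] by (intro F.submodule_finsum[OF U(1)]) (auto simp: pow_sub_mem)
    finally show "v \<in> U" .
  qed
qed

section \<open>Minimal covers and minimal free resolutions over an Artinian local ring\<close>

context artinian_local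
begin

abbreviation "free \<equiv> free_module R"
abbreviation "ring_len \<equiv> len R (self_module R) {\<zero>} (carrier R)"
abbreviation "m_free n \<equiv> pow_sub (self_module R) n \<mm>"

lemma free_mod: "module R (free n)"
  by (rule free_module_is_module[OF is_cring])

lemma pow_free_sub: "ideal J R \<Longrightarrow> submodule (pow_sub (self_module R) n J) R (free n)"
  unfolding free_module_def ideal_iff_submodule by (rule prod_sub_submodule[OF self_mod])

lemma pow_sub_free_carrier: "pow_sub (self_module R) n X \<subseteq> carrier (free n)"
  by (auto simp: prod_sub_def free_module_def)

lemma len_free_pow:
  assumes "ideal J R" "ideal K R" "J \<subseteq> K"
  shows "len R (free n) (pow_sub (self_module R) n J) (pow_sub (self_module R) n K)
    = enat n * len R (self_module R) J K"
  unfolding free_module_def using assms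
  by (intro len_pow_sub[OF self_mod]) (auto simp: ideal_iff_submodule)

lemma pow_sub_carrier_free: "pow_sub (self_module R) n (carrier R) = carrier (free n)"
  using pow_sub_carrier[of "self_module R" n] by (simp add: free_module_def)

lemma len_free: "len R (free n) {\<zero>\<^bsub>free n\<^esub>} (carrier (free n)) = enat n * ring_len"
proof -
  have "pow_sub (self_module R) n {\<zero>} = {\<zero>\<^bsub>free n\<^esub>}"
    using pow_sub_zero[OF self_mod, of n] by (simp add: free_module_def)
  then show ?thesis
    using len_free_pow[OF zeroideal oneideal, of n] by (simp add: pow_sub_carrier_free)
qed

lemma len_free_residue: "len R (free n) (m_free n) (carrier (free n)) = enat n"
  using len_free_pow[OF m_ideal oneideal, of n] m_carrier
  by (simp add: pow_sub_carrier_free len_residue subsetI)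

lemma len_free_image_le:
  assumes N: "module R N" and f: "f \<in> mod_hom R (free n) N"
  shows "len R N {\<zero>\<^bsub>N\<^esub>} (f ` carrier (free n)) \<le> enat n * ring_len"
proof -
  interpret N: module R N by fact
  interpret F: module R "free n" by (rule free_mod)
  have "len R N {\<zero>\<^bsub>N\<^esub>} (f ` carrier (free n)) \<le> len R (free n) {\<zero>\<^bsub>free n\<^esub>} (carrier (free n))"
    by (rule len_surj[OF free_mod N f F.carrier_is_submodule N.submodule_zero_set])
       (use mod_hom_zero[OF free_mod N f] mod_homD(1)[OF f] in \<open>auto intro!: bexI\<close>)
  then show ?thesis by (simp add: len_free)
qed

text \<open>As long as a finite tuple in X does not generate X, adjoining an element outside its
  span makes the span strictly longer; if this never stopped, X would have infinite length.\<close>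

lemma finite_len_generated:
  assumes N: "module R N" and X: "submodule X R N" and fin: "len R N {\<zero>\<^bsub>N\<^esub>} X < \<infinity>"
  shows "\<exists>n y. (\<forall>k<n. y k \<in> X) \<and> lin_comb N n y ` carrier (free n) = X"
proof (rule ccontr)
  assume no: "\<not> ?thesis"
  interpret N: module R N by fact
  interpret F: module R "free n" for n by (rule free_mod)
  have Xc: "x \<in> carrier N" if "x \<in> X" for x using that N.submoduleE(1)[OF X] by auto
  have long: "\<exists>n y. (\<forall>k<n. y k \<in> X) \<and> enat j \<le> len R N {\<zero>\<^bsub>N\<^esub>} (lin_comb N n y ` carrier (free n))" for j
  proof (induction j)
    case 0
    show ?case by (rule exI[of _ 0]) (simp add: zero_enat_def[symmetric])
  next
    case (Suc j)
    then obtain n y where y: "\<And>k. k < n \<Longrightarrow> y k \<in> X"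
      and j: "enat j \<le> len R N {\<zero>\<^bsub>N\<^esub>} (lin_comb N n y ` carrier (free n))" by auto
    let ?U = "lin_comb N n y ` carrier (free n)"
    have "?U \<subseteq> X" using lin_comb_image_least[OF N X] y by blast
    then obtain x where x: "x \<in> X" "x \<notin> ?U" using no y by blast
    define y' where "y' = y(n := x)"
    let ?V = "lin_comb N (Suc n) y' ` carrier (free (Suc n))"
    have y': "y' k \<in> X" if "k < Suc n" for k using that x y by (auto simp: y'_def less_Suc_eq)
    have hom: "lin_comb N n y \<in> mod_hom R (free n) N"
      "lin_comb N (Suc n) y' \<in> mod_hom R (free (Suc n)) N"
      using y y' Xc by (intro lin_comb_hom[OF N]; blast)+
    note U = submodule_image[OF free_mod N hom(1) F.carrier_is_submodule]
    note V = submodule_image[OF free_mod N hom(2) F.carrier_is_submodule]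
    have gen: "y' k \<in> ?V" if "k < Suc n" for k
      using lin_comb_gen[OF N _ that, of y'] y' Xc by blast
    have "?U \<subseteq> ?V"
    proof (rule lin_comb_image_least[OF N V])
      fix k assume "k < n"
      then show "y k \<in> ?V" using gen[of k] by (simp add: y'_def)
    qed
    moreover have "x \<in> ?V" using gen[of n] by (simp add: y'_def)
    ultimately have "?U \<subset> ?V" using x by blast
    from len_strict[OF N.submodule_zero_set V _ this] N.submodule_zero[OF U]
    have "len R N {\<zero>\<^bsub>N\<^esub>} ?U + 1 \<le> len R N {\<zero>\<^bsub>N\<^esub>} ?V" by simp
    moreover have "enat (Suc j) \<le> len R N {\<zero>\<^bsub>N\<^esub>} ?U + 1"
      using add_right_mono[OF j, of 1] by (simp add: one_enat_def)
    ultimately have "enat (Suc j) \<le> len R N {\<zero>\<^bsub>N\<^esub>} ?V" by (rule order_trans[rotated])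
    then show ?case using y' by blast
  qed
  have *: "enat j \<le> len R N {\<zero>\<^bsub>N\<^esub>} X" for j
  proof -
    obtain n y where y: "\<forall>k<n. y k \<in> X"
      and j: "enat j \<le> len R N {\<zero>\<^bsub>N\<^esub>} (lin_comb N n y ` carrier (free n))"
      using long[of j] by blast
    note j
    also have "len R N {\<zero>\<^bsub>N\<^esub>} (lin_comb N n y ` carrier (free n)) \<le> len R N {\<zero>\<^bsub>N\<^esub>} X"
      using lin_comb_image_least[OF N X] y by (intro len_mono) auto
    finally show ?thesis .
  qed
  obtain l where "len R N {\<zero>\<^bsub>N\<^esub>} X = enat l" using fin by auto
  then show False using *[of "Suc l"] by simp
qed

text \<open>A generating tuple of least size n works: a relation with a coefficient v_k outside
  \<mm> could be solved for y_k, leaving n - 1 generators.\<close>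

lemma minimal_cover:
  assumes N: "module R N" and X: "submodule X R N" and fin: "len R N {\<zero>\<^bsub>N\<^esub>} X < \<infinity>"
  shows "\<exists>n f. f \<in> mod_hom R (free n) N \<and> f ` carrier (free n) = X \<and> a_kernel (free n) N f \<subseteq> m_free n"
proof -
  interpret N: module R N by fact
  interpret F: module R "free n" for n by (rule free_mod)
  have Xc: "x \<in> carrier N" if "x \<in> X" for x using that N.submoduleE(1)[OF X] by auto
  define P where "P n \<longleftrightarrow> (\<exists>y. (\<forall>k<n. y k \<in> X) \<and> lin_comb N n y ` carrier (free n) = X)" for n
  define n where "n = (LEAST n. P n)"
  have "\<exists>n. P n" using finite_len_generated[OF assms] by (simp add: P_def)
  then have Pn: "P n" and least: "\<And>k. P k \<Longrightarrow> n \<le> k"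
    unfolding n_def by (auto intro: LeastI_ex Least_le)
  then obtain y where y: "\<And>k. k < n \<Longrightarrow> y k \<in> X" and im: "lin_comb N n y ` carrier (free n) = X"
    by (auto simp: P_def)
  have yc: "y k \<in> carrier N" if "k < n" for k using y[OF that] Xc by blast
  have hom: "lin_comb N n y \<in> mod_hom R (free n) N" using yc by (rule lin_comb_hom[OF N])
  have "v k \<in> \<mm>" if v: "v \<in> carrier (free n)" "lin_comb N n y v = \<zero>\<^bsub>N\<^esub>" and k: "k < n" for v k
  proof (rule ccontr)
    assume nm: "v k \<notin> \<mm>"
    have vc: "v k \<in> carrier R" for k using free_carrier[OF is_cring v(1)] .
    obtain p where p: "n = Suc p" using k by (cases n) auto
    \<comment> \<open>\<open>z\<close> is the tuple \<open>y\<close> with its k-th member removed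
      and the later ones moved down by one.\<close>
    define z where "z j = (if j < k then y j else y (Suc j))" for j
    let ?U = "lin_comb N p z ` carrier (free p)"
    have z: "z j \<in> X" if "j < p" for j using that k p y by (auto simp: z_def)
    then have zc: "z j \<in> carrier N" if "j < p" for j using that Xc by blast
    have U: "submodule ?U R N"
      using lin_comb_hom[OF N zc] by (rule submodule_image[OF free_mod N _ F.carrier_is_submodule])
    have gen: "z j \<in> ?U" if "j < p" for j using lin_comb_gen[OF N zc that] .
    have yU: "y j \<in> ?U" if "j < n" "j \<noteq> k" for j
    proof (cases "j < k")
      case True
      then have "z j = y j" by (simp add: z_def)
      then show ?thesis using gen[of j] k p True by simp
    next
      case False
      then obtain i where i: "j = Suc i" "k \<le> i" using False \<open>j \<noteq> k\<close> by (cases j) auto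
      then have "z i = y j" by (simp add: z_def)
      then show ?thesis using gen[of i] that p i by simp
    qed
    have "{..<n} = insert k ({..<n} - {k})" using k by auto
    then have "lin_comb N n y v = (\<Oplus>\<^bsub>N\<^esub>j\<in>insert k ({..<n} - {k}). v j \<odot>\<^bsub>N\<^esub> y j)" by simp
    also have "\<dots> = v k \<odot>\<^bsub>N\<^esub> y k \<oplus>\<^bsub>N\<^esub> (\<Oplus>\<^bsub>N\<^esub>j\<in>{..<n} - {k}. v j \<odot>\<^bsub>N\<^esub> y j)"
      using vc yc k by (intro N.finsum_insert) auto
    finally have eq: "v k \<odot>\<^bsub>N\<^esub> y k \<oplus>\<^bsub>N\<^esub> (\<Oplus>\<^bsub>N\<^esub>j\<in>{..<n} - {k}. v j \<odot>\<^bsub>N\<^esub> y j) = \<zero>\<^bsub>N\<^esub>"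
      using v(2) by simp
    have sU: "(\<Oplus>\<^bsub>N\<^esub>j\<in>{..<n} - {k}. v j \<odot>\<^bsub>N\<^esub> y j) \<in> ?U"
      using yU vc N.submoduleE(4)[OF U] by (intro N.submodule_finsum[OF U]) auto
    have "v k \<odot>\<^bsub>N\<^esub> y k = \<ominus>\<^bsub>N\<^esub> (\<Oplus>\<^bsub>N\<^esub>j\<in>{..<n} - {k}. v j \<odot>\<^bsub>N\<^esub> y j)"
      using subsetD[OF N.submoduleE(1)[OF U] sU] N.smult_closed[OF vc yc[OF k]]
      by (intro N.M.minus_equality[symmetric, OF eq])
    then have vU: "v k \<odot>\<^bsub>N\<^esub> y k \<in> ?U" using N.submoduleE(3)[OF U sU] by simp
    obtain b where b: "b \<in> carrier R" "b \<otimes> v k = \<one>" using unit_if_notin_m[OF vc nm] by auto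
    have "b \<odot>\<^bsub>N\<^esub> (v k \<odot>\<^bsub>N\<^esub> y k) = y k"
      using b vc yc[OF k] by (metis N.smult_assoc1 N.smult_one)
    then have yk: "y k \<in> ?U" using N.submoduleE(4)[OF U b(1) vU] by simp
    have "y j \<in> ?U" if "j < n" for j using yU[OF that] yk by (cases "j = k") auto
    then have "X \<subseteq> ?U" using lin_comb_image_least[OF N U, of n y] im by blast
    moreover have "?U \<subseteq> X" using lin_comb_image_least[OF N X] z by blast
    ultimately have "P p" using z unfolding P_def by blast
    then show False using least[of p] p by simp
  qed
  then have "a_kernel (free n) N (lin_comb N n y) \<subseteq> m_free n"
    using free_carrier[OF is_cring] by (auto simp: a_kernel_def' prod_sub_def free_module_def)
  then show ?thesis using hom im by blast
qed

lemma submodule_free_finite_len: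
  assumes "submodule K R (free n)" shows "len R (free n) {\<zero>\<^bsub>free n\<^esub>} K < \<infinity>"
proof -
  interpret F: module R "free n" by (rule free_mod)
  have "len R (free n) {\<zero>\<^bsub>free n\<^esub>} K \<le> len R (free n) {\<zero>\<^bsub>free n\<^esub>} (carrier (free n))"
    using F.submoduleE(1)[OF assms] by (intro len_mono) auto
  also have "\<dots> = enat n * ring_len" by (rule len_free)
  also have "\<dots> < \<infinity>" using ring_finite_length by auto
  finally show ?thesis .
qed

text \<open>Each kernel is a submodule of a free module of finite length, so it has a minimal cover
  again; dependent choice strings the covers together. The invariant records that the kernel of each
  map lies in \<mm> times its source, and this is what makes the next differential minimal.\<close>

lemma minimal_resolution_exists:
  assumes L: "module R L" and fin: "len R L {\<zero>\<^bsub>L\<^esub>} (carrier L) < \<infinity>"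
  shows "\<exists>\<beta> \<epsilon> d. minimal_free_resolution R \<mm> L \<beta> \<epsilon> d"
proof -
  interpret L: module R L by fact
  obtain n0 \<epsilon> where \<epsilon>: "\<epsilon> \<in> mod_hom R (free n0) L" "\<epsilon> ` carrier (free n0) = carrier L"
    and k0: "a_kernel (free n0) L \<epsilon> \<subseteq> m_free n0"
    using minimal_cover[OF L L.carrier_is_submodule fin] by blast
  have next_cover: "\<exists>q f. f \<in> mod_hom R (free q) (free n) \<and> f ` carrier (free q) = K \<and>
      a_kernel (free q) (free n) f \<subseteq> m_free q" if "submodule K R (free n)" for n K
    using minimal_cover[OF free_mod that submodule_free_finite_len[OF that]] .
  \<comment> \<open>A triple (p, q, f) stands for a differential f from R^q to R^p; the clause for i
    = 0 ties the first one to the augmentation.\<close>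
  let ?P = "\<lambda>i::nat. \<lambda>(p, q, f). f \<in> mod_hom R (free q) (free p) \<and> a_kernel (free q) (free p) f \<subseteq> m_free q
    \<and> (i = 0 \<longrightarrow> p = n0 \<and> f ` carrier (free q) = a_kernel (free n0) L \<epsilon>)"
  let ?Q = "\<lambda>i::nat. \<lambda>(p, q, f). \<lambda>(p', q', f'). p' = q \<and> f' ` carrier (free q') = a_kernel (free q) (free p) f"
  have "\<exists>s. \<forall>i. ?P i (s i) \<and> ?Q i (s i) (s (Suc i))"
  proof (rule dependent_nat_choice)
    obtain q f where "f \<in> mod_hom R (free q) (free n0)" "f ` carrier (free q) = a_kernel (free n0) L \<epsilon>"
      "a_kernel (free q) (free n0) f \<subseteq> m_free q"
      using next_cover[OF submodule_kernel[OF free_mod L \<epsilon>(1)]] by blast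
    then show "\<exists>x. ?P 0 x" by (intro exI[of _ "(n0, q, f)"]) auto
  next
    fix x i assume P: "?P i x"
    obtain p q f where x: "x = (p, q, f)" by (cases x) auto
    then have f: "f \<in> mod_hom R (free q) (free p)" using P by auto
    obtain q' f' where "f' \<in> mod_hom R (free q') (free q)" "f' ` carrier (free q') = a_kernel (free q) (free p) f"
      "a_kernel (free q') (free q) f' \<subseteq> m_free q'"
      using next_cover[OF submodule_kernel[OF free_mod free_mod f]] by blast
    then show "\<exists>y. ?P (Suc i) y \<and> ?Q i x y" using x by (intro exI[of _ "(q, q', f')"]) auto
  qed
  then obtain s where *: "\<forall>i. ?P i (s i) \<and> ?Q i (s i) (s (Suc i))" by (rule exE)
  have s: "?P i (s i)" "?Q i (s i) (s (Suc i))" for i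
    by (rule conjunct1[OF spec[OF *]], rule conjunct2[OF spec[OF *]])
  define \<beta> where "\<beta> i = fst (s i)" for i
  define d where "d i = snd (snd (s i))" for i
  have q: "fst (snd (s i)) = \<beta> (Suc i)" for i using s(2)[of i] by (auto simp: \<beta>_def split: prod.splits)
  have si: "s i = (\<beta> i, \<beta> (Suc i), d i)" for i using q[of i] by (simp add: \<beta>_def d_def prod_eq_iff)
  have d: "d i \<in> mod_hom R (free (\<beta> (Suc i))) (free (\<beta> i))"
    "a_kernel (free (\<beta> (Suc i))) (free (\<beta> i)) (d i) \<subseteq> m_free (\<beta> (Suc i))"
    "d (Suc i) ` carrier (free (\<beta> (Suc (Suc i)))) = a_kernel (free (\<beta> (Suc i))) (free (\<beta> i)) (d i)" for i
    using s[of i] by (auto simp: si)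
  have b0: "\<beta> 0 = n0" "d 0 ` carrier (free (\<beta> 1)) = a_kernel (free n0) L \<epsilon>" using s(1)[of 0] by (auto simp: si)
  have "d i ` carrier (free (\<beta> (Suc i))) \<subseteq> m_free (\<beta> i)" for i
    using b0 k0 d(2,3) by (cases i) auto
  then have "minimal_free_resolution R \<mm> L \<beta> \<epsilon> d"
    unfolding minimal_free_resolution_def Let_def
    using d b0 \<epsilon> by (simp add: ideal_smult_free[OF is_cring m_ideal])
  then show ?thesis by blast
qed

text \<open>Finite length guarantees that a resolution exists, so the choice in
  \<open>min_res\<close> is a genuine one; all knowledge about \<open>betti\<close> and
  \<open>res_diff\<close> enters here.\<close>

lemma min_res_resolution:
  assumes L: "module R L" and fin: "len R L {\<zero>\<^bsub>L\<^esub>} (carrier L) < \<infinity>"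
  shows "minimal_free_resolution R \<mm> L (betti R \<mm> L) (fst (snd (min_res R \<mm> L))) (res_diff R \<mm> L)"
proof -
  have "\<exists>x. case x of (\<beta>, \<epsilon>, d) \<Rightarrow> minimal_free_resolution R \<mm> L \<beta> \<epsilon> d"
    using minimal_resolution_exists[OF assms] by auto
  then have "case min_res R \<mm> L of (\<beta>, \<epsilon>, d) \<Rightarrow> minimal_free_resolution R \<mm> L \<beta> \<epsilon> d"
    unfolding min_res_def by (rule someI_ex)
  then show ?thesis by (simp add: betti_def res_diff_def case_prod_beta)
qed

lemma finitely_generated_finite_len:
  assumes M: "module R M" and fg: "finitely_generated R M"
  shows "len R M {\<zero>\<^bsub>M\<^esub>} (carrier M) < \<infinity>"
proof -
  interpret M: module R M by fact
  interpret F: module R "free n" for n by (rule free_mod)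
  obtain A where A: "finite A" "A \<subseteq> carrier M" "module_span R M A = carrier M"
    using fg by (auto simp: finitely_generated_def)
  obtain y :: "nat \<Rightarrow> _" where y: "bij_betw y {..<card A} A"
    using ex_bij_betw_nat_finite[OF A(1)] by (auto simp: atLeast0LessThan)
  have yA: "y k \<in> carrier M" if "k < card A" for k using y that A(2) by (auto simp: bij_betw_def)
  let ?U = "lin_comb M (card A) y ` carrier (free (card A))"
  have U: "submodule ?U R M"
    using lin_comb_hom[OF M yA] by (rule submodule_image[OF free_mod M _ F.carrier_is_submodule])
  have "A \<subseteq> ?U"
  proof
    fix a assume "a \<in> A"
    then obtain k where "k < card A" "a = y k" using y by (auto simp: bij_betw_def)
    then show "a \<in> ?U" using lin_comb_gen[OF M, of "card A" y k] yA by simp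
  qed
  then have "carrier M \<subseteq> ?U" using U A(3) unfolding module_span_def by blast
  then have "len R M {\<zero>\<^bsub>M\<^esub>} (carrier M) \<le> len R M {\<zero>\<^bsub>M\<^esub>} ?U" by (intro len_mono) auto
  also have "\<dots> \<le> enat (card A) * ring_len" by (rule len_free_image_le[OF M lin_comb_hom[OF M yA]])
  also have "\<dots> < \<infinity>" using ring_finite_length by auto
  finally show ?thesis .
qed

text \<open>Ideals have finite length, hence finitely many generators. The definition of
  \<open>gorenstein_local_ring\<close> asks for this.\<close>

lemma noetherian: "noetherian_ring R"
proof (rule noetherian_ringI)
  interpret S: module R "self_module R" by (rule self_mod)
  fix J assume J: "ideal J R"
  note J' = J[unfolded ideal_iff_submodule]
  have "len R (self_module R) {\<zero>\<^bsub>self_module R\<^esub>} J \<le> ring_len"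
    using ideal.Icarr[OF J] by (intro len_mono) auto
  then have "len R (self_module R) {\<zero>\<^bsub>self_module R\<^esub>} J < \<infinity>"
    using ring_finite_length by (rule order.strict_trans1)
  from finite_len_generated[OF self_mod J' this] obtain n y
    where y: "\<And>k. k < n \<Longrightarrow> y k \<in> J" and im: "lin_comb (self_module R) n y ` carrier (free n) = J" by auto
  have c: "y ` {..<n} \<subseteq> carrier R" using y ideal.Icarr[OF J] by auto
  have "Idl (y ` {..<n}) \<subseteq> J" using y by (intro genideal_minimal[OF J]) auto
  moreover have "J \<subseteq> Idl (y ` {..<n})"
    using lin_comb_image_least[OF self_mod, of "Idl (y ` {..<n})" n y] genideal_ideal[OF c] genideal_self[OF c] im
    by (auto simp: ideal_iff_submodule)
  ultimately show "\<exists>A\<subseteq>carrier R. finite A \<and> J = Idl A" using c by blast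
qed

end

section \<open>Ideal-free modules\<close>

context module
begin

lemma submodule_abelian_subgroup:
  assumes "submodule K R M" shows "abelian_subgroup K M"
  by (rule abelian_subgroupI3[OF additive_subgroup.intro[OF submodule.axioms(1)[OF assms]]])
     (rule M.abelian_group_axioms)

lemma coset_eq_iff:
  assumes K: "submodule K R M" and x: "x \<in> carrier M" and y: "y \<in> carrier M"
  shows "K +>\<^bsub>M\<^esub> x = K +>\<^bsub>M\<^esub> y \<longleftrightarrow> x \<ominus>\<^bsub>M\<^esub> y \<in> K"
proof
  interpret K: abelian_subgroup K M by (rule submodule_abelian_subgroup[OF K])
  have Kc: "k \<in> carrier M" if "k \<in> K" for k using that submoduleE(1)[OF K] by auto
  { assume "K +>\<^bsub>M\<^esub> x = K +>\<^bsub>M\<^esub> y"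
    then have "x \<in> K +>\<^bsub>M\<^esub> y" using K.a_rcos_self[OF x] by simp
    then obtain k where "k \<in> K" "x = k \<oplus>\<^bsub>M\<^esub> y" by (auto simp: a_r_coset_def')
    then show "x \<ominus>\<^bsub>M\<^esub> y \<in> K" using y Kc by (simp add: a_minus_def M.a_assoc M.r_neg) }
  { assume k: "x \<ominus>\<^bsub>M\<^esub> y \<in> K"
    have "x = (x \<ominus>\<^bsub>M\<^esub> y) \<oplus>\<^bsub>M\<^esub> y" using x y by (simp add: a_minus_def M.a_assoc M.l_neg)
    then have "x \<in> K +>\<^bsub>M\<^esub> y" using k by (auto simp: a_r_coset_def')
    then show "K +>\<^bsub>M\<^esub> x = K +>\<^bsub>M\<^esub> y" using K.a_repr_independence'[of x y] y by simp }
qed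

text \<open>One statement serves both quotients in use: A is the singleton of a for
  \<open>quotient_module\<close> and the coset I + a for \<open>reduction\<close>. The last
  assumption says that all scalars in A act alike on the class of x.\<close>

lemma coset_smult:
  assumes K: "submodule K R M" and a: "a \<in> carrier R" and x: "x \<in> carrier M"
    and A: "a \<in> A" "A \<subseteq> carrier R" and AK: "\<And>b. b \<in> A \<Longrightarrow> (b \<ominus>\<^bsub>R\<^esub> a) \<odot>\<^bsub>M\<^esub> x \<in> K"
  shows "(\<Union>b\<in>A. \<Union>y\<in>K +>\<^bsub>M\<^esub> x. K +>\<^bsub>M\<^esub> (b \<odot>\<^bsub>M\<^esub> y)) = K +>\<^bsub>M\<^esub> (a \<odot>\<^bsub>M\<^esub> x)"
proof -
  interpret K: abelian_subgroup K M by (rule submodule_abelian_subgroup[OF K])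
  have Kc: "k \<in> carrier M" if "k \<in> K" for k using that submoduleE(1)[OF K] by auto
  have "K +>\<^bsub>M\<^esub> (b \<odot>\<^bsub>M\<^esub> y) = K +>\<^bsub>M\<^esub> (a \<odot>\<^bsub>M\<^esub> x)" if b: "b \<in> A" and y: "y \<in> K +>\<^bsub>M\<^esub> x" for b y
  proof -
    obtain k where k: "k \<in> K" "y = k \<oplus>\<^bsub>M\<^esub> x" using y by (auto simp: a_r_coset_def')
    have bc: "b \<in> carrier R" using b A by auto
    have yc: "y \<in> carrier M" using k Kc x by auto
    have "b \<odot>\<^bsub>M\<^esub> y \<ominus>\<^bsub>M\<^esub> a \<odot>\<^bsub>M\<^esub> x = b \<odot>\<^bsub>M\<^esub> k \<oplus>\<^bsub>M\<^esub> (b \<ominus>\<^bsub>R\<^esub> a) \<odot>\<^bsub>M\<^esub> x"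
      using a bc x Kc[OF k(1)] by (simp add: k(2) a_minus_def smult_r_distr smult_l_distr smult_l_minus M.a_assoc)
    also have "\<dots> \<in> K" using AK[OF b] submoduleE(4,5)[OF K] k bc by simp
    finally show ?thesis using coset_eq_iff[OF K] a bc x yc by simp
  qed
  then show ?thesis using A(1) K.a_rcos_self[OF x] by blast
qed

end

context artinian_local
begin

lemma ideal_smult_submodule:
  assumes L: "module R L" and J: "J \<subseteq> carrier R"
  shows "submodule (ideal_smult R J L) R L"
proof -
  interpret L: module R L by fact
  let ?S = "{N. submodule N R L \<and> {a \<odot>\<^bsub>L\<^esub> x |a x. a \<in> J \<and> x \<in> carrier L} \<subseteq> N}"
  have S: "carrier L \<in> ?S" using L.carrier_is_submodule J by auto
  have sub: "submodule N R L" if "N \<in> ?S" for N using that by simp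
  show ?thesis
    unfolding ideal_smult_def module_span_def
  proof (rule L.submoduleI')
    show "\<Inter>?S \<subseteq> carrier L" using S by blast
    show "\<zero>\<^bsub>L\<^esub> \<in> \<Inter>?S" using L.submodule_zero[OF sub] by blast
    show "a \<oplus>\<^bsub>L\<^esub> b \<in> \<Inter>?S" if "a \<in> \<Inter>?S" "b \<in> \<Inter>?S" for a b
      using that L.submoduleE(5)[OF sub] by blast
    show "a \<odot>\<^bsub>L\<^esub> b \<in> \<Inter>?S" if "a \<in> carrier R" "b \<in> \<Inter>?S" for a b
      using that L.submoduleE(4)[OF sub] by blast
  qed
qed

lemma ideal_smult_mem:
  assumes "a \<in> J" "x \<in> carrier L" shows "a \<odot>\<^bsub>L\<^esub> x \<in> ideal_smult R J L"
  using assms unfolding ideal_smult_def module_span_def by blast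

lemma ideal_smult_least:
  assumes "submodule U R L" "\<And>a x. a \<in> J \<Longrightarrow> x \<in> carrier L \<Longrightarrow> a \<odot>\<^bsub>L\<^esub> x \<in> U"
  shows "ideal_smult R J L \<subseteq> U"
  using assms unfolding ideal_smult_def module_span_def by blast

text \<open>The isomorphism of L/IL with (R/I)^n is traded for elements of L: the u_k are lifts of a
  basis, so they generate L modulo IL and are independent modulo I. From here on the arguments stay
  inside L.\<close>

lemma ideal_free_basis:
  assumes L: "module R L" and I: "ideal I R" and free: "ideal_free R I L"
  shows "\<exists>n u. (\<forall>k<n. u k \<in> carrier L) \<and>
    (\<forall>x\<in>carrier L. \<exists>c\<in>carrier (free n). x \<ominus>\<^bsub>L\<^esub> lin_comb L n u c \<in> ideal_smult R I L) \<and>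
    (\<forall>c\<in>carrier (free n). lin_comb L n u c \<in> ideal_smult R I L \<longrightarrow> (\<forall>k<n. c k \<in> I))"
proof -
  interpret L: module R L by fact
  interpret I: ideal I R by fact
  interpret S: module R "self_module R" by (rule self_mod)
  define K where "K = ideal_smult R I L"
  have K: "submodule K R L" unfolding K_def using ideal.Icarr[OF I] by (intro ideal_smult_submodule[OF L]) auto
  interpret K: abelian_subgroup K L by (rule L.submodule_abelian_subgroup[OF K])
  let ?Q = "reduction R I L"
  have Qc: "carrier ?Q = {K +>\<^bsub>L\<^esub> x |x. x \<in> carrier L}"
    by (auto simp: reduction_def Let_def K_def A_RCOSETS_def')
  have Qadd: "(K +>\<^bsub>L\<^esub> x) \<oplus>\<^bsub>?Q\<^esub> (K +>\<^bsub>L\<^esub> y) = K +>\<^bsub>L\<^esub> (x \<oplus>\<^bsub>L\<^esub> y)"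
    if "x \<in> carrier L" "y \<in> carrier L" for x y
    using K.a_rcos_sum[OF that] by (simp add: reduction_def Let_def K_def)
  have Qsm: "(I +> a) \<odot>\<^bsub>?Q\<^esub> (K +>\<^bsub>L\<^esub> x) = K +>\<^bsub>L\<^esub> (a \<odot>\<^bsub>L\<^esub> x)"
    if a: "a \<in> carrier R" and x: "x \<in> carrier L" for a x
  proof -
    have "(b \<ominus> a) \<odot>\<^bsub>L\<^esub> x \<in> K" if b: "b \<in> I +> a" for b
    proof -
      obtain i where i: "i \<in> I" "b = i \<oplus> a" using b by (auto simp: a_r_coset_def')
      then have "b \<ominus> a = i" using a I.Icarr by (simp add: a_minus_def a_assoc r_neg)
      then show ?thesis using ideal_smult_mem[OF i(1) x] by (simp add: K_def)
    qed
    then have "(\<Union>b\<in>I +> a. \<Union>y\<in>K +>\<^bsub>L\<^esub> x. K +>\<^bsub>L\<^esub> (b \<odot>\<^bsub>L\<^esub> y)) = K +>\<^bsub>L\<^esub> (a \<odot>\<^bsub>L\<^esub> x)"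
      using I.a_rcos_self[OF a] a_r_coset_subset_G[OF I.a_subset a]
      by (intro L.coset_smult[OF K a x]) auto
    then show ?thesis by (simp add: reduction_def Let_def K_def)
  qed
  obtain n h where h: "h \<in> mod_hom (R Quot I) ?Q (free_module (R Quot I) n)"
    and bij: "bij_betw h (carrier ?Q) (carrier (free_module (R Quot I) n))"
    using free by (auto simp: ideal_free_def fg_free_def module_isomorphic_def)
  have RI: "carrier (R Quot I) = {I +> a |a. a \<in> carrier R}" "\<zero>\<^bsub>R Quot I\<^esub> = I"
    by (auto simp: FactRing_def A_RCOSETS_def')
  \<comment> \<open>\<open>rep x c\<close> says that the class of x has coordinates c modulo I.
    Coordinates from n on are the coset I, the zero of R/I.\<close>
  define rep where "rep x c \<longleftrightarrow> h (K +>\<^bsub>L\<^esub> x) = (\<lambda>k. if k < n then I +> c k else I)" for x c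
  have QcI: "K +>\<^bsub>L\<^esub> x \<in> carrier ?Q" if "x \<in> carrier L" for x using that Qc by auto
  have rep_ex: "\<exists>c\<in>carrier (free n). rep x c" if x: "x \<in> carrier L" for x
  proof -
    have hx: "h (K +>\<^bsub>L\<^esub> x) \<in> carrier (free_module (R Quot I) n)"
      using mod_homD(1)[OF h QcI[OF x]] .
    then have "\<forall>k. \<exists>a. k < n \<longrightarrow> a \<in> carrier R \<and> h (K +>\<^bsub>L\<^esub> x) k = I +> a"
      by (auto simp: free_module_def RI)
    then obtain c where c: "\<And>k. k < n \<Longrightarrow> c k \<in> carrier R \<and> h (K +>\<^bsub>L\<^esub> x) k = I +> c k" by metis
    have "rep x (\<lambda>k. if k < n then c k else \<zero>)"
      unfolding rep_def using c hx by (auto simp: fun_eq_iff free_module_def RI)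
    moreover have "(\<lambda>k. if k < n then c k else \<zero>) \<in> carrier (free n)" using c by (auto simp: free_module_def)
    ultimately show ?thesis by blast
  qed
  have rep_surj: "\<exists>x\<in>carrier L. rep x c" if c: "\<And>k. k < n \<Longrightarrow> c k \<in> carrier R" for c
  proof -
    have "(\<lambda>k. if k < n then I +> c k else I) \<in> carrier (free_module (R Quot I) n)"
      using c by (auto simp: free_module_def RI)
    then have "(\<lambda>k. if k < n then I +> c k else I) \<in> h ` carrier ?Q" using bij by (simp add: bij_betw_def)
    then show ?thesis using Qc by (auto simp: rep_def)
  qed
  have rep_inj: "x \<ominus>\<^bsub>L\<^esub> y \<in> K" if "rep x c" "rep y c" "x \<in> carrier L" "y \<in> carrier L" for x y c
  proof -
    have "h (K +>\<^bsub>L\<^esub> x) = h (K +>\<^bsub>L\<^esub> y)" using that by (simp add: rep_def)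
    then have "K +>\<^bsub>L\<^esub> x = K +>\<^bsub>L\<^esub> y" using bij QcI that by (auto simp: bij_betw_def inj_on_def)
    then show ?thesis using L.coset_eq_iff[OF K] that by simp
  qed
  have rep_add: "rep (x \<oplus>\<^bsub>L\<^esub> y) (\<lambda>k. c k \<oplus> d k)"
    if "rep x c" "rep y d" "x \<in> carrier L" "y \<in> carrier L" "\<And>k. k < n \<Longrightarrow> c k \<in> carrier R"
      "\<And>k. k < n \<Longrightarrow> d k \<in> carrier R" for x y c d
  proof -
    have "h (K +>\<^bsub>L\<^esub> (x \<oplus>\<^bsub>L\<^esub> y)) = h (K +>\<^bsub>L\<^esub> x) \<oplus>\<^bsub>free_module (R Quot I) n\<^esub> h (K +>\<^bsub>L\<^esub> y)"
      using mod_homD(2)[OF h QcI QcI] Qadd that by simp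
    moreover have "I <+> I = I" using I.a_rcos_sum[of \<zero> \<zero>] I.a_subset by simp
    ultimately show ?thesis
      using that I.a_rcos_sum by (auto simp: rep_def fun_eq_iff free_module_def FactRing_def)
  qed
  have rep_smult: "rep (a \<odot>\<^bsub>L\<^esub> x) (\<lambda>k. a \<otimes> c k)"
    if "rep x c" "x \<in> carrier L" "a \<in> carrier R" "\<And>k. k < n \<Longrightarrow> c k \<in> carrier R" for a x c
  proof -
    have "I +> a \<in> carrier (R Quot I)" using that RI by auto
    then have "h (K +>\<^bsub>L\<^esub> (a \<odot>\<^bsub>L\<^esub> x)) = (I +> a) \<odot>\<^bsub>free_module (R Quot I) n\<^esub> h (K +>\<^bsub>L\<^esub> x)"
      using mod_homD(3)[OF h _ QcI, of "I +> a" x] Qsm that by simp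
    moreover have "rcoset_mult R I (I +> a) I = I"
      using I.rcoset_mult_add[of a \<zero>] that I.a_subset by simp
    ultimately show ?thesis
      using that I.rcoset_mult_add by (auto simp: rep_def fun_eq_iff free_module_def FactRing_def)
  qed
  have uv: "unit_vector R j k \<in> carrier R" for j k by (simp add: unit_vector_def)
  have "\<forall>j. \<exists>x. j < n \<longrightarrow> x \<in> carrier L \<and> rep x (unit_vector R j)"
    using rep_surj uv by metis
  then obtain u where u: "\<And>j. j < n \<Longrightarrow> u j \<in> carrier L" "\<And>j. j < n \<Longrightarrow> rep (u j) (unit_vector R j)" by metis
  have rep0: "rep \<zero>\<^bsub>L\<^esub> (\<lambda>k. \<zero>)"
  proof -
    obtain c where c: "c \<in> carrier (free n)" "rep \<zero>\<^bsub>L\<^esub> c" using rep_ex by blast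
    then show ?thesis using rep_smult[of "\<zero>\<^bsub>L\<^esub>" c \<zero>] free_carrier[OF is_cring c(1)] by simp
  qed
  \<comment> \<open>Induction on the number m of summands, with coordinates truncated at m; the case
    m = n is the linear combination itself.\<close>
  have rep_lc: "rep (\<Oplus>\<^bsub>L\<^esub>k\<in>{..<m}. c k \<odot>\<^bsub>L\<^esub> u k) (\<lambda>k. if k < m then c k else \<zero>)"
    if c: "\<And>k. k < n \<Longrightarrow> c k \<in> carrier R" and "m \<le> n" for c m
    using \<open>m \<le> n\<close>
  proof (induction m)
    case 0
    then show ?case using rep0 by simp
  next
    case (Suc m)
    have car: "(\<Oplus>\<^bsub>L\<^esub>k\<in>{..<m}. c k \<odot>\<^bsub>L\<^esub> u k) \<in> carrier L"
      using u c Suc.prems by (intro L.M.finsum_closed) auto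
    have "(\<Oplus>\<^bsub>L\<^esub>k\<in>{..<Suc m}. c k \<odot>\<^bsub>L\<^esub> u k) = c m \<odot>\<^bsub>L\<^esub> u m \<oplus>\<^bsub>L\<^esub> (\<Oplus>\<^bsub>L\<^esub>k\<in>{..<m}. c k \<odot>\<^bsub>L\<^esub> u k)"
      unfolding lessThan_Suc using u c Suc.prems by (intro L.M.finsum_insert) auto
    moreover have "rep (c m \<odot>\<^bsub>L\<^esub> u m) (\<lambda>k. c m \<otimes> unit_vector R m k)"
      using u c Suc.prems uv by (intro rep_smult) auto
    ultimately have "rep (\<Oplus>\<^bsub>L\<^esub>k\<in>{..<Suc m}. c k \<odot>\<^bsub>L\<^esub> u k)
        (\<lambda>k. c m \<otimes> unit_vector R m k \<oplus> (if k < m then c k else \<zero>))"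
      using rep_add[of "c m \<odot>\<^bsub>L\<^esub> u m" "\<lambda>k. c m \<otimes> unit_vector R m k" _ "\<lambda>k. if k < m then c k else \<zero>"]
        Suc car u c uv by auto
    moreover have "c m \<otimes> unit_vector R m k \<oplus> (if k < m then c k else \<zero>) = (if k < Suc m then c k else \<zero>)"
      if "k < n" for k
      using that Suc.prems c by (auto simp: unit_vector_def less_Suc_eq)
    ultimately show ?case by (auto simp: rep_def fun_eq_iff)
  qed
  have lc: "rep (lin_comb L n u c) c" if "c \<in> carrier (free n)" for c
    using rep_lc[of c n] free_carrier[OF is_cring that] by (simp add: rep_def cong: if_cong)
  have lcc: "lin_comb L n u c \<in> carrier L" if "c \<in> carrier (free n)" for c
    using mod_homD(1)[OF lin_comb_hom[OF L u(1)] that] .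
  show ?thesis
  proof (intro exI[of _ n] exI[of _ u] conjI allI impI ballI)
    show "\<exists>c\<in>carrier (free n). x \<ominus>\<^bsub>L\<^esub> lin_comb L n u c \<in> ideal_smult R I L" if x: "x \<in> carrier L" for x
      using rep_ex[OF x] rep_inj[OF _ lc x lcc] by (auto simp: K_def)
    fix c k assume c: "c \<in> carrier (free n)" "lin_comb L n u c \<in> ideal_smult R I L" "k < n"
    have "lin_comb L n u c \<ominus>\<^bsub>L\<^esub> \<zero>\<^bsub>L\<^esub> \<in> K"
      using c(2) by (intro L.submodule_diff[OF K _ L.submodule_zero[OF K]]) (simp add: K_def)
    then have "K +>\<^bsub>L\<^esub> lin_comb L n u c = K +>\<^bsub>L\<^esub> \<zero>\<^bsub>L\<^esub>" using L.coset_eq_iff[OF K] lcc[OF c(1)] by simp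
    then have "(\<lambda>k. if k < n then I +> c k else I) = (\<lambda>k. if k < n then I +> \<zero> else I)"
      using lc[OF c(1)] rep0 by (simp add: rep_def)
    then have "I +> c k = I +> \<zero>" using c(3) by (auto dest: fun_cong[of _ _ k])
    then have "c k \<in> I +> \<zero>" using I.a_rcos_self[of "c k"] free_carrier[OF is_cring c(1)] by simp
    then show "c k \<in> I" using I.a_subset by simp
  qed (use u in auto)
qed

text \<open>If f x = f v with v \<in> \<mm>R^b, then x - v lies in the kernel and so in \<mm>R^b.
  Thus R^b/\<mm>R^b embeds into the target modulo f(\<mm>R^b).\<close>

lemma minimal_cover_reflects:
  assumes L: "module R L" and f: "f \<in> mod_hom R (free b) L"
    and ker: "a_kernel (free b) L f \<subseteq> m_free b"
    and x: "x \<in> carrier (free b)" "f x \<in> f ` m_free b"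
  shows "x \<in> m_free b"
proof -
  interpret L: module R L by fact
  interpret F: module R "free b" by (rule free_mod)
  obtain v where v: "v \<in> m_free b" "f x = f v" using x(2) by auto
  have vc: "v \<in> carrier (free b)" using v pow_sub_free_carrier by blast
  have "f (x \<ominus>\<^bsub>free b\<^esub> v) = \<zero>\<^bsub>L\<^esub>"
    using mod_hom_diff[OF free_mod L f x(1) vc] v mod_homD(1)[OF f vc] by (simp add: a_minus_def L.r_neg)
  then have "x \<ominus>\<^bsub>free b\<^esub> v \<in> m_free b" using ker x(1) vc by (auto simp: a_kernel_def')
  then have "(x \<ominus>\<^bsub>free b\<^esub> v) \<oplus>\<^bsub>free b\<^esub> v \<in> m_free b"
    using F.submoduleE(5)[OF pow_free_sub[OF m_ideal]] v by blast
  then show ?thesis using x(1) vc by (simp add: a_minus_def F.M.a_assoc F.M.l_neg)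
qed

text \<open>Counting generators gives \<open>b \<le> n\<close> when \<open>L/IL \<cong> (R/I)\<^sup>n\<close>, and then comparing lengths shows that the
  surjection \<open>(R/I)\<^sup>b \<rightarrow> L/IL\<close> is injective.\<close>

lemma ideal_free_kernel:
  assumes L: "module R L" and I: "ideal I R" and I1: "\<one> \<notin> I" and free: "ideal_free R I L"
    and f: "f \<in> mod_hom R (free b) L" and surj: "f ` carrier (free b) = carrier L"
    and ker: "a_kernel (free b) L f \<subseteq> m_free b"
  shows "a_kernel (free b) L f \<subseteq> pow_sub (self_module R) b I"
proof -
  interpret L: module R L by fact
  interpret F: module R "free n" for n by (rule free_mod)
  define K where "K = ideal_smult R I L"
  have K: "submodule K R L" unfolding K_def using ideal.Icarr[OF I] by (intro ideal_smult_submodule[OF L]) auto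
  obtain n u where u: "\<And>k. k < n \<Longrightarrow> u k \<in> carrier L"
    "\<And>x. x \<in> carrier L \<Longrightarrow> \<exists>c\<in>carrier (free n). x \<ominus>\<^bsub>L\<^esub> lin_comb L n u c \<in> K"
    "\<And>c k. c \<in> carrier (free n) \<Longrightarrow> lin_comb L n u c \<in> K \<Longrightarrow> k < n \<Longrightarrow> c k \<in> I"
    using ideal_free_basis[OF L I free, folded K_def] by blast
  have Im: "I \<subseteq> \<mm>" by (rule proper_ideal_sub_m[OF I I1])
  let ?g = "lin_comb L n u"
  have g: "?g \<in> mod_hom R (free n) L" by (rule lin_comb_hom[OF L u(1)])
  \<comment> \<open>\<open>mL\<close> is \<mm>L, written as an image so that
    \<open>minimal_cover_reflects\<close> applies directly.\<close>
  define mL where "mL = f ` m_free b"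
  have mL: "submodule mL R L"
    unfolding mL_def by (rule submodule_image[OF free_mod L f pow_free_sub[OF m_ideal]])
  have scal: "a \<odot>\<^bsub>L\<^esub> x \<in> mL" if a: "a \<in> \<mm>" and x: "x \<in> carrier L" for a x
  proof -
    obtain v where v: "v \<in> carrier (free b)" "x = f v" using x surj by auto
    have "a \<odot>\<^bsub>free b\<^esub> v \<in> m_free b"
      using a v(1) free_carrier[OF is_cring v(1)] ideal.I_r_closed[OF m_ideal a] m_carrier[OF a]
      by (auto simp: pow_sub_mem free_module_def)
    then show ?thesis using mod_homD(3)[OF f m_carrier[OF a] v(1)] v(2) unfolding mL_def by (metis imageI)
  qed
  have KmL: "K \<subseteq> mL" unfolding K_def by (rule ideal_smult_least[OF mL]) (use scal Im in auto)
  have decomp: "\<exists>c\<in>carrier (free n). \<exists>y\<in>K. x = ?g c \<oplus>\<^bsub>L\<^esub> y" if x: "x \<in> carrier L" for x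
  proof -
    obtain c where c: "c \<in> carrier (free n)" "x \<ominus>\<^bsub>L\<^esub> ?g c \<in> K" using u(2)[OF x] by auto
    have "x = ?g c \<oplus>\<^bsub>L\<^esub> (x \<ominus>\<^bsub>L\<^esub> ?g c)"
      using x mod_homD(1)[OF g c(1)] by (simp add: a_minus_def L.M.a_ac L.M.r_neg1 L.M.r_neg2 L.M.a_lcomm L.M.r_neg)
    then show ?thesis using c by blast
  qed
  \<comment> \<open>L/\<mm>L has length at least b, but it is generated by the n lifts of a basis of
    L/IL.\<close>
  have "enat b \<le> len R L mL (carrier L)"
    unfolding len_free_residue[of b, symmetric]
  proof (rule len_inj[OF free_mod L f F.carrier_is_submodule L.carrier_is_submodule mL L.submoduleE(1)[OF mL]])
    show "x \<in> m_free b" if "x \<in> carrier (free b)" "f x \<in> mL" for x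
      using minimal_cover_reflects[OF L f ker that(1)] that(2) by (simp add: mL_def)
  qed (use mod_homD(1)[OF f] in auto)
  also have "len R L mL (carrier L) \<le> len R (free n) (m_free n) (carrier (free n))"
  proof (rule len_surj[OF free_mod L g F.carrier_is_submodule mL])
    fix c assume c: "c \<in> m_free n"
    then have cc: "c \<in> carrier (free n)" using pow_sub_free_carrier by blast
    have "?g c \<in> mL" using c scal u(1) by (intro L.submodule_finsum[OF mL]) (auto simp: pow_sub_mem)
    then show "c \<in> carrier (free n) \<and> ?g c \<in> mL" using cc by simp
  next
    fix z assume "z \<in> carrier L"
    then show "\<exists>x\<in>carrier (free n). \<exists>y\<in>mL. z = ?g x \<oplus>\<^bsub>L\<^esub> y" using decomp KmL by blast
  qed
  also have "\<dots> = enat n" by (rule len_free_residue)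
  finally have bn: "b \<le> n" by simp
  let ?I = "pow_sub (self_module R) b I" and ?l = "len R (self_module R) I (carrier R)"
  \<comment> \<open>P contains both I R^b and the kernel of f. Its colength in R^b is at least n
    times the length of R/I, and that of I R^b is b times this length; as b \<le> n, there is no
    room between the two.\<close>
  define P where "P = {v \<in> carrier (free b). f v \<in> K}"
  have P: "submodule P R (free b)"
    unfolding P_def by (rule submodule_preimage[OF free_mod L f F.carrier_is_submodule K])
  have IP: "?I \<subseteq> P"
  proof
    fix v assume v: "v \<in> ?I"
    then have vc: "v \<in> carrier (free b)" using pow_sub_free_carrier by blast
    have "f v = lin_comb L b (\<lambda>k. f (unit_vector R k)) v" by (rule hom_eq_lin_comb[OF L f vc])
    also have "\<dots> \<in> K"
      using v ideal_smult_mem[of _ I _ L] mod_homD(1)[OF f unit_vector_carrier[OF is_cring]]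
      by (intro L.submodule_finsum[OF K]) (auto simp: pow_sub_mem K_def)
    finally show "v \<in> P" using vc by (simp add: P_def)
  qed
  have IR: "I \<subseteq> carrier R" using ideal.Icarr[OF I] by auto
  have "enat n * ?l = len R (free n) (pow_sub (self_module R) n I) (carrier (free n))"
    using len_free_pow[OF I oneideal IR, of n] by (simp add: pow_sub_carrier_free)
  also have "\<dots> \<le> len R L K (carrier L)"
  proof (rule len_inj[OF free_mod L g F.carrier_is_submodule L.carrier_is_submodule K L.submoduleE(1)[OF K]])
    show "c \<in> pow_sub (self_module R) n I" if "c \<in> carrier (free n)" "?g c \<in> K" for c
      using u(3)[OF that] that(1) free_carrier[OF is_cring that(1)] by (auto simp: pow_sub_mem free_module_def)
  qed (use mod_homD(1)[OF g] in auto)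
  also have "\<dots> \<le> len R (free b) P (carrier (free b))"
  proof (rule len_surj[OF free_mod L f F.carrier_is_submodule K])
    fix z assume "z \<in> carrier L"
    then obtain x where "x \<in> carrier (free b)" "z = f x" using surj by auto
    then show "\<exists>x\<in>carrier (free b). \<exists>y\<in>K. z = f x \<oplus>\<^bsub>L\<^esub> y"
      using L.submodule_zero[OF K] mod_homD(1)[OF f] by (metis L.M.r_zero)
  qed (auto simp: P_def)
  finally have 1: "enat n * ?l \<le> len R (free b) P (carrier (free b))" .
  have "enat b * ?l = len R (free b) ?I (carrier (free b))"
    using len_free_pow[OF I oneideal IR, of b] by (simp add: pow_sub_carrier_free)
  also have "\<dots> = len R (free b) ?I P + len R (free b) P (carrier (free b))"
    using F.submoduleE(1)[OF P] by (intro len_additive[OF free_mod pow_free_sub[OF I] P F.carrier_is_submodule IP])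
  finally have 2: "len R (free b) ?I P + len R (free b) P (carrier (free b)) = enat b * ?l" by simp
  have "?l \<le> ring_len"
    using I by (intro len_mono) (auto dest: additive_subgroup.zero_closed[OF ideal.axioms(1)])
  then obtain l where l: "?l = enat l" using ring_finite_length by (cases ?l) auto
  have "\<not> ?I \<subset> P"
  proof
    assume "?I \<subset> P"
    from len_strict[OF pow_free_sub[OF I] P order.refl this] have "1 \<le> len R (free b) ?I P" by simp
    from add_mono[OF this 1] have "1 + enat n * enat l \<le> enat b * enat l" using 2 l by simp
    then have "Suc (n * l) \<le> b * l" by (simp add: one_enat_def)
    then show False using mult_le_mono1[OF bn, of l] by simp
  qed
  then have "P = ?I" using IP by blast
  moreover have "a_kernel (free b) L f \<subseteq> P"
    using L.submodule_zero[OF K] by (auto simp: a_kernel_def' P_def)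
  ultimately show ?thesis by simp
qed

end

section \<open>The canonical module\<close>

lemma coord_free_hom: "cring R \<Longrightarrow> (\<lambda>f. f l) \<in> mod_hom R (free_module R g) (self_module R)"
  unfolding free_module_def by (rule coord_hom[OF self_module_is_module])

text \<open>Builds a map on a submodule that is given as an image, by choosing preimages; the kernel
  condition makes the value independent of the choice. Such maps are what injectivity then
  extends.\<close>

lemma hom_factor_image:
  assumes N: "module R N" and P: "module R P" and Q: "module R Q"
    and \<phi>: "\<phi> \<in> mod_hom R N P" and g: "g \<in> mod_hom R N Q"
    and ker: "\<And>x. x \<in> carrier N \<Longrightarrow> \<phi> x = \<zero>\<^bsub>P\<^esub> \<Longrightarrow> g x = \<zero>\<^bsub>Q\<^esub>"
  shows "\<exists>h\<in>mod_hom R (P\<lparr>carrier := \<phi> ` carrier N\<rparr>) Q. \<forall>x\<in>carrier N. h (\<phi> x) = g x"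
proof -
  interpret N: module R N by fact
  interpret P: module R P by fact
  interpret Q: module R Q by fact
  have eq: "g x = g y" if "x \<in> carrier N" "y \<in> carrier N" "\<phi> x = \<phi> y" for x y
  proof -
    have "\<phi> (x \<ominus>\<^bsub>N\<^esub> y) = \<zero>\<^bsub>P\<^esub>"
      using that mod_hom_diff[OF N P \<phi>] mod_homD(1)[OF \<phi>] by (simp add: a_minus_def P.M.r_neg)
    then have "g (x \<ominus>\<^bsub>N\<^esub> y) = \<zero>\<^bsub>Q\<^esub>" using ker that by simp
    then have "g x \<ominus>\<^bsub>Q\<^esub> g y = \<zero>\<^bsub>Q\<^esub>" using mod_hom_diff[OF N Q g] that by simp
    then show ?thesis using mod_homD(1)[OF g] that
      by (metis Q.M.add.inv_solve_right' Q.M.l_zero Q.M.zero_closed a_minus_def)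
  qed
  define h where "h u = g (SOME x. x \<in> carrier N \<and> \<phi> x = u)" for u
  have h: "h (\<phi> x) = g x" if "x \<in> carrier N" for x
    unfolding h_def by (rule eq) (use that someI[of "\<lambda>y. y \<in> carrier N \<and> \<phi> y = \<phi> x" x] in auto)
  have "h \<in> mod_hom R (P\<lparr>carrier := \<phi> ` carrier N\<rparr>) Q"
    unfolding mod_hom_def using h mod_homD[OF g] mod_homD(2,3)[OF \<phi>, symmetric] by auto
  then show ?thesis using h by blast
qed

context artinian_local
begin

text \<open>Free modules live in the type of the test modules of \<open>injective_module\<close>, so
  they can serve as ambient modules directly.\<close>

lemma injective_extension:
  assumes "injective_module R W" "submodule A R (free n)"
    and "f \<in> mod_hom R ((free n)\<lparr>carrier := A\<rparr>) W"
  shows "\<exists>g\<in>mod_hom R (free n) W. \<forall>x\<in>A. g x = f x"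
  using assms free_mod unfolding injective_module_def by blast

text \<open>c is the image of 1 from R/\<mm> under the embedding into the hull. By essentiality a
  nonzero submodule contains some a c \<noteq> 0; then a is outside \<mm>, and inverting it gives
  c.\<close>

lemma canonical_socle:
  assumes W: "canonical_module R \<mm> W"
  shows "\<exists>c\<in>carrier W. c \<noteq> \<zero>\<^bsub>W\<^esub> \<and> (\<forall>a\<in>\<mm>. a \<odot>\<^bsub>W\<^esub> c = \<zero>\<^bsub>W\<^esub>) \<and>
    (\<forall>N. submodule N R W \<and> N \<noteq> {\<zero>\<^bsub>W\<^esub>} \<longrightarrow> c \<in> N)"
proof -
  interpret S: module R "self_module R" by (rule self_mod)
  let ?K = "quotient_module (self_module R) \<mm>"
  let ?C = "\<lambda>a. \<mm> +>\<^bsub>self_module R\<^esub> a"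
  obtain j where j: "j \<in> mod_hom R ?K W" and inj: "inj_on j (carrier ?K)"
    and ess: "\<And>N. submodule N R W \<Longrightarrow> N \<noteq> {\<zero>\<^bsub>W\<^esub>} \<Longrightarrow> N \<inter> j ` carrier ?K \<noteq> {\<zero>\<^bsub>W\<^esub>}"
    and Wm: "module R W"
    using W unfolding canonical_module_def injective_hull_def injective_module_def by blast
  interpret W: module R W by (rule Wm)
  have Kc: "carrier ?K = ?C ` carrier R" by (auto simp: quotient_module_def A_RCOSETS_def')
  have sm: "a \<odot>\<^bsub>?K\<^esub> ?C \<one> = ?C a" if a: "a \<in> carrier R" for a
  proof -
    have "(\<Union>b\<in>{a}. \<Union>y\<in>?C \<one>. ?C (b \<odot>\<^bsub>self_module R\<^esub> y)) = ?C (a \<odot>\<^bsub>self_module R\<^esub> \<one>)"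
      using a S.submodule_zero[OF m_sub] by (intro S.coset_smult[OF m_sub a]) (auto simp: a_minus_def r_neg)
    then show ?thesis using a by (simp add: quotient_module_def)
  qed
  have C_eq: "?C a = ?C b \<longleftrightarrow> a \<ominus>\<^bsub>self_module R\<^esub> b \<in> \<mm>" if "a \<in> carrier R" "b \<in> carrier R" for a b
    using S.coset_eq_iff[OF m_sub] that by simp
  have C0: "?C a = ?C \<zero> \<longleftrightarrow> a \<in> \<mm>" if "a \<in> carrier R" for a
  proof -
    have "a \<ominus>\<^bsub>self_module R\<^esub> \<zero>\<^bsub>self_module R\<^esub> = a"
      using that S.M.minus_equality[of \<zero> \<zero>] by (simp add: a_minus_def)
    then show ?thesis using C_eq[OF that zero_closed] by simp
  qed
  define c where "c = j (?C \<one>)"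
  have C1: "?C \<one> \<in> carrier ?K" using Kc by auto
  have cc: "c \<in> carrier W" using mod_homD(1)[OF j C1] by (simp add: c_def)
  have jc: "j (?C a) = a \<odot>\<^bsub>W\<^esub> c" if "a \<in> carrier R" for a
    using mod_homD(3)[OF j that C1] sm[OF that] by (simp add: c_def)
  have mc: "a \<odot>\<^bsub>W\<^esub> c = \<zero>\<^bsub>W\<^esub>" if a: "a \<in> \<mm>" for a
    using jc[OF m_carrier[OF a]] jc[OF zero_closed] C0[OF m_carrier[OF a]] a cc by simp
  have c0: "c \<noteq> \<zero>\<^bsub>W\<^esub>"
  proof
    assume "c = \<zero>\<^bsub>W\<^esub>"
    then have "j (?C \<one>) = j (?C \<zero>)" using jc[OF zero_closed] jc[OF one_closed] by simp
    then have "?C \<one> = ?C \<zero>" using inj Kc by (auto simp: inj_on_def)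
    then show False using C0[OF one_closed] one_notin_m by simp
  qed
  have "c \<in> N" if N: "submodule N R W" "N \<noteq> {\<zero>\<^bsub>W\<^esub>}" for N
  proof -
    have "?C \<zero> \<in> carrier ?K" using Kc by auto
    moreover have "j (?C \<zero>) = \<zero>\<^bsub>W\<^esub>" using jc[OF zero_closed] cc by simp
    ultimately have "\<zero>\<^bsub>W\<^esub> \<in> j ` carrier ?K" by (metis imageI)
    then obtain x where x: "x \<in> N" "x \<in> j ` carrier ?K" "x \<noteq> \<zero>\<^bsub>W\<^esub>"
      using ess[OF N] W.submodule_zero[OF N(1)] by blast
    then obtain a where a: "a \<in> carrier R" "x = a \<odot>\<^bsub>W\<^esub> c" using Kc jc by auto
    have "a \<notin> \<mm>" using x(3) mc unfolding a(2) by blast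
    then obtain b where b: "b \<in> carrier R" "b \<otimes> a = \<one>" using unit_if_notin_m[OF a(1)] by blast
    have "b \<odot>\<^bsub>W\<^esub> x = c" using a b cc by (simp flip: W.smult_assoc1)
    then show ?thesis using W.submoduleE(4)[OF N(1) b(1) x(1)] by simp
  qed
  then show ?thesis using cc c0 mc by blast
qed

lemma canonical_injective:
  assumes "canonical_module R \<mm> W" shows "injective_module R W"
  using assms by (simp add: canonical_module_def injective_hull_def)

lemma canonical_is_module:
  assumes "canonical_module R \<mm> W" shows "module R W"
  using canonical_injective[OF assms] by (simp add: injective_module_def)

text \<open>The annihilator in \<open>W\<close> of an ideal \<open>J\<close> has length at most that of \<open>R/J\<close>: enlarging \<open>J\<close> by an
  element of the socle of \<open>R/J\<close> changes the annihilator by at most the socle of \<open>W\<close>.\<close>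

lemma canonical_finite_len:
  assumes can: "canonical_module R \<mm> W"
  shows "len R W {\<zero>\<^bsub>W\<^esub>} (carrier W) < \<infinity>"
proof -
  interpret S: module R "self_module R" by (rule self_mod)
  note W = canonical_is_module[OF can]
  interpret W: module R W by (rule W)
  obtain c where c: "c \<in> carrier W" "c \<noteq> \<zero>\<^bsub>W\<^esub>" "\<And>a. a \<in> \<mm> \<Longrightarrow> a \<odot>\<^bsub>W\<^esub> c = \<zero>\<^bsub>W\<^esub>"
    and ess: "\<And>N. submodule N R W \<Longrightarrow> N \<noteq> {\<zero>\<^bsub>W\<^esub>} \<Longrightarrow> c \<in> N"
    using canonical_socle[OF can] by blast
  define ann where "ann J = {w \<in> carrier W. \<forall>a\<in>J. a \<odot>\<^bsub>W\<^esub> w = \<zero>\<^bsub>W\<^esub>}" for J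
  have ann: "submodule (ann J) R W" if "J \<subseteq> carrier R" for J
  proof (rule W.submoduleI')
    fix a x assume a: "a \<in> carrier R" and x: "x \<in> ann J"
    have "b \<odot>\<^bsub>W\<^esub> (a \<odot>\<^bsub>W\<^esub> x) = a \<odot>\<^bsub>W\<^esub> (b \<odot>\<^bsub>W\<^esub> x)" if "b \<in> J" for b
    proof -
      have "b \<in> carrier R" "x \<in> carrier W" using x that \<open>J \<subseteq> carrier R\<close> by (auto simp: ann_def)
      then show ?thesis using a by (simp add: m_comm flip: W.smult_assoc1)
    qed
    then show "a \<odot>\<^bsub>W\<^esub> x \<in> ann J" using a x by (simp add: ann_def)
  qed (use that in \<open>auto simp: ann_def W.smult_r_distr subset_iff\<close>)
  \<comment> \<open>The socle is generated by c: for w \<noteq> 0 killed by \<mm>, essentiality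
    gives c = r w, and r is a unit because c \<noteq> 0.\<close>
  have soc: "len R W {\<zero>\<^bsub>W\<^esub>} (ann \<mm>) \<le> 1"
  proof (rule len_cyclic[OF W W.submodule_zero_set c(1)])
    fix w assume w: "w \<in> ann \<mm>"
    then have wc: "w \<in> carrier W" by (simp add: ann_def)
    show "\<exists>a\<in>carrier R. \<exists>y\<in>{\<zero>\<^bsub>W\<^esub>}. w = a \<odot>\<^bsub>W\<^esub> c \<oplus>\<^bsub>W\<^esub> y"
    proof (cases "w = \<zero>\<^bsub>W\<^esub>")
      case True
      then show ?thesis using c(1) by (intro bexI[of _ \<zero>]) auto
    next
      case False
      let ?N = "(\<lambda>a. a \<odot>\<^bsub>W\<^esub> w) ` carrier R"
      have N: "submodule ?N R W"
        using submodule_image[OF self_mod W mod_hom_smult_vector[OF W wc] S.carrier_is_submodule] by simp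
      have "w \<in> ?N" using wc by (intro image_eqI[of _ _ \<one>]) auto
      then have "?N \<noteq> {\<zero>\<^bsub>W\<^esub>}" using False by auto
      then obtain r where r: "r \<in> carrier R" "c = r \<odot>\<^bsub>W\<^esub> w" using ess[OF N] by auto
      then have "r \<notin> \<mm>" using w c(2) by (auto simp: ann_def)
      then obtain b where b: "b \<in> carrier R" "b \<otimes> r = \<one>" using unit_if_notin_m r by auto
      have "w = b \<odot>\<^bsub>W\<^esub> c" using r b wc by (simp flip: W.smult_assoc1)
      then show ?thesis using b c(1) by (intro bexI[of _ b]) auto
    qed
  qed (use c in auto)
  have ann_one: "len R W {\<zero>\<^bsub>W\<^esub>} (ann J) = 0" if "\<one> \<in> J" for J
  proof -
    have "ann J \<subseteq> {\<zero>\<^bsub>W\<^esub>}" using that by (auto simp: ann_def)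
    then have "len R W {\<zero>\<^bsub>W\<^esub>} (ann J) \<le> len R W {\<zero>\<^bsub>W\<^esub>} {\<zero>\<^bsub>W\<^esub>}" by (intro len_mono) auto
    then show ?thesis by simp
  qed
  have "len R W {\<zero>\<^bsub>W\<^esub>} (ann J) \<le> enat k"
    if "ideal J R" "len R (self_module R) J (carrier R) \<le> enat k" for k J
    using that
  proof (induction k arbitrary: J)
    case J: (0 J)
    have "\<one> \<in> J"
    proof (rule ccontr)
      assume "\<one> \<notin> J"
      then have "J \<subset> carrier R" using ideal.Icarr[OF J(1)] by auto
      from len_strict[OF J(1)[unfolded ideal_iff_submodule] _ order.refl this] S.carrier_is_submodule
      have "1 \<le> len R (self_module R) J (carrier R)" by simp
      then show False using J(2) by (simp add: zero_enat_def[symmetric])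
    qed
    then show ?case using ann_one by (simp add: zero_enat_def[symmetric])
  next
    case J: (Suc k J)
    note Js = J(2)[unfolded ideal_iff_submodule]
    have Jc: "J \<subseteq> carrier R" using ideal.Icarr[OF J(2)] by auto
    show ?case
    proof (cases "\<one> \<in> J")
      case True
      then show ?thesis using ann_one by simp
    next
      case False
      from socle_above[OF J(2) False] obtain x
        where x: "x \<in> carrier R" "x \<notin> J" "\<And>a. a \<in> \<mm> \<Longrightarrow> a \<otimes> x \<in> J" by blast
      have P: "submodule (PIdl x) R (self_module R)"
        using x(1) by (simp add: cgenideal_ideal flip: ideal_iff_submodule)
      define J' where "J' = J <+>\<^bsub>self_module R\<^esub> PIdl x"
      note J' = S.submodule_sum[OF Js P, folded J'_def]
      have J'c: "J' \<subseteq> carrier R" using S.submoduleE(1)[OF J'(1)] by simp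
      have xJ': "x \<in> J'" using J'(3) cgenideal_self[OF x(1)] by auto
      have "len R (self_module R) J J' \<ge> 1"
        using len_strict[OF Js J'(1) order.refl] J'(2) xJ' x(2) by auto
      moreover have "len R (self_module R) J (carrier R) =
          len R (self_module R) J J' + len R (self_module R) J' (carrier R)"
        using len_additive[OF self_mod Js J'(1) S.carrier_is_submodule J'(2)] J'c by simp
      ultimately have "1 + len R (self_module R) J' (carrier R) \<le> enat (Suc k)"
        using J(3) by (metis add_right_mono order_trans)
      then have "len R (self_module R) J' (carrier R) \<le> enat k"
        by (cases "len R (self_module R) J' (carrier R)") (auto simp: one_enat_def)
      then have IH: "len R W {\<zero>\<^bsub>W\<^esub>} (ann J') \<le> enat k"
        using J(1)[of J'] J'(1) by (simp add: ideal_iff_submodule)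
      \<comment> \<open>Multiplication by x maps ann J into ann \<mm>, since \<mm>x \<subseteq> J,
        and its kernel on ann J lies in ann J' because J' = J + (x).\<close>
      have "len R W (ann J') (ann J) \<le> len R W {\<zero>\<^bsub>W\<^esub>} (ann \<mm>)"
      proof (rule len_inj[OF W W mod_hom_scalar_mult[OF W x(1)] ann[OF Jc] ann W.submodule_zero_set])
        show "\<mm> \<subseteq> carrier R" using m_carrier by auto
        show "{\<zero>\<^bsub>W\<^esub>} \<subseteq> ann \<mm>" using m_carrier by (auto simp: ann_def)
        show "x \<odot>\<^bsub>W\<^esub> w \<in> ann \<mm>" if "w \<in> ann J" for w
          using that x m_carrier by (auto simp: ann_def simp flip: W.smult_assoc1)
        show "w \<in> ann J'" if w: "w \<in> ann J" "x \<odot>\<^bsub>W\<^esub> w \<in> {\<zero>\<^bsub>W\<^esub>}" for w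
        proof -
          have "a \<odot>\<^bsub>W\<^esub> w = \<zero>\<^bsub>W\<^esub>" if a: "a \<in> J'" for a
          proof -
            obtain y r where "y \<in> J" "r \<in> carrier R" "a = y \<oplus> r \<otimes> x"
              using a by (auto simp: J'_def set_add_mem cgenideal_def)
            then show ?thesis
              using w Jc x(1) by (auto simp: ann_def W.smult_l_distr W.smult_assoc1 subset_iff)
          qed
          then show ?thesis using w by (simp add: ann_def)
        qed
      qed
      also note soc
      finally have 1: "len R W (ann J') (ann J) \<le> 1" .
      have sub: "ann J' \<subseteq> ann J" using J'(2) by (auto simp: ann_def)
      have "len R W {\<zero>\<^bsub>W\<^esub>} (ann J) = len R W {\<zero>\<^bsub>W\<^esub>} (ann J') + len R W (ann J') (ann J)"
        using W.submodule_zero[OF ann[OF J'c]]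
        by (intro len_additive[OF W W.submodule_zero_set ann[OF J'c] ann[OF Jc] _ sub]) simp
      also have "\<dots> \<le> enat k + 1" using IH 1 by (rule add_mono)
      finally show ?thesis by (simp add: one_enat_def)
    qed
  qed
  moreover obtain l where "ring_len = enat l" using ring_finite_length by auto
  ultimately have "len R W {\<zero>\<^bsub>W\<^esub>} (ann {\<zero>}) \<le> enat l" using zeroideal by simp
  moreover have "ann {\<zero>} = carrier W" by (auto simp: ann_def)
  ultimately show ?thesis using order.strict_trans1[of _ "enat l" \<infinity>] by simp
qed

text \<open>W is a cogenerator: on C + Rv the map u + a v \<mapsto> a c, with c in the socle of W,
  kills C but not v, and injectivity extends it to R^n. It is well defined because a v \<in> C
  forces a \<in> \<mm>, which annihilates c.\<close>

lemma canonical_separates: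
  assumes can: "canonical_module R \<mm> W" and C: "submodule C R (free n)"
    and v: "v \<in> carrier (free n)" "v \<notin> C"
  shows "\<exists>f\<in>mod_hom R (free n) W. (\<forall>u\<in>C. f u = \<zero>\<^bsub>W\<^esub>) \<and> f v \<noteq> \<zero>\<^bsub>W\<^esub>"
proof -
  note W = canonical_is_module[OF can]
  interpret W: module R W by (rule W)
  interpret F: module R "free i" for i by (rule free_mod)
  let ?F = "free n"
  obtain c where c: "c \<in> carrier W" "c \<noteq> \<zero>\<^bsub>W\<^esub>" "\<And>a. a \<in> \<mm> \<Longrightarrow> a \<odot>\<^bsub>W\<^esub> c = \<zero>\<^bsub>W\<^esub>"
    using canonical_socle[OF can] by blast
  obtain q y where y: "\<And>k. k < q \<Longrightarrow> y k \<in> C" and im: "lin_comb ?F q y ` carrier (free q) = C"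
    using finite_len_generated[OF free_mod C submodule_free_finite_len[OF C]] by blast
  \<comment> \<open>C + Rv is presented as the image of R^{q+1}, with v at the last index q; the
    coordinate \<open>x q\<close> is then the coefficient of v.\<close>
  define y' where "y' = y(q := v)"
  have yc: "y k \<in> carrier ?F" if "k < q" for k using y[OF that] F.submoduleE(1)[OF C] by blast
  have y'c: "y' k \<in> carrier ?F" if "k < Suc q" for k using that yc v by (auto simp: y'_def less_Suc_eq)
  let ?\<phi> = "lin_comb ?F (Suc q) y'"
  have \<phi>: "?\<phi> \<in> mod_hom R (free (Suc q)) ?F" by (rule lin_comb_hom[OF free_mod y'c])
  have split: "?\<phi> x = x q \<odot>\<^bsub>?F\<^esub> v \<oplus>\<^bsub>?F\<^esub> lin_comb ?F q y x" if "\<And>k. x k \<in> carrier R" for x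
  proof -
    have "?\<phi> x = x q \<odot>\<^bsub>?F\<^esub> y' q \<oplus>\<^bsub>?F\<^esub> lin_comb ?F q y' x"
      unfolding lessThan_Suc using that y'c by (intro F.M.finsum_insert) auto
    also have "lin_comb ?F q y' x = lin_comb ?F q y x"
      using that yc by (intro F.M.finsum_cong') (auto simp: y'_def)
    finally show ?thesis by (simp add: y'_def)
  qed
  have g: "(\<lambda>x. x q \<odot>\<^bsub>W\<^esub> c) \<in> mod_hom R (free (Suc q)) W"
    by (rule mod_hom_comp[OF coord_free_hom[OF is_cring] mod_hom_smult_vector[OF W c(1)]])
  have ker: "x q \<odot>\<^bsub>W\<^esub> c = \<zero>\<^bsub>W\<^esub>" if x: "x \<in> carrier (free (Suc q))" "?\<phi> x = \<zero>\<^bsub>?F\<^esub>" for x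
  proof -
    have xc: "x k \<in> carrier R" for k using free_carrier[OF is_cring x(1)] .
    have sC: "lin_comb ?F q y x \<in> C"
      using xc y F.submoduleE(4)[OF C] by (intro F.submodule_finsum[OF C]) auto
    have "x q \<odot>\<^bsub>?F\<^esub> v = \<ominus>\<^bsub>?F\<^esub> lin_comb ?F q y x"
      using x(2) split[OF xc] subsetD[OF F.submoduleE(1)[OF C] sC] F.smult_closed[OF xc v(1)]
      by (intro F.M.minus_equality[symmetric]) simp_all
    then have xv: "x q \<odot>\<^bsub>?F\<^esub> v \<in> C" using F.submoduleE(3)[OF C sC] by simp
    have "x q \<in> \<mm>"
    proof (rule ccontr)
      assume "x q \<notin> \<mm>"
      then obtain b where b: "b \<in> carrier R" "b \<otimes> x q = \<one>" using unit_if_notin_m[OF xc] by blast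
      have "b \<odot>\<^bsub>?F\<^esub> (x q \<odot>\<^bsub>?F\<^esub> v) = v" using b xc v by (simp flip: F.smult_assoc1)
      then show False using F.submoduleE(4)[OF C b(1) xv] v by simp
    qed
    then show ?thesis by (rule c(3))
  qed
  have "\<exists>h\<in>mod_hom R (?F\<lparr>carrier := ?\<phi> ` carrier (free (Suc q))\<rparr>) W.
      \<forall>x\<in>carrier (free (Suc q)). h (?\<phi> x) = x q \<odot>\<^bsub>W\<^esub> c"
    by (rule hom_factor_image[OF free_mod free_mod W \<phi> g]) (rule ker)
  then obtain h where h: "h \<in> mod_hom R (?F\<lparr>carrier := ?\<phi> ` carrier (free (Suc q))\<rparr>) W"
    "\<And>x. x \<in> carrier (free (Suc q)) \<Longrightarrow> h (?\<phi> x) = x q \<odot>\<^bsub>W\<^esub> c" by blast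
  from injective_extension[OF canonical_injective[OF can]
      submodule_image[OF free_mod free_mod \<phi> F.carrier_is_submodule] h(1)]
  obtain f where f: "f \<in> mod_hom R ?F W"
    "\<And>x. x \<in> carrier (free (Suc q)) \<Longrightarrow> f (?\<phi> x) = x q \<odot>\<^bsub>W\<^esub> c"
    using h(2) by auto
  have "f u = \<zero>\<^bsub>W\<^esub>" if u: "u \<in> C" for u
  proof -
    obtain x where x: "x \<in> carrier (free q)" "u = lin_comb ?F q y x" using u im by blast
    have uc: "u \<in> carrier ?F" using u F.submoduleE(1)[OF C] by blast
    \<comment> \<open>Vectors of R^q are extended by zero, so x is also a vector of R^{q+1}, with
      last coordinate 0.\<close>
    have xq: "x q = \<zero>" and x': "x \<in> carrier (free (Suc q))" using x(1) by (auto simp: free_module_def less_Suc_eq)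
    have "?\<phi> x = u" using split[OF free_carrier[OF is_cring x(1)]] xq v(1) uc by (simp add: x(2))
    then show ?thesis using f(2)[OF x'] xq c(1) by simp
  qed
  moreover have "f v = c"
  proof -
    have "?\<phi> (unit_vector R q) = y' q" by (rule lin_comb_unit[OF free_mod y'c]) simp_all
    then have "f (y' q) = unit_vector R q q \<odot>\<^bsub>W\<^esub> c"
      using f(2)[OF unit_vector_carrier[OF is_cring lessI]] by simp
    then show ?thesis using c(1) by (simp add: y'_def unit_vector_def)
  qed
  ultimately show ?thesis using f(1) c(2) by blast
qed

end

section \<open>Inequalities between Betti numbers\<close>

lemma (in abelian_group) diff_zero: "x \<in> carrier G \<Longrightarrow> x \<ominus> \<zero> = x"
  using minus_equality[of \<zero> \<zero>] by (simp add: a_minus_def)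

text \<open>\<phi> v is the sum of v_k \<phi>(e_k), with v_k in K and the coordinates of \<phi>(e_k)
  in J; every product lies in H.\<close>

lemma hom_free_pow_sub:
  assumes R: "cring R" and \<phi>: "\<phi> \<in> mod_hom R (free_module R n) (free_module R m)"
    and J: "\<And>u. u \<in> carrier (free_module R n) \<Longrightarrow> \<phi> u \<in> pow_sub (self_module R) m J"
    and H: "ideal H R" and KJ: "\<And>a b. a \<in> K \<Longrightarrow> b \<in> J \<Longrightarrow> a \<otimes>\<^bsub>R\<^esub> b \<in> H"
    and v: "v \<in> pow_sub (self_module R) n K"
  shows "\<phi> v \<in> pow_sub (self_module R) m H"
proof -
  interpret R: cring R by fact
  note F = free_module_is_module[OF R]
  interpret F: module R "free_module R m" by (rule F)
  have H': "submodule (pow_sub (self_module R) m H) R (free_module R m)"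
    unfolding free_module_def using H
    by (intro prod_sub_submodule[OF self_module_is_module[OF R]]) (simp add: R.ideal_iff_submodule)
  have vc: "v \<in> carrier (free_module R n)" using v by (auto simp: prod_sub_def free_module_def)
  have "v k \<odot>\<^bsub>free_module R m\<^esub> \<phi> (unit_vector R k) \<in> pow_sub (self_module R) m H" if k: "k < n" for k
    using J[OF unit_vector_carrier[OF R k]] v k KJ by (auto simp: pow_sub_mem free_module_def)
  then have "lin_comb (free_module R m) n (\<lambda>k. \<phi> (unit_vector R k)) v \<in> pow_sub (self_module R) m H"
    by (intro F.submodule_finsum[OF H']) auto
  then show ?thesis using hom_eq_lin_comb[OF F \<phi> vc] by simp
qed

section \<open>An ideal annihilated by the square of the maximal ideal\<close>

locale artinian_local_ideal = artinian_local +
  fixes I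
  assumes I_ideal: "ideal I R" and I_proper: "I \<noteq> carrier R" and mmI: "\<mm> \<cdot> \<mm> \<cdot> I = {\<zero>}"
begin

abbreviation mI :: "'a set" where "mI \<equiv> \<mm> \<cdot> I"
abbreviation "I_free n \<equiv> pow_sub (self_module R) n I"
abbreviation "mI_free n \<equiv> pow_sub (self_module R) n mI"

lemma one_notin_I: "\<one> \<notin> I"
  using I_proper ideal.one_imp_carrier[OF I_ideal] by auto

lemma I_carrier: "a \<in> I \<Longrightarrow> a \<in> carrier R"
  using ideal.Icarr[OF I_ideal] .

lemma mI_ideal: "ideal mI R"
  by (rule ideal_prod_is_ideal[OF m_ideal I_ideal])

lemma mI_sub_I: "mI \<subseteq> I"
  using ideal_prod_inter[OF m_ideal I_ideal] by auto

lemma I_mult_m: "a \<in> I \<Longrightarrow> b \<in> \<mm> \<Longrightarrow> a \<otimes> b \<in> mI"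
  using ideal_prod.prod[of b \<mm> a I] m_comm[OF I_carrier m_carrier] by metis

text \<open>The hypothesis that \<mm> times \<mm> times I vanishes acts only in this form: \<mm>I
  lies in the socle of R.\<close>

lemma mI_mult_m: assumes x: "x \<in> mI" and b: "b \<in> \<mm>" shows "x \<otimes> b = \<zero>"
proof -
  have "x \<in> carrier R \<and> x \<otimes> b = \<zero>"
    using x
  proof induction
    case (prod a c)
    have "b \<otimes> a \<otimes> c \<in> \<mm> \<cdot> \<mm> \<cdot> I" using b prod by (intro ideal_prod.prod)
    then have "b \<otimes> a \<otimes> c = \<zero>" using mmI by simp
    then show ?case using m_carrier[OF b] m_carrier[OF prod(1)] I_carrier[OF prod(2)]
      by (simp add: m_ac)
  next
    case (sum s1 s2)
    then show ?case using m_carrier[OF b] by (simp add: l_distr)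
  qed
  then show ?thesis by simp
qed

text \<open>The entries of a minimal map lie in \<mm>, which annihilates \<mm>I. In an exact complex
  this places \<mm>I R^n in the image of the next differential.\<close>

lemma minimal_map_kills:
  assumes "\<phi> \<in> mod_hom R (free n) (free m)" "\<phi> ` carrier (free n) \<subseteq> m_free m" "v \<in> mI_free n"
  shows "\<phi> v = \<zero>\<^bsub>free m\<^esub>"
proof -
  have "\<phi> v \<in> pow_sub (self_module R) m {\<zero>}"
    using hom_free_pow_sub[OF is_cring assms(1) _ zeroideal _ assms(3), of \<mm>] assms(2) mI_mult_m by blast
  then show ?thesis using pow_sub_zero[OF self_mod, of m] by (simp add: free_module_def)
qed

text \<open>The kernel K of \<delta> lies between \<mm>I R^b and I R^b. Since \<delta>' sends
  \<mm>R^{b'} into \<mm>I R^b, the quotient K/\<mm>I R^b is an image of (R/\<mm>)^{b'} and has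
  length at most b', while I R^b/K is isomorphic to \<delta>(I R^b).\<close>

lemma betti_inequality:
  assumes \<delta>: "\<delta> \<in> mod_hom R (free b) (free g)" "\<delta> ` carrier (free b) \<subseteq> m_free g"
    and \<delta>': "\<delta>' \<in> mod_hom R (free b') (free b)" "\<delta>' ` carrier (free b') = a_kernel (free b) (free g) \<delta>"
      "\<delta>' ` carrier (free b') \<subseteq> I_free b"
  shows "enat b * len R (self_module R) mI I \<le> enat b' + len R (free g) {\<zero>\<^bsub>free g\<^esub>} (\<delta> ` I_free b)"
proof -
  interpret F: module R "free n" for n by (rule free_mod)
  let ?K = "a_kernel (free b) (free g) \<delta>"
  have K: "submodule ?K R (free b)" by (rule submodule_kernel[OF free_mod free_mod \<delta>(1)])
  have mIK: "mI_free b \<subseteq> ?K"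
    using minimal_map_kills[OF \<delta>] pow_sub_free_carrier by (auto simp: a_kernel_def')
  have KI: "?K \<subseteq> I_free b" using \<delta>' by simp
  have "enat b * len R (self_module R) mI I = len R (free b) (mI_free b) (I_free b)"
    by (rule len_free_pow[OF mI_ideal I_ideal mI_sub_I, symmetric])
  also have "\<dots> = len R (free b) (mI_free b) ?K + len R (free b) ?K (I_free b)"
    by (rule len_additive[OF free_mod pow_free_sub[OF mI_ideal] K pow_free_sub[OF I_ideal] mIK KI])
  also have "len R (free b) (mI_free b) ?K \<le> len R (free b') (m_free b') (carrier (free b'))"
  proof (rule len_surj[OF free_mod free_mod \<delta>'(1) F.carrier_is_submodule pow_free_sub[OF mI_ideal]])
    fix x assume x: "x \<in> m_free b'"
    have "\<delta>' x \<in> mI_free b"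
      using hom_free_pow_sub[OF is_cring \<delta>'(1) _ mI_ideal _ x, of I] \<delta>'(3) ideal_prod.prod[of _ \<mm> _ I R]
      by blast
    then show "x \<in> carrier (free b') \<and> \<delta>' x \<in> mI_free b" using x pow_sub_free_carrier by blast
  next
    fix z assume "z \<in> ?K"
    then obtain x where x: "x \<in> carrier (free b')" "z = \<delta>' x" using \<delta>'(2) by auto
    then have "z = \<delta>' x \<oplus>\<^bsub>free b\<^esub> \<zero>\<^bsub>free b\<^esub>" using mod_homD(1)[OF \<delta>'(1) x(1)] by simp
    then show "\<exists>x\<in>carrier (free b'). \<exists>y\<in>mI_free b. z = \<delta>' x \<oplus>\<^bsub>free b\<^esub> y"
      using x(1) F.submodule_zero[OF pow_free_sub[OF mI_ideal]] by blast
  qed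
  also have "\<dots> = enat b'" by (rule len_free_residue)
  also have "len R (free b) ?K (I_free b) \<le> len R (free g) {\<zero>\<^bsub>free g\<^esub>} (\<delta> ` I_free b)"
  proof (rule len_inj[OF free_mod free_mod \<delta>(1) pow_free_sub[OF I_ideal] _ F.submodule_zero_set])
    show sub: "submodule (\<delta> ` I_free b) R (free g)"
      by (rule submodule_image[OF free_mod free_mod \<delta>(1) pow_free_sub[OF I_ideal]])
    show "{\<zero>\<^bsub>free g\<^esub>} \<subseteq> \<delta> ` I_free b" using F.submodule_zero[OF sub] by simp
    show "x \<in> ?K" if "x \<in> I_free b" "\<delta> x \<in> {\<zero>\<^bsub>free g\<^esub>}" for x
      using that pow_sub_free_carrier by (auto simp: a_kernel_def')
  qed auto
  finally show ?thesis by (simp add: add_mono)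
qed

text \<open>With \<open>W\<^sub>1 = ker \<epsilon>\<close>, every element of \<open>(I W\<^sub>1)\<^sup>m\<close> is \<open>t y\<close> for some \<open>y \<in> (R\<^sup>g)\<^sup>n\<close>; the image of
  \<open>y\<close> in \<open>W\<^sup>n\<close> is killed by \<open>t\<close>, hence comes from \<open>s\<close>, and correcting \<open>y\<close> accordingly one gets
  \<open>y \<in> W\<^sub>1\<^sup>n\<close>. So \<open>t\<close> maps \<open>(W\<^sub>1/\<mm>W\<^sub>1)\<^sup>n\<close> onto a module containing \<open>(I W\<^sub>1)\<^sup>m\<close>.\<close>

lemma syzygy_inequality:
  fixes m n p :: nat and t s :: "nat \<Rightarrow> nat \<Rightarrow> 'a"
  assumes W: "module R W" and \<epsilon>: "\<epsilon> \<in> mod_hom R (free g) W" "\<epsilon> ` carrier (free g) = carrier W"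
    and \<delta>: "\<delta> \<in> mod_hom R (free b) (free g)" "\<delta> ` carrier (free b) = a_kernel (free g) W \<epsilon>"
      "\<delta> ` carrier (free b) \<subseteq> m_free g"
    and t: "\<And>j k. j < m \<Longrightarrow> k < n \<Longrightarrow> t j k \<in> I"
    and s: "\<And>k l. k < n \<Longrightarrow> l < p \<Longrightarrow> s k l \<in> carrier R"
    and ts: "\<And>v. v \<in> carrier (free p) \<Longrightarrow>
      mat_act (self_module R) n m t (mat_act (self_module R) p n s v) = (\<lambda>_. \<zero>)"
    and onto: "mI_free m \<subseteq> mat_act (self_module R) n m t ` carrier (free n)"
    and exact: "\<And>w. w \<in> carrier (power_module W n) \<Longrightarrow> mat_act W n m t w = (\<lambda>_. \<zero>\<^bsub>W\<^esub>) \<Longrightarrow>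
      \<exists>z\<in>carrier (power_module W p). w = mat_act W p n s z"
  shows "enat m * len R (free g) {\<zero>\<^bsub>free g\<^esub>} (\<delta> ` I_free b) \<le> enat (n * b)"
proof -
  have tc: "t j k \<in> carrier R" if "j < m" "k < n" for j k
    using t that I_carrier by blast
  interpret W: module R W by fact
  interpret F: module R "free i" for i by (rule free_mod)
  interpret PF: module R "power_module (free i) j" for i j by (rule power_module_is_module[OF free_mod])
  let ?G = "free g" and ?IW = "\<delta> ` I_free b"
  have IW: "submodule ?IW R ?G" by (rule submodule_image[OF free_mod free_mod \<delta>(1) pow_free_sub[OF I_ideal]])
  have IW_mI: "?IW \<subseteq> mI_free g"
    using hom_free_pow_sub[OF is_cring \<delta>(1) _ mI_ideal _, of \<mm> I] \<delta>(3) I_mult_m by blast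
  have IW_ker: "\<epsilon> y = \<zero>\<^bsub>W\<^esub>" if "y \<in> ?IW" for y
  proof -
    have "y \<in> \<delta> ` carrier (free b)" using that pow_sub_free_carrier by blast
    then show ?thesis using \<delta>(2) by (auto simp: a_kernel_def')
  qed
  \<comment> \<open>With entries in I, the matrix t does not see \<delta>(\<mm>R^b): a v lies in
    \<mm>I R^b, which \<delta> kills.\<close>
  have \<delta>_zero: "a \<odot>\<^bsub>?G\<^esub> \<delta> v = \<zero>\<^bsub>?G\<^esub>" if "a \<in> I" "v \<in> m_free b" for a v
  proof -
    have vc: "v \<in> carrier (free b)" using that pow_sub_free_carrier by blast
    have "a \<odot>\<^bsub>free b\<^esub> v \<in> mI_free b"
      using that I_carrier m_carrier I_mult_m ideal.Icarr[OF mI_ideal]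
        additive_subgroup.zero_closed[OF ideal.axioms(1)[OF mI_ideal]]
      by (auto simp: pow_sub_mem free_module_def)
    from minimal_map_kills[OF \<delta>(1,3) this] show ?thesis
      using mod_homD(3)[OF \<delta>(1) I_carrier[OF that(1)] vc] by simp
  qed
  \<comment> \<open>\<open>\<Theta>\<close> is the action of t on tuples of elements of the syzygy,
    pulled back along \<delta> to free modules.\<close>
  define \<Theta> where "\<Theta> = (\<lambda>y. mat_act ?G n m t (\<lambda>k. \<delta> (y k)))"
  have \<Theta>: "\<Theta> \<in> mod_hom R (power_module (free b) n) (power_module ?G m)"
    unfolding \<Theta>_def
    by (rule mod_hom_comp[OF pointwise_hom[OF free_mod free_mod \<delta>(1)] mat_act_hom[OF free_mod tc]])
  have lift: "\<exists>x\<in>carrier (power_module (free b) n). \<Theta> x = y" if y: "y \<in> pow_sub ?G m ?IW" for y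
  proof -
    have yc: "y \<in> carrier (power_module ?G m)" using y by (simp add: prod_sub_def)
    have yIW: "y j \<in> ?IW" for j
      using y F.submodule_zero[OF IW] by (cases "j < m") (auto simp: pow_sub_mem)
    \<comment> \<open>The entries y_j lie in \<mm>I R^g, so for each l the tuple of their l-th
      coordinates lies in \<mm>I R^m and \<open>onto\<close> solves for it; the solutions u_l are
      reassembled into q, an n-tuple of vectors in R^g.\<close>
    have "\<exists>u\<in>carrier (free n). mat_act (self_module R) n m t u = (\<lambda>j. y j l)" for l
    proof -
      have "y j l \<in> mI" for j
      proof -
        have "y j \<in> mI_free g" using yIW IW_mI by blast
        then show ?thesis
          using additive_subgroup.zero_closed[OF ideal.axioms(1)[OF mI_ideal]]
          by (cases "l < g") (simp_all add: pow_sub_mem)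
      qed
      moreover have "y j = (\<lambda>_. \<zero>)" if "j \<ge> m" for j using yc that by (simp add: free_zero)
      ultimately have "(\<lambda>j. y j l) \<in> mI_free m" using ideal.Icarr[OF mI_ideal] by (simp add: pow_sub_mem)
      from subsetD[OF onto this] obtain u where
        "u \<in> carrier (free n)" "(\<lambda>j. y j l) = mat_act (self_module R) n m t u" by (rule imageE)
      then show ?thesis by (intro bexI[of _ u]) simp_all
    qed
    then have "\<forall>l. \<exists>u. u \<in> carrier (free n) \<and> mat_act (self_module R) n m t u = (\<lambda>j. y j l)" by blast
    from choice[OF this] obtain u where u: "\<And>l. u l \<in> carrier (free n)"
      "\<And>l. mat_act (self_module R) n m t (u l) = (\<lambda>j. y j l)" by blast
    have uc: "u l k \<in> carrier R" for l k using free_carrier[OF is_cring u(1)] .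
    define q where "q k = (\<lambda>l. if l < g then u l k else \<zero>)" for k
    have qk: "q k \<in> carrier ?G" for k using uc by (auto simp: q_def free_module_def)
    have q: "q \<in> carrier (power_module ?G n)"
      using qk u(1) by (auto simp: q_def free_zero free_module_def fun_eq_iff)
    have tq: "mat_act ?G n m t q = y"
    proof (intro ext)
      fix j l
      have tqG: "mat_act ?G n m t q j \<in> carrier ?G"
        using power_carrier[OF free_mod mod_homD(1)[OF mat_act_hom[OF free_mod tc] q]] .
      have yG: "y j \<in> carrier ?G" using power_carrier[OF free_mod yc] .
      show "mat_act ?G n m t q j l = y j l"
      proof (cases "l < g")
        case True
        have "(\<lambda>k. q k l) = u l" using True by (simp add: q_def)
        moreover have "mat_act (self_module R) n m t (\<lambda>k. q k l) = (\<lambda>j. mat_act ?G n m t q j l)"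
          by (rule mat_act_natural[OF free_mod self_mod coord_free_hom[OF is_cring] tc qk])
        ultimately have "(\<lambda>j. mat_act ?G n m t q j l) = (\<lambda>j. y j l)" using u(2)[of l] by simp
        then show ?thesis by (rule fun_cong)
      next
        case False
        then show ?thesis using tqG yG by (simp add: free_module_def)
      qed
    qed
    have \<epsilon>q: "(\<lambda>k. \<epsilon> (q k)) \<in> carrier (power_module W n)"
      using mod_homD(1)[OF pointwise_hom[OF free_mod W \<epsilon>(1)] q] .
    have "mat_act W n m t (\<lambda>k. \<epsilon> (q k)) = (\<lambda>j. \<epsilon> (mat_act ?G n m t q j))"
      by (rule mat_act_natural[OF free_mod W \<epsilon>(1) tc qk])
    also have "\<dots> = (\<lambda>_. \<zero>\<^bsub>W\<^esub>)" using tq IW_ker[OF yIW] by simp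
    finally obtain z where z: "z \<in> carrier (power_module W p)" "(\<lambda>k. \<epsilon> (q k)) = mat_act W p n s z"
      using exact[OF \<epsilon>q] by blast
    \<comment> \<open>z is lifted along the surjection \<epsilon> to z'; then r = s z' has the same
      image in W^n as q, while t r = 0 because t s = 0 holds in each coordinate over R.\<close>
    have "\<exists>x\<in>carrier ?G. \<epsilon> x = z i" for i using power_carrier[OF W z(1)] \<epsilon>(2) by (metis imageE)
    then obtain z0 where z0: "\<And>i. z0 i \<in> carrier ?G" "\<And>i. \<epsilon> (z0 i) = z i" by metis
    define z' where "z' i = (if i < p then z0 i else \<zero>\<^bsub>?G\<^esub>)" for i
    have z'k: "z' i \<in> carrier ?G" for i using z0 by (simp add: z'_def)
    have z': "z' \<in> carrier (power_module ?G p)" using z0 by (simp add: z'_def)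
    have \<epsilon>z': "(\<lambda>i. \<epsilon> (z' i)) = z"
      using z0 z(1) mod_hom_zero[OF free_mod W \<epsilon>(1)] by (auto simp: z'_def fun_eq_iff)
    define r where "r = mat_act ?G p n s z'"
    have r: "r \<in> carrier (power_module ?G n)"
      unfolding r_def by (rule mod_homD(1)[OF mat_act_hom[OF free_mod s] z'])
    have rk: "r k \<in> carrier ?G" for k using power_carrier[OF free_mod r] .
    have \<epsilon>r: "\<epsilon> (r k) = \<epsilon> (q k)" for k
      using mat_act_natural[OF free_mod W \<epsilon>(1) s z'k] z(2) \<epsilon>z' by (simp add: r_def fun_eq_iff)
    have tr: "mat_act ?G n m t r = (\<lambda>_. \<zero>\<^bsub>?G\<^esub>)"
    proof (intro ext)
      fix j l
      have "z' i l = \<zero>" if "i \<ge> p" for i using that by (simp add: z'_def free_zero)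
      then have "(\<lambda>i. z' i l) \<in> carrier (free p)"
        using free_carrier[OF is_cring z'k] by (simp add: free_module_def)
      note ts[OF this]
      moreover have "mat_act (self_module R) p n s (\<lambda>i. z' i l) = (\<lambda>k. r k l)"
        unfolding r_def by (rule mat_act_natural[OF free_mod self_mod coord_free_hom[OF is_cring] s z'k])
      moreover have "mat_act (self_module R) n m t (\<lambda>k. r k l) = (\<lambda>j. mat_act ?G n m t r j l)"
        by (rule mat_act_natural[OF free_mod self_mod coord_free_hom[OF is_cring] tc rk])
      ultimately have "(\<lambda>j. mat_act ?G n m t r j l) = (\<lambda>_. \<zero>)" by simp
      from fun_cong[OF this, of j] show "mat_act ?G n m t r j l = \<zero>\<^bsub>?G\<^esub> l" by (simp add: free_zero)
    qed
    \<comment> \<open>The corrected tuple still satisfies t q' = y, and its entries lie in the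
      kernel of \<epsilon>, which is the image of \<delta>.\<close>
    define q' where "q' = q \<ominus>\<^bsub>power_module ?G n\<^esub> r"
    have q': "q' \<in> carrier (power_module ?G n)" unfolding q'_def using q r by (rule PF.M.minus_closed)
    have "\<epsilon> (q' k) = \<zero>\<^bsub>W\<^esub>" for k
    proof -
      have "q' k = q k \<ominus>\<^bsub>?G\<^esub> r k"
        unfolding q'_def
        using mod_hom_diff[OF power_module_is_module[OF free_mod] free_mod coord_hom[OF free_mod] q r] .
      then show ?thesis
        using mod_hom_diff[OF free_mod W \<epsilon>(1) qk rk] \<epsilon>r mod_homD(1)[OF \<epsilon>(1) qk]
        by (simp add: a_minus_def W.M.r_neg)
    qed
    then have "q' k \<in> \<delta> ` carrier (free b)" for k
      using power_carrier[OF free_mod q'] \<delta>(2) by (auto simp: a_kernel_def')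
    then have "\<exists>x\<in>carrier (free b). \<delta> x = q' k" for k by (metis imageE)
    then obtain x0 where x0: "\<And>k. x0 k \<in> carrier (free b)" "\<And>k. \<delta> (x0 k) = q' k" by metis
    define x where "x k = (if k < n then x0 k else \<zero>\<^bsub>free b\<^esub>)" for k
    have x: "x \<in> carrier (power_module (free b) n)" using x0 by (simp add: x_def)
    have \<delta>x: "(\<lambda>k. \<delta> (x k)) = q'"
      using x0 q' mod_hom_zero[OF free_mod free_mod \<delta>(1)] by (auto simp: x_def fun_eq_iff)
    have "\<Theta> x = mat_act ?G n m t q'" by (simp add: \<Theta>_def \<delta>x)
    also have "\<dots> = y \<ominus>\<^bsub>power_module ?G m\<^esub> \<zero>\<^bsub>power_module ?G m\<^esub>"
      unfolding q'_def
      using mod_hom_diff[OF power_module_is_module[OF free_mod] power_module_is_module[OF free_mod]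
          mat_act_hom[OF free_mod tc] q r] tq tr by (simp add: power_module_def)
    also have "\<dots> = y" using yc by (rule PF.M.diff_zero)
    finally show ?thesis using x by blast
  qed
  have "enat m * len R ?G {\<zero>\<^bsub>?G\<^esub>} ?IW =
      len R (power_module ?G m) (pow_sub ?G m {\<zero>\<^bsub>?G\<^esub>}) (pow_sub ?G m ?IW)"
    using F.submodule_zero[OF IW] by (intro len_pow_sub[OF free_mod F.submodule_zero_set IW, symmetric]) simp
  \<comment> \<open>The source is (R^b)^n modulo (\<mm>R^b)^n, of length n b;
    \<open>\<Theta>\<close> kills the second module and, by \<open>lift\<close>, reaches everything
    in the target.\<close>
  also have "\<dots> \<le> len R (power_module (free b) n)
      (pow_sub (free b) n (m_free b)) (pow_sub (free b) n (carrier (free b)))"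
  proof (rule len_surj[OF power_module_is_module[OF free_mod] power_module_is_module[OF free_mod] \<Theta>])
    show "submodule (pow_sub (free b) n (carrier (free b))) R (power_module (free b) n)"
      using prod_sub_submodule[OF free_mod F.carrier_is_submodule] .
    show Y': "submodule (pow_sub ?G m {\<zero>\<^bsub>?G\<^esub>}) R (power_module ?G m)"
      using prod_sub_submodule[OF free_mod F.submodule_zero_set] .
    { fix x assume x: "x \<in> pow_sub (free b) n (m_free b)"
      have "mat_act ?G n m t (\<lambda>k. \<delta> (x k)) = (\<lambda>_. \<zero>\<^bsub>?G\<^esub>)"
      proof
        fix j
        have "(\<Oplus>\<^bsub>?G\<^esub>k\<in>{..<n}. t j k \<odot>\<^bsub>?G\<^esub> \<delta> (x k)) = \<zero>\<^bsub>?G\<^esub>" if j: "j < m"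
        proof -
          have "(\<Oplus>\<^bsub>?G\<^esub>k\<in>{..<n}. t j k \<odot>\<^bsub>?G\<^esub> \<delta> (x k)) = (\<Oplus>\<^bsub>?G\<^esub>k\<in>{..<n}. \<zero>\<^bsub>?G\<^esub>)"
            using \<delta>_zero[OF t[OF j]] x by (intro F.M.finsum_cong') (auto simp: prod_sub_def)
          then show ?thesis by simp
        qed
        then show "mat_act ?G n m t (\<lambda>k. \<delta> (x k)) j = \<zero>\<^bsub>?G\<^esub>" by (simp add: mat_act_def)
      qed
      then have "\<Theta> x \<in> pow_sub ?G m {\<zero>\<^bsub>?G\<^esub>}" by (simp add: \<Theta>_def pow_sub_mem)
      then show "x \<in> pow_sub (free b) n (carrier (free b)) \<and> \<Theta> x \<in> pow_sub ?G m {\<zero>\<^bsub>?G\<^esub>}"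
        using x by (auto simp: prod_sub_def) }
    { fix z assume z: "z \<in> pow_sub ?G m ?IW"
      then obtain x where x: "x \<in> carrier (power_module (free b) n)" "\<Theta> x = z" using lift by blast
      have "z = \<Theta> x \<oplus>\<^bsub>power_module ?G m\<^esub> \<zero>\<^bsub>power_module ?G m\<^esub>"
        using x mod_homD(1)[OF \<Theta> x(1)] by (simp del: power_module_simps)
      then show "\<exists>x\<in>pow_sub (free b) n (carrier (free b)). \<exists>y\<in>pow_sub ?G m {\<zero>\<^bsub>?G\<^esub>}.
          z = \<Theta> x \<oplus>\<^bsub>power_module ?G m\<^esub> y"
        using x(1) PF.submodule_zero[OF Y'] by (metis pow_sub_carrier) }
  qed
  also have "\<dots> = enat n * len R (free b) (m_free b) (carrier (free b))"
    using pow_sub_free_carrier by (intro len_pow_sub[OF free_mod pow_free_sub[OF m_ideal] F.carrier_is_submodule])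
  also have "\<dots> = enat (n * b)" by (simp add: len_free_residue)
  finally show ?thesis .
qed

end

section \<open>Minimal resolutions and vanishing of Tor\<close>

text \<open>Adjunction between a matrix and its transpose under the pairing of N^p with R^p. The
  right-hand side is linear in x, so it is determined by its values at unit vectors, and these are
  the coordinates of the transpose applied to w.\<close>

lemma lin_comb_transpose:
  assumes N: "module R N" and \<phi>: "\<phi> \<in> mod_hom R (free_module R n) (free_module R p)"
    and w: "\<And>l. l < p \<Longrightarrow> w l \<in> carrier N" and x: "x \<in> carrier (free_module R n)"
  shows "lin_comb N n (mat_act N p n (\<lambda>k l. \<phi> (unit_vector R k) l) w) x = lin_comb N p w (\<phi> x)"
proof -
  interpret N: module R N by fact
  have h: "(\<lambda>x. lin_comb N p w (\<phi> x)) \<in> mod_hom R (free_module R n) N"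
    by (rule mod_hom_comp[OF \<phi> lin_comb_hom[OF N w]])
  have "lin_comb N p w (\<phi> x) = lin_comb N n (\<lambda>k. lin_comb N p w (\<phi> (unit_vector R k))) x"
    by (rule hom_eq_lin_comb[OF N h x])
  also have "\<dots> = lin_comb N n (mat_act N p n (\<lambda>k l. \<phi> (unit_vector R k) l) w) x"
    using free_carrier[OF N.R.is_cring x] mod_homD(1)[OF h unit_vector_carrier[OF N.R.is_cring]]
    by (intro N.finsum_cong') (auto simp: mat_act_def)
  finally show ?thesis by simp
qed

text \<open>The coset B + z is forced to equal B, and it contains z because 0 \<in> B.\<close>

lemma zero_quotient_subset:
  assumes N: "module R N" and B: "\<zero>\<^bsub>N\<^esub> \<in> B" and Z: "Z \<subseteq> carrier N"
    and zero: "zero_module (quotient_module (N\<lparr>carrier := Z\<rparr>) B)"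
  shows "Z \<subseteq> B"
proof
  interpret N: module R N by fact
  fix z assume z: "z \<in> Z"
  let ?c = "B +>\<^bsub>N\<lparr>carrier := Z\<rparr>\<^esub> z"
  have "?c \<in> a_rcosets\<^bsub>N\<lparr>carrier := Z\<rparr>\<^esub> B" using z by (auto simp: A_RCOSETS_def')
  then have "?c = B" using zero by (simp add: zero_module_def quotient_module_def)
  moreover have "\<zero>\<^bsub>N\<^esub> \<oplus>\<^bsub>N\<^esub> z \<in> ?c" using B by (auto simp: a_r_coset_def')
  ultimately show "z \<in> B" using z Z by auto
qed

context artinian_local
begin

abbreviation diff_matrix :: "('a, 'l) module \<Rightarrow> nat \<Rightarrow> nat \<Rightarrow> nat \<Rightarrow> 'a" where
  "diff_matrix L i \<equiv> \<lambda>j k. res_diff R \<mm> L i (unit_vector R k) j"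

lemma minimal_resolutionD:
  assumes "minimal_free_resolution R \<mm> L \<beta> \<epsilon> d"
  shows "\<epsilon> \<in> mod_hom R (free (\<beta> 0)) L"
    and "d i \<in> mod_hom R (free (\<beta> (Suc i))) (free (\<beta> i))"
    and "\<epsilon> ` carrier (free (\<beta> 0)) = carrier L"
    and "d 0 ` carrier (free (\<beta> 1)) = a_kernel (free (\<beta> 0)) L \<epsilon>"
    and "d (Suc i) ` carrier (free (\<beta> (Suc (Suc i)))) = a_kernel (free (\<beta> (Suc i))) (free (\<beta> i)) (d i)"
    and "d i ` carrier (free (\<beta> (Suc i))) \<subseteq> m_free (\<beta> i)"
  using assms ideal_smult_free[OF is_cring m_ideal]
  unfolding minimal_free_resolution_def Let_def by auto

text \<open>The differential \<open>res_diff R \<mm> L j\<close>, regarded as a minimal cover of the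
  syzygy it maps onto, has the image of the next differential as its kernel, so
  \<open>ideal_free_kernel\<close> bounds that image.\<close>

lemma syzygy_ideal_free_entries:
  assumes L: "module R L" and fin: "len R L {\<zero>\<^bsub>L\<^esub>} (carrier L) < \<infinity>"
    and I: "ideal I R" and I1: "\<one> \<notin> I" and free: "ideal_free R I (syzygy R \<mm> L (Suc j))"
  shows "res_diff R \<mm> L (Suc j) ` carrier (free (betti R \<mm> L (Suc (Suc j))))
    \<subseteq> pow_sub (self_module R) (betti R \<mm> L (Suc j)) I"
proof -
  note res = minimal_resolutionD[OF min_res_resolution[OF L fin]]
  interpret F: module R "free n" for n by (rule free_mod)
  let ?b = "betti R \<mm> L" and ?d = "res_diff R \<mm> L"
  let ?S = "syzygy R \<mm> L (Suc j)"
  have S: "?S = (free (?b j))\<lparr>carrier := ?d j ` carrier (free (?b (Suc j)))\<rparr>"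
    by (simp add: syzygy_def)
  have Sm: "module R ?S"
    unfolding S by (rule restrict_module[OF free_mod submodule_image[OF free_mod free_mod res(2) F.carrier_is_submodule]])
  have f: "?d j \<in> mod_hom R (free (?b (Suc j))) ?S"
    unfolding S by (rule mod_hom_corestrict[OF res(2) order.refl])
  have ker: "a_kernel (free (?b (Suc j))) ?S (?d j) = a_kernel (free (?b (Suc j))) (free (?b j)) (?d j)"
    by (simp add: a_kernel_def' S)
  have "a_kernel (free (?b (Suc j))) ?S (?d j) \<subseteq> pow_sub (self_module R) (?b (Suc j)) I"
  proof (rule ideal_free_kernel[OF Sm I I1 free f])
    show "?d j ` carrier (free (?b (Suc j))) = carrier ?S" by (simp add: S)
    show "a_kernel (free (?b (Suc j))) ?S (?d j) \<subseteq> m_free (?b (Suc j))"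
      unfolding ker using res(5)[of j] res(6)[of "Suc j"] by simp
  qed
  then show ?thesis unfolding ker using res(5)[of j] by simp
qed

text \<open>The form in which \<open>syzygy_inequality\<close> and \<open>transpose_onto\<close>
  take up the vanishing of Tor: exactness of a complex of matrices acting on powers of N.\<close>

lemma Tor_vanishing:
  assumes L: "module R L" and fin: "len R L {\<zero>\<^bsub>L\<^esub>} (carrier L) < \<infinity>" and N: "module R N"
    and tor: "zero_module (Tor R \<mm> (Suc j) L N)"
    and w: "w \<in> carrier (power_module N (betti R \<mm> L (Suc j)))"
    and w0: "mat_act N (betti R \<mm> L (Suc j)) (betti R \<mm> L j) (diff_matrix L j) w = (\<lambda>_. \<zero>\<^bsub>N\<^esub>)"
  shows "\<exists>z\<in>carrier (power_module N (betti R \<mm> L (Suc (Suc j)))).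
    w = mat_act N (betti R \<mm> L (Suc (Suc j))) (betti R \<mm> L (Suc j)) (diff_matrix L (Suc j)) z"
proof -
  note res = minimal_resolutionD[OF min_res_resolution[OF L fin]]
  interpret N: module R N by fact
  let ?b = "betti R \<mm> L"
  let ?P = "power_module N (?b (Suc j))"
  have td: "tor_diff R \<mm> L N i y = mat_act N (?b (Suc i)) (?b i) (diff_matrix L i) y"
    if "y \<in> carrier (power_module N (?b (Suc i)))" for i y
    unfolding tor_diff_def by (rule mat_act_eq_tensor_map[OF N res(2) that])
  let ?B = "tor_diff R \<mm> L N (Suc j) ` carrier (power_module N (?b (Suc (Suc j))))"
  have "tor_cycles R \<mm> L N (Suc j) \<subseteq> ?B"
  proof (rule zero_quotient_subset[OF power_module_is_module[OF N]])
    show "tor_cycles R \<mm> L N (Suc j) \<subseteq> carrier ?P" by (auto simp: tor_cycles_def a_kernel_def')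
    show "zero_module (quotient_module (?P\<lparr>carrier := tor_cycles R \<mm> L N (Suc j)\<rparr>) ?B)"
      using tor by (simp add: Tor_def)
    have "diff_matrix L (Suc j) r k \<in> carrier R" if "k < ?b (Suc (Suc j))" for r k
      using free_carrier[OF is_cring mod_homD(1)[OF res(2) unit_vector_carrier[OF is_cring that]]] .
    then have hom: "mat_act N (?b (Suc (Suc j))) (?b (Suc j)) (diff_matrix L (Suc j))
        \<in> mod_hom R (power_module N (?b (Suc (Suc j)))) ?P"
      by (intro mat_act_hom[OF N]) blast
    have z: "\<zero>\<^bsub>power_module N (?b (Suc (Suc j)))\<^esub> \<in> carrier (power_module N (?b (Suc (Suc j))))"
      by (simp add: power_module_def)
    have "tor_diff R \<mm> L N (Suc j) \<zero>\<^bsub>power_module N (?b (Suc (Suc j)))\<^esub> = \<zero>\<^bsub>?P\<^esub>"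
      using mod_hom_zero[OF power_module_is_module[OF N] power_module_is_module[OF N] hom] td[OF z] by simp
    then show "\<zero>\<^bsub>?P\<^esub> \<in> ?B" using z by (metis imageI)
  qed
  moreover have "w \<in> tor_cycles R \<mm> L N (Suc j)"
    using w w0 td[OF w] by (simp add: tor_cycles_def a_kernel_def' power_module_def)
  ultimately obtain z where "z \<in> carrier (power_module N (?b (Suc (Suc j))))" "w = tor_diff R \<mm> L N (Suc j) z"
    by blast
  then show ?thesis using td by auto
qed

section \<open>Positive Betti numbers, a length count, and the case of a free canonical
  module\<close>

lemma augmentation_bij:
  assumes L: "module R L" and res: "minimal_free_resolution R \<mm> L \<beta> \<epsilon> d" and b1: "\<beta> 1 = 0"
  shows "bij_betw \<epsilon> (carrier (free (\<beta> 0))) (carrier L)"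
proof -
  note res = minimal_resolutionD[OF res]
  have "carrier (free (\<beta> 1)) = {\<zero>\<^bsub>free (\<beta> 1)\<^esub>}"
    unfolding b1 by (auto simp: free_module_def power_module_def)
  then have ker: "a_kernel (free (\<beta> 0)) L \<epsilon> = {\<zero>\<^bsub>free (\<beta> 0)\<^esub>}"
    using mod_hom_zero[OF free_mod free_mod res(2)[of 0]] by (simp add: res(4)[symmetric])
  have "inj_on \<epsilon> (carrier (free (\<beta> 0)))"
    by (rule mod_hom_inj[OF free_mod L res(1)]) (use ker in \<open>auto simp: a_kernel_def'\<close>)
  then show ?thesis using res(3) by (simp add: bij_betw_def)
qed

text \<open>If the first Betti number vanished, the augmentation would be an isomorphism from a free
  module. If a later one vanished first, the preceding differential would be injective, although its
  values lie in \<mm> times its target and are killed by a nonzero socle element of R.\<close>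

lemma betti_pos:
  assumes L: "module R L" and res: "minimal_free_resolution R \<mm> L \<beta> \<epsilon> d" and nonfree: "\<not> fg_free R L"
  shows "0 < \<beta> (Suc j)"
proof (induction j)
  case 0
  show ?case
  proof (rule ccontr)
    assume "\<not> ?thesis"
    then have "bij_betw \<epsilon> (carrier (free (\<beta> 0))) (carrier L)" using augmentation_bij[OF L res] by simp
    from mod_hom_inverse[OF free_mod L minimal_resolutionD(1)[OF res] this] have "fg_free R L"
      by (auto simp: fg_free_def module_isomorphic_def)
    then show False using nonfree by simp
  qed
next
  case (Suc j)
  note res = minimal_resolutionD[OF res]
  show ?case
  proof (rule ccontr)
    assume "\<not> ?thesis"
    then have b0: "\<beta> (Suc (Suc j)) = 0" by simp
    have "carrier (free (\<beta> (Suc (Suc j)))) = {\<zero>\<^bsub>free (\<beta> (Suc (Suc j)))\<^esub>}"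
      unfolding b0 by (auto simp: free_module_def power_module_def)
    then have ker: "a_kernel (free (\<beta> (Suc j))) (free (\<beta> j)) (d j) = {\<zero>\<^bsub>free (\<beta> (Suc j))\<^esub>}"
      using mod_hom_zero[OF free_mod free_mod res(2)[of "Suc j"]] by (simp add: res(5)[symmetric])
    have "\<one> \<notin> {\<zero>}" using one_notin_m additive_subgroup.zero_closed[OF ideal.axioms(1)[OF m_ideal]] by auto
    from socle_above[OF zeroideal this] obtain x
      where "x \<in> carrier R" "x \<notin> {\<zero>}" "\<And>a. a \<in> \<mm> \<Longrightarrow> a \<otimes> x \<in> {\<zero>}" by blast
    then have x: "x \<in> carrier R" "x \<noteq> \<zero>" "\<And>a. a \<in> \<mm> \<Longrightarrow> a \<otimes> x = \<zero>" by simp_all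
    let ?e = "unit_vector R 0" and ?F = "free (\<beta> (Suc j))"
    have e: "?e \<in> carrier ?F" using unit_vector_carrier[OF is_cring Suc] .
    have de: "d j ?e \<in> m_free (\<beta> j)" using res(6) e by blast
    have "d j (x \<odot>\<^bsub>?F\<^esub> ?e) = x \<odot>\<^bsub>free (\<beta> j)\<^esub> d j ?e" using mod_homD(3)[OF res(2) x(1) e] .
    also have "\<dots> = \<zero>\<^bsub>free (\<beta> j)\<^esub>"
    proof
      fix k
      show "(x \<odot>\<^bsub>free (\<beta> j)\<^esub> d j ?e) k = \<zero>\<^bsub>free (\<beta> j)\<^esub> k"
        using de x m_comm[of x "d j ?e k"]
        by (cases "k < \<beta> j")
          (auto simp: pow_sub_mem free_module_def free_zero[unfolded free_module_def])
    qed
    finally have "x \<odot>\<^bsub>?F\<^esub> ?e \<in> a_kernel ?F (free (\<beta> j)) (d j)"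
      using module.smult_closed[OF free_mod x(1) e] by (simp add: a_kernel_def')
    then have "x \<odot>\<^bsub>?F\<^esub> ?e = (\<lambda>_. \<zero>)" using ker by (simp add: free_zero)
    then have "(x \<odot>\<^bsub>?F\<^esub> ?e) 0 = \<zero>" by simp
    then show False using x by (simp add: free_module_def unit_vector_def)
  qed
qed

text \<open>The kernel of \<phi> is an image of R^p, and the image of \<phi> lies in \<mm>R^m. The
  summand m on the left is the length of R^m/\<mm>R^m, gained from minimality.\<close>

lemma exact_length_bound:
  assumes \<phi>: "\<phi> \<in> mod_hom R (free n) (free m)" "\<phi> ` carrier (free n) \<subseteq> m_free m"
    and \<psi>: "\<psi> \<in> mod_hom R (free p) (free n)" "\<psi> ` carrier (free p) = a_kernel (free n) (free m) \<phi>"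
  shows "enat n * ring_len + enat m \<le> enat m * ring_len + enat p * ring_len"
proof -
  interpret F: module R "free i" for i by (rule free_mod)
  let ?K = "a_kernel (free n) (free m) \<phi>"
  have K: "submodule ?K R (free n)" by (rule submodule_kernel[OF free_mod free_mod \<phi>(1)])
  have M: "submodule (m_free m) R (free m)" by (rule pow_free_sub[OF m_ideal])
  have "len R (free n) ?K (carrier (free n)) \<le> len R (free m) {\<zero>\<^bsub>free m\<^esub>} (m_free m)"
    by (rule len_inj[OF free_mod free_mod \<phi>(1) F.carrier_is_submodule M F.submodule_zero_set])
       (use F.submodule_zero[OF M] \<phi>(2) in \<open>auto simp: a_kernel_def'\<close>)
  moreover have "len R (free m) {\<zero>\<^bsub>free m\<^esub>} (m_free m) + enat m = enat m * ring_len"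
    using len_additive[OF free_mod F.submodule_zero_set M F.carrier_is_submodule] F.submodule_zero[OF M]
    by (simp add: len_free len_free_residue pow_sub_free_carrier)
  ultimately have 1: "len R (free n) ?K (carrier (free n)) + enat m \<le> enat m * ring_len"
    by (metis add_right_mono)
  have 2: "len R (free n) {\<zero>\<^bsub>free n\<^esub>} ?K \<le> enat p * ring_len"
    using len_free_image_le[OF free_mod \<psi>(1)] \<psi>(2) by simp
  have "enat n * ring_len = len R (free n) {\<zero>\<^bsub>free n\<^esub>} ?K + len R (free n) ?K (carrier (free n))"
    using len_additive[OF free_mod F.submodule_zero_set K F.carrier_is_submodule] F.submodule_zero[OF K]
      F.submoduleE(1)[OF K] by (simp add: len_free)
  then have "enat n * ring_len + enat m
      = (len R (free n) ?K (carrier (free n)) + enat m) + len R (free n) {\<zero>\<^bsub>free n\<^esub>} ?K"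
    by (simp add: ac_simps)
  also have "\<dots> \<le> enat m * ring_len + enat p * ring_len" using 1 2 by (rule add_mono)
  finally show ?thesis .
qed

text \<open>R is a direct summand of R^g, hence of W up to isomorphism, and a summand of an
  injective module is injective. So R is its own injective resolution.\<close>

lemma gorenstein_if_canonical_free:
  assumes can: "canonical_module R \<mm> W" and \<epsilon>: "\<epsilon> \<in> mod_hom R (free g) W"
    and bij: "bij_betw \<epsilon> (carrier (free g)) (carrier W)"
  shows "gorenstein_local_ring R"
proof -
  note W = canonical_is_module[OF can]
  interpret W: module R W by (rule W)
  interpret F: module R "free n" for n by (rule free_mod)
  let ?\<gamma> = "the_inv_into (carrier (free g)) \<epsilon>"
  note \<gamma> = mod_hom_inverse[OF free_mod W \<epsilon> bij]
  \<comment> \<open>W is not zero, since it contains the generator of its socle.\<close>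
  have g: "0 < g"
  proof (rule ccontr)
    assume "\<not> 0 < g"
    then have "carrier (free g) = {\<zero>\<^bsub>free g\<^esub>}" by (auto simp: free_module_def power_module_def)
    then have "carrier W = {\<zero>\<^bsub>W\<^esub>}" using bij mod_hom_zero[OF free_mod W \<epsilon>] by (simp add: bij_betw_def)
    then show False using canonical_socle[OF can] by blast
  qed
  let ?s = "\<lambda>n x j. if j = (0::nat) then x else \<zero>"
  have slot: "?s n \<in> mod_hom R (self_module R) (free n)" if "0 < n" for n
    using slot_hom[OF self_mod that] unfolding self_module_simps free_module_def .
  \<comment> \<open>\<open>\<iota>\<close> embeds R^1 as the first slot of R^g and
    \<open>\<rho>\<close> projects back, so \<open>\<rho>\<close> after \<open>\<iota>\<close> is
    the identity; a map into R^1 is extended as a map into W and then projected.\<close>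
  define \<iota> where "\<iota> v = \<epsilon> (?s g (v (0::nat)))" for v
  define \<rho> where "\<rho> w = ?s 1 (?\<gamma> w 0)" for w
  have \<iota>: "\<iota> \<in> mod_hom R (free 1) W"
    unfolding \<iota>_def by (rule mod_hom_comp[OF mod_hom_comp[OF coord_free_hom[OF is_cring] slot[OF g]] \<epsilon>])
  have \<rho>: "\<rho> \<in> mod_hom R W (free 1)"
    unfolding \<rho>_def
    by (rule mod_hom_comp[OF mod_hom_comp[OF \<gamma>(1) coord_free_hom[OF is_cring]] slot[OF zero_less_one]])
  have \<rho>\<iota>: "\<rho> (\<iota> v) = v" if v: "v \<in> carrier (free 1)" for v
  proof -
    have "?s g (v 0) \<in> carrier (free g)"
      using mod_homD(1)[OF slot[OF g], of "v 0"] free_carrier[OF is_cring v] by simp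
    then have "?\<gamma> (\<iota> v) = ?s g (v 0)"
      unfolding \<iota>_def using bij by (intro the_inv_into_f_f) (simp_all add: bij_betw_def)
    then show ?thesis using v by (auto simp: \<rho>_def free_module_def fun_eq_iff)
  qed
  have inj1: "injective_module R (free 1)"
    unfolding injective_module_def
  proof (intro conjI allI impI free_mod)
    fix B :: "('a, nat \<Rightarrow> 'a) module" and A f
    assume BAf: "module R B \<and> submodule A R B \<and> f \<in> mod_hom R (B\<lparr>carrier := A\<rparr>) (free 1)"
    then have "(\<lambda>x. \<iota> (f x)) \<in> mod_hom R (B\<lparr>carrier := A\<rparr>) W" using mod_hom_comp[OF _ \<iota>] by blast
    then obtain h where h: "h \<in> mod_hom R B W" "\<forall>x\<in>A. h x = \<iota> (f x)"
      using canonical_injective[OF can] BAf unfolding injective_module_def by blast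
    have "f x \<in> carrier (free 1)" if "x \<in> A" for x
      using mod_homD(1)[of f R "B\<lparr>carrier := A\<rparr>" "free 1"] BAf that by simp
    then have "\<forall>x\<in>A. \<rho> (h x) = f x" using h(2) \<rho>\<iota> by simp
    then show "\<exists>g\<in>mod_hom R B (free 1). \<forall>x\<in>A. g x = f x" by (rule bexI[OF _ mod_hom_comp[OF h(1) \<rho>]])
  qed
  have F0: "carrier (free 0) = {\<zero>\<^bsub>free 0\<^esub>}" by (auto simp: free_module_def power_module_def)
  have zero_hom: "(\<lambda>_. \<zero>\<^bsub>free n\<^esub>) \<in> mod_hom R N (free n)" for N :: "('a, nat \<Rightarrow> 'a) module" and n
    using F.smult_r_null by (auto simp: mod_hom_def)
  have inj0: "injective_module R (free 0)"
    unfolding injective_module_def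
  proof (intro conjI allI impI free_mod)
    fix B :: "('a, nat \<Rightarrow> 'a) module" and A f
    assume BAf: "module R B \<and> submodule A R B \<and> f \<in> mod_hom R (B\<lparr>carrier := A\<rparr>) (free 0)"
    have f0: "f x = \<zero>\<^bsub>free 0\<^esub>" if "x \<in> A" for x
      using mod_homD(1)[of f R "B\<lparr>carrier := A\<rparr>" "free 0"] BAf that F0 by simp
    show "\<exists>g\<in>mod_hom R B (free 0). \<forall>x\<in>A. g x = f x"
      by (rule bexI[OF _ zero_hom]) (simp add: f0)
  qed
  \<comment> \<open>The resolution is R^1 in degree 0 and R^0 = 0 in all others. R^1 stands in for R
    because the modules of an injective resolution must have elements of type
    \<open>nat \<Rightarrow> 'a\<close>.\<close>
  define E where "E i = free (if i = 0 then 1 else 0)" for i :: nat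
  have "finite_injective_dimension R (self_module R)"
    unfolding finite_injective_dimension_def
  proof (intro exI[of _ E] exI[of _ "?s 1"] exI[of _ "\<lambda>i _. \<zero>\<^bsub>E (Suc i)\<^esub>"] conjI allI exI[of _ 0] impI)
    show "injective_module R (E i)" for i using inj0 inj1 by (simp add: E_def)
    show "?s 1 \<in> mod_hom R (self_module R) (E 0)" using slot[of 1] by (simp add: E_def)
    show "(\<lambda>_. \<zero>\<^bsub>E (Suc i)\<^esub>) \<in> mod_hom R (E i) (E (Suc i))" for i unfolding E_def by (rule zero_hom)
    show "inj_on (?s 1) (carrier (self_module R))" by (rule inj_onI) (metis)
    have "v \<in> ?s 1 ` carrier R" if v: "v \<in> carrier (free 1)" for v
      using v by (intro image_eqI[of _ _ "v 0"]) (auto simp: free_module_def fun_eq_iff)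
    then have "?s 1 ` carrier R = carrier (free 1)"
      using mod_homD(1)[OF slot[OF zero_less_one]] by auto
    then show "?s 1 ` carrier (self_module R) = a_kernel (E 0) (E 1) (\<lambda>_. \<zero>\<^bsub>E (Suc 0)\<^esub>)"
      by (simp add: a_kernel_def' E_def)
    show "(\<lambda>_. \<zero>\<^bsub>E (Suc i)\<^esub>) ` carrier (E i) =
        a_kernel (E (Suc i)) (E (Suc (Suc i))) (\<lambda>_. \<zero>\<^bsub>E (Suc (Suc i))\<^esub>)" for i
      using F0 F.zero_closed[of "if i = 0 then 1 else 0"] by (auto simp: a_kernel_def' E_def)
    show "carrier (E i) = {\<zero>\<^bsub>E i\<^esub>}" if "0 < i" for i using F0 that by (simp add: E_def)
  qed
  then show ?thesis using noetherian local by (auto simp: gorenstein_local_ring_def)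
qed

end

section \<open>Generators of the ideal\<close>

context artinian_local_ideal
begin

text \<open>A minimal cover f : R^e \<rightarrow> I satisfies \<mm>I \<subseteq> f(\<mm>R^e), so
  whatever it sends into \<mm>I lies in \<mm>R^e; hence the residue space of R^e embeds into
  I/\<mm>I.\<close>

lemma betti_ideal_le:
  "enat (betti R \<mm> ((self_module R)\<lparr>carrier := I\<rparr>) 0) \<le> len R (self_module R) mI I"
proof -
  interpret S: module R "self_module R" by (rule self_mod)
  interpret F: module R "free n" for n by (rule free_mod)
  let ?J = "(self_module R)\<lparr>carrier := I\<rparr>"
  have I: "submodule I R (self_module R)" using I_ideal by (simp add: ideal_iff_submodule)
  have J: "module R ?J" by (rule restrict_module[OF self_mod I])
  have id: "(\<lambda>x. x) \<in> mod_hom R ?J (self_module R)" using I_carrier by (auto simp: mod_hom_def)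
  \<comment> \<open>I inherits finite length from R along the inclusion, so its chosen resolution is
    a genuine one.\<close>
  have "len R ?J {\<zero>\<^bsub>?J\<^esub>} (carrier ?J) \<le> len R (self_module R) {\<zero>\<^bsub>self_module R\<^esub>} (carrier (self_module R))"
    by (rule len_inj[OF J self_mod id module.carrier_is_submodule[OF J] S.carrier_is_submodule S.submodule_zero_set])
       (use I_carrier in auto)
  then have fin: "len R ?J {\<zero>\<^bsub>?J\<^esub>} (carrier ?J) < \<infinity>"
    unfolding self_module_simps by (rule order.strict_trans1[OF _ ring_finite_length])
  define e where "e = betti R \<mm> ?J 0"
  define f where "f = fst (snd (min_res R \<mm> ?J))"
  note res = minimal_resolutionD[OF min_res_resolution[OF J fin], folded e_def f_def]
  have f: "f \<in> mod_hom R (free e) ?J" "f ` carrier (free e) = I" using res(1,3) by simp_all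
  have ker: "a_kernel (free e) ?J f \<subseteq> m_free e" using res(4) res(6)[of 0] by (simp add: e_def)
  have fS: "f \<in> mod_hom R (free e) (self_module R)" using mod_hom_comp[OF f(1) id] by simp
  have ker': "a_kernel (free e) (self_module R) f \<subseteq> m_free e" using ker by (simp add: a_kernel_def')
  have mI: "submodule mI R (self_module R)" using mI_ideal by (simp add: ideal_iff_submodule)
  have fm: "submodule (f ` m_free e) R (self_module R)"
    by (rule submodule_image[OF free_mod self_mod fS pow_free_sub[OF m_ideal]])
  have mI_image: "x \<in> f ` m_free e" if "x \<in> mI" for x
    using that
  proof induction
    case (prod a c)
    then obtain v where v: "v \<in> carrier (free e)" "c = f v" using f(2) by auto
    have "a \<odot>\<^bsub>free e\<^esub> v \<in> m_free e"
      using prod(1) v(1) free_carrier[OF is_cring v(1)] ideal.I_r_closed[OF m_ideal prod(1)] m_carrier[OF prod(1)]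
      by (auto simp: pow_sub_mem free_module_def)
    moreover have "f (a \<odot>\<^bsub>free e\<^esub> v) = a \<otimes> c"
      using mod_homD(3)[OF fS m_carrier[OF prod(1)] v(1)] v(2) by simp
    ultimately show ?case by (metis imageI)
  next
    case (sum x y)
    then show ?case using S.submoduleE(5)[OF fm] by simp
  qed
  have "enat e = len R (free e) (m_free e) (carrier (free e))" by (rule len_free_residue[symmetric])
  also have "\<dots> \<le> len R (self_module R) mI I"
  proof (rule len_inj[OF free_mod self_mod fS F.carrier_is_submodule I mI mI_sub_I])
    show "x \<in> m_free e" if "x \<in> carrier (free e)" "f x \<in> mI" for x
      using minimal_cover_reflects[OF self_mod fS ker' that(1) mI_image[OF that(2)]] .
  qed (use f(2) in auto)
  finally show ?thesis by (simp add: e_def)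
qed

end

section \<open>Transposed resolutions\<close>

context artinian_local
begin

text \<open>By adjunction, the j-th coordinate of the product pairs v with \<phi>(\<psi>(e_j)),
  which is 0.\<close>

lemma transpose_complex:
  assumes \<phi>: "\<phi> \<in> mod_hom R (free n) (free p)" and \<psi>: "\<psi> \<in> mod_hom R (free m) (free n)"
    and zero: "\<And>x. x \<in> carrier (free m) \<Longrightarrow> \<phi> (\<psi> x) = \<zero>\<^bsub>free p\<^esub>" and v: "v \<in> carrier (free p)"
  shows "mat_act (self_module R) n m (\<lambda>j k. \<psi> (unit_vector R j) k)
    (mat_act (self_module R) p n (\<lambda>k l. \<phi> (unit_vector R k) l) v) = (\<lambda>_. \<zero>)"
proof
  fix j
  let ?S = "self_module R"
  interpret S: module R ?S by (rule self_mod)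
  have vc: "v l \<in> carrier ?S" for l using free_carrier[OF is_cring v] by simp
  show "mat_act ?S n m (\<lambda>j k. \<psi> (unit_vector R j) k) (mat_act ?S p n (\<lambda>k l. \<phi> (unit_vector R k) l) v) j = \<zero>"
  proof (cases "j < m")
    case True
    have e: "unit_vector R j \<in> carrier (free m)" using unit_vector_carrier[OF is_cring True] .
    have "lin_comb ?S n (mat_act ?S p n (\<lambda>k l. \<phi> (unit_vector R k) l) v) (\<psi> (unit_vector R j))
        = lin_comb ?S p v (\<phi> (\<psi> (unit_vector R j)))"
      by (rule lin_comb_transpose[OF self_mod \<phi> vc mod_homD(1)[OF \<psi> e]])
    also have "\<dots> = lin_comb ?S p v \<zero>\<^bsub>free p\<^esub>" by (simp only: zero[OF e])
    also have "\<dots> = \<zero>" using mod_hom_zero[OF free_mod self_mod lin_comb_hom[OF self_mod vc]] by simp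
    finally show ?thesis using True by (simp add: mat_act_def)
  qed (simp add: mat_act_def)
qed

text \<open>Exactness of Hom(-, W). The tuple w is the functional e_k \<mapsto> w_k on R^n; it kills
  the image of \<psi>, hence the kernel of \<phi>, so it factors through the image of \<phi> and
  extends to R^p. The values of the extension at the unit vectors form z.\<close>

lemma transpose_exact:
  assumes inj: "injective_module R W"
    and \<phi>: "\<phi> \<in> mod_hom R (free n) (free p)" and \<psi>: "\<psi> \<in> mod_hom R (free m) (free n)"
    and exact: "\<psi> ` carrier (free m) = a_kernel (free n) (free p) \<phi>"
    and w: "w \<in> carrier (power_module W n)"
    and w0: "mat_act W n m (\<lambda>j k. \<psi> (unit_vector R j) k) w = (\<lambda>_. \<zero>\<^bsub>W\<^esub>)"
  shows "\<exists>z\<in>carrier (power_module W p). w = mat_act W p n (\<lambda>k l. \<phi> (unit_vector R k) l) z"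
proof -
  have W: "module R W" using inj by (simp add: injective_module_def)
  interpret W: module R W by (rule W)
  interpret F: module R "free i" for i by (rule free_mod)
  have wc: "w k \<in> carrier W" for k using power_carrier[OF W w] .
  let ?g = "lin_comb W n w"
  have g: "?g \<in> mod_hom R (free n) W" by (rule lin_comb_hom[OF W wc])
  have "(\<lambda>x. ?g (\<psi> x)) ` carrier (free m) \<subseteq> {\<zero>\<^bsub>W\<^esub>}"
  proof (rule hom_free_image_least[OF W W.submodule_zero_set mod_hom_comp[OF \<psi> g]])
    fix j assume "j < m"
    then show "?g (\<psi> (unit_vector R j)) \<in> {\<zero>\<^bsub>W\<^esub>}" using fun_cong[OF w0, of j] by (simp add: mat_act_def)
  qed
  then have "?g (\<psi> x) = \<zero>\<^bsub>W\<^esub>" if "x \<in> carrier (free m)" for x using that by blast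
  then have "?g y = \<zero>\<^bsub>W\<^esub>" if "y \<in> carrier (free n)" "\<phi> y = \<zero>\<^bsub>free p\<^esub>" for y
  proof -
    have "y \<in> \<psi> ` carrier (free m)" using that exact by (simp add: a_kernel_def')
    then show ?thesis using \<open>\<And>x. x \<in> carrier (free m) \<Longrightarrow> ?g (\<psi> x) = \<zero>\<^bsub>W\<^esub>\<close> by auto
  qed
  from hom_factor_image[OF free_mod free_mod W \<phi> g this]
  obtain h where h: "h \<in> mod_hom R ((free p)\<lparr>carrier := \<phi> ` carrier (free n)\<rparr>) W"
    "\<And>x. x \<in> carrier (free n) \<Longrightarrow> h (\<phi> x) = ?g x" by blast
  from injective_extension[OF inj submodule_image[OF free_mod free_mod \<phi> F.carrier_is_submodule] h(1)]
  obtain G where G: "G \<in> mod_hom R (free p) W" "\<And>x. x \<in> carrier (free n) \<Longrightarrow> G (\<phi> x) = ?g x"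
    using h(2) by auto
  define z where "z l = (if l < p then G (unit_vector R l) else \<zero>\<^bsub>W\<^esub>)" for l
  have zc: "z l \<in> carrier W" for l
    using mod_homD(1)[OF G(1) unit_vector_carrier[OF is_cring]] by (simp add: z_def)
  have z: "z \<in> carrier (power_module W p)"
    using mod_homD(1)[OF G(1) unit_vector_carrier[OF is_cring]] by (simp add: z_def)
  have Gz: "G u = lin_comb W p z u" if "u \<in> carrier (free p)" for u
  proof -
    have "G u = lin_comb W p (\<lambda>l. G (unit_vector R l)) u" by (rule hom_eq_lin_comb[OF W G(1) that])
    also have "\<dots> = lin_comb W p z u"
      using zc free_carrier[OF is_cring that] by (intro W.finsum_cong') (auto simp: z_def)
    finally show ?thesis .
  qed
  have "w k = mat_act W p n (\<lambda>k l. \<phi> (unit_vector R k) l) z k" for k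
  proof (cases "k < n")
    case True
    have e: "unit_vector R k \<in> carrier (free n)" using unit_vector_carrier[OF is_cring True] .
    have "w k = ?g (unit_vector R k)" by (rule lin_comb_unit[OF W wc True, symmetric])
    also have "\<dots> = lin_comb W p z (\<phi> (unit_vector R k))"
      using G(2)[OF e] Gz[OF mod_homD(1)[OF \<phi> e]] by simp
    finally show ?thesis using True by (simp add: mat_act_def)
  next
    case False
    then show ?thesis using w by (simp add: mat_act_def)
  qed
  then show ?thesis using z by blast
qed

end

context artinian_local_ideal
begin

text \<open>If some v \<in> \<mm>I R^m were outside the image C of the transpose of \<psi>, a
  functional f to W would vanish on C but not at v. Its values w_j = f(e_j) form a cycle of the
  complex over W, hence a boundary under the matrix of \<chi>, whose entries lie in \<mm>; then v_j
  w_j = 0 for all j, as \<mm>I annihilates \<mm>, and f v = 0.\<close>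

lemma transpose_onto:
  assumes can: "canonical_module R \<mm> W"
    and \<psi>: "\<psi> \<in> mod_hom R (free m) (free n)"
    and \<chi>: "\<chi> \<in> mod_hom R (free q) (free m)" "\<chi> ` carrier (free q) \<subseteq> m_free m"
    and exact: "\<And>w. w \<in> carrier (power_module W m) \<Longrightarrow>
      mat_act W m n (\<lambda>k j. \<psi> (unit_vector R j) k) w = (\<lambda>_. \<zero>\<^bsub>W\<^esub>) \<Longrightarrow>
      \<exists>z\<in>carrier (power_module W q). w = mat_act W q m (\<lambda>j l. \<chi> (unit_vector R l) j) z"
  shows "mI_free m \<subseteq> mat_act (self_module R) n m (\<lambda>j k. \<psi> (unit_vector R j) k) ` carrier (free n)"
proof
  note W = canonical_is_module[OF can]
  interpret W: module R W by (rule W)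
  interpret F: module R "free i" for i by (rule free_mod)
  fix v assume v: "v \<in> mI_free m"
  then have vc: "v \<in> carrier (free m)" using pow_sub_free_carrier by blast
  let ?t = "\<lambda>j k. \<psi> (unit_vector R j) k"
  let ?T = "mat_act (self_module R) n m ?t"
  let ?C = "?T ` carrier (free n)"
  have \<psi>e: "\<psi> (unit_vector R j) k \<in> carrier R" if "j < m" for j k
    using free_carrier[OF is_cring mod_homD(1)[OF \<psi> unit_vector_carrier[OF is_cring that]]] .
  have T: "?T \<in> mod_hom R (free n) (free m)"
    unfolding free_module_def by (rule mat_act_hom[OF self_mod \<psi>e])
  have C: "submodule ?C R (free m)" by (rule submodule_image[OF free_mod free_mod T F.carrier_is_submodule])
  show "v \<in> ?C"
  proof (rule ccontr)
    assume "v \<notin> ?C"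
    from canonical_separates[OF can C vc this] obtain f
      where f: "f \<in> mod_hom R (free m) W" "\<And>u. u \<in> ?C \<Longrightarrow> f u = \<zero>\<^bsub>W\<^esub>" "f v \<noteq> \<zero>\<^bsub>W\<^esub>" by blast
    define w where "w j = (if j < m then f (unit_vector R j) else \<zero>\<^bsub>W\<^esub>)" for j
    have wc: "w j \<in> carrier W" for j
      using mod_homD(1)[OF f(1) unit_vector_carrier[OF is_cring]] by (simp add: w_def)
    have w: "w \<in> carrier (power_module W m)"
      using mod_homD(1)[OF f(1) unit_vector_carrier[OF is_cring]] by (simp add: w_def)
    have fw: "f u = lin_comb W m w u" if "u \<in> carrier (free m)" for u
    proof -
      have "f u = lin_comb W m (\<lambda>l. f (unit_vector R l)) u" by (rule hom_eq_lin_comb[OF W f(1) that])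
      also have "\<dots> = lin_comb W m w u"
        using wc free_carrier[OF is_cring that] by (intro W.finsum_cong') (auto simp: w_def)
      finally show ?thesis .
    qed
    \<comment> \<open>f vanishes at the images of the unit vectors e_k under the transpose, and
      these values are exactly the coordinates of the matrix of \<psi> applied to w.\<close>
    have "mat_act W m n (\<lambda>k j. ?t j k) w = (\<lambda>_. \<zero>\<^bsub>W\<^esub>)"
    proof
      fix k
      have "lin_comb W m w (\<lambda>j. ?t j k) = \<zero>\<^bsub>W\<^esub>" if k: "k < n"
      proof -
        have e: "unit_vector R k \<in> carrier (free n)" using unit_vector_carrier[OF is_cring k] .
        have Te: "?T (unit_vector R k) j = ?t j k" if "j < m" for j
        proof -
          have "(\<Oplus>\<^bsub>self_module R\<^esub>i\<in>{..<n}. unit_vector R k i \<odot>\<^bsub>self_module R\<^esub> ?t j i) = ?t j k"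
            using \<psi>e[OF that] k by (intro lin_comb_unit[OF self_mod]) auto
          moreover have "(\<Oplus>\<^bsub>self_module R\<^esub>i\<in>{..<n}. ?t j i \<odot>\<^bsub>self_module R\<^esub> unit_vector R k i) =
              (\<Oplus>\<^bsub>self_module R\<^esub>i\<in>{..<n}. unit_vector R k i \<odot>\<^bsub>self_module R\<^esub> ?t j i)"
            using \<psi>e[OF that] free_carrier[OF is_cring e]
            by (intro abelian_monoid.finsum_cong'[OF abelian_group.axioms(1)[OF module.axioms(2)[OF self_mod]]])
               (auto simp: m_comm)
          ultimately show ?thesis using that by (simp add: mat_act_def)
        qed
        have "f (?T (unit_vector R k)) = \<zero>\<^bsub>W\<^esub>" using f(2) e by blast
        then have "lin_comb W m w (?T (unit_vector R k)) = \<zero>\<^bsub>W\<^esub>" using fw[OF mod_homD(1)[OF T e]] by simp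
        moreover have "lin_comb W m w (?T (unit_vector R k)) = lin_comb W m w (\<lambda>j. ?t j k)"
          using Te wc \<psi>e by (intro W.finsum_cong') auto
        ultimately show ?thesis by simp
      qed
      then show "mat_act W m n (\<lambda>k j. ?t j k) w k = \<zero>\<^bsub>W\<^esub>" by (simp add: mat_act_def)
    qed
    from exact[OF w this] obtain z where z: "z \<in> carrier (power_module W q)"
      "w = mat_act W q m (\<lambda>j l. \<chi> (unit_vector R l) j) z" by blast
    have zc: "z l \<in> carrier W" for l using power_carrier[OF W z(1)] .
    have "v j \<odot>\<^bsub>W\<^esub> w j = \<zero>\<^bsub>W\<^esub>" if j: "j < m" for j
    proof -
      have vj: "v j \<in> mI" "v j \<in> carrier R" using v j by (auto simp: pow_sub_mem)
      have \<chi>m: "\<chi> (unit_vector R l) j \<in> \<mm>" if "l < q" for l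
        using \<chi>(2) unit_vector_carrier[OF is_cring that] j by (auto simp: pow_sub_mem image_subset_iff)
      have "v j \<odot>\<^bsub>W\<^esub> w j = (\<Oplus>\<^bsub>W\<^esub>l\<in>{..<q}. v j \<odot>\<^bsub>W\<^esub> (\<chi> (unit_vector R l) j \<odot>\<^bsub>W\<^esub> z l))"
        unfolding z(2) mat_act_def using j vj \<chi>m m_carrier zc
        by (simp add: W.finsum_smult_ldistr Pi_def)
      also have "\<dots> = (\<Oplus>\<^bsub>W\<^esub>l\<in>{..<q}. \<zero>\<^bsub>W\<^esub>)"
      proof (rule W.finsum_cong')
        fix l assume "l \<in> {..<q}"
        then have m: "\<chi> (unit_vector R l) j \<in> \<mm>" using \<chi>m by simp
        show "v j \<odot>\<^bsub>W\<^esub> (\<chi> (unit_vector R l) j \<odot>\<^bsub>W\<^esub> z l) = \<zero>\<^bsub>W\<^esub>"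
          using W.smult_assoc1[OF vj(2) m_carrier[OF m] zc[of l]] mI_mult_m[OF vj(1) m] zc[of l] by simp
      qed auto
      finally show ?thesis by simp
    qed
    then have "lin_comb W m w v = (\<Oplus>\<^bsub>W\<^esub>j\<in>{..<m}. \<zero>\<^bsub>W\<^esub>)" by (intro W.finsum_cong') auto
    then show False using f(3) fw[OF vc] by simp
  qed
qed

end

theorem corollary3p5:
  fixes R :: "('a, 'b) ring_scheme" and \<mm> I :: "'a set"
    and \<omega> :: "('a, 'w) module" and M :: "('a, 'm) module" and i :: nat
  assumes "local_ring R \<mm>" and "artinian_ring R"
    and "canonical_module R \<mm> \<omega>"
    and "ideal I R" and "I \<noteq> carrier R"
    and "\<mm> \<cdot>\<^bsub>R\<^esub> \<mm> \<cdot>\<^bsub>R\<^esub> I = {\<zero>\<^bsub>R\<^esub>}"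
    and "betti R \<mm> ((self_module R)\<lparr>carrier := I\<rparr>) 0 > 2"
    and "betti R \<mm> \<omega> 2 \<le> betti R \<mm> \<omega> 1"
    and "module R M" and "finitely_generated R M" and "\<not> fg_free R M"
    and "ideal_smult R (\<mm> \<cdot>\<^bsub>R\<^esub> I) M = {\<zero>\<^bsub>M\<^esub>}"
    and "i > 1"
    and "zero_module (Tor R \<mm> i M \<omega>)"
    and "zero_module (Tor R \<mm> (i + 1) M \<omega>)"
    and "zero_module (Tor R \<mm> (i + 2) M \<omega>)"
    and "\<forall>t. i \<le> t \<and> t \<le> i + 3 \<longrightarrow> ideal_free R I (syzygy R \<mm> M t)"
    and "\<forall>t\<in>{1, 2, 3}. ideal_free R I (syzygy R \<mm> \<omega> t)"
  shows "gorenstein_local_ring R"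
proof -
  interpret cring R using assms(1) by (simp add: local_ring_def)
  interpret artinian_local R \<mm> by unfold_locales (rule assms(1), rule assms(2))
  interpret artinian_local_ideal R \<mm> I
    by (intro artinian_local_ideal.intro artinian_local_ideal_axioms.intro artinian_local_axioms
        assms(4) assms(5) assms(6))
  note can = assms(3) and M = assms(9)
  note W = canonical_is_module[OF can] and Wfin = canonical_finite_len[OF can]
    and Mfin = finitely_generated_finite_len[OF M assms(10)]
  note Wmin = min_res_resolution[OF W Wfin] and Mmin = min_res_resolution[OF M Mfin]
  note Wres = minimal_resolutionD[OF Wmin] and Mres = minimal_resolutionD[OF Mmin]
  define \<epsilon> where "\<epsilon> = fst (snd (min_res R \<mm> \<omega>))"
  let ?c = "betti R \<mm> \<omega>" and ?\<delta> = "res_diff R \<mm> \<omega>"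
  let ?b = "betti R \<mm> M" and ?d = "res_diff R \<mm> M"
  have \<epsilon>: "\<epsilon> \<in> mod_hom R (free (?c 0)) \<omega>" "\<epsilon> ` carrier (free (?c 0)) = carrier \<omega>"
    "?\<delta> 0 ` carrier (free (?c 1)) = a_kernel (free (?c 0)) \<omega> \<epsilon>"
    using Wres(1,3,4) by (simp_all add: \<epsilon>_def)
  show ?thesis
  proof (cases "?c 1 = 0")
    case True
    from augmentation_bij[OF W Wmin this]
    have "bij_betw \<epsilon> (carrier (free (?c 0))) (carrier \<omega>)" by (simp add: \<epsilon>_def)
    then show ?thesis by (rule gorenstein_if_canonical_free[OF can \<epsilon>(1)])
  next
    case False
    \<comment> \<open>The differential with index h = i - 1 precedes d_i; it serves to show that b_i
      > 0 and that \<mm>I R^{b_i} is reached by d_i.\<close>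
    obtain h where h: "i = Suc h" using assms(13) by (cases i) auto
    let ?s = "len R (free (?c 0)) {\<zero>\<^bsub>free (?c 0)\<^esub>} (?\<delta> 0 ` I_free (?c 1))"
    \<comment> \<open>The t-th syzygy is covered by the free module in degree t, so its I-freeness
      controls d_t, which maps onto the kernel of this cover; t \<ge> 1 allows t to be written as a
      successor.\<close>
    have M_entries: "?d t ` carrier (free (?b (Suc t))) \<subseteq> I_free (?b t)" if "i \<le> t" "t \<le> i + 3" for t
      using syzygy_ideal_free_entries[OF M Mfin I_ideal one_notin_I, of "t - 1"] that assms(13,17) by simp
    have M_entry: "?d t (unit_vector R k) j \<in> I"
      if "i \<le> t" "t \<le> i + 3" "k < ?b (Suc t)" "j < ?b t" for t j k
      using M_entries[OF that(1,2)] unit_vector_carrier[OF is_cring that(3)] that(4)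
      by (auto simp: pow_sub_mem image_subset_iff)
    have M_carrier: "?d t (unit_vector R k) j \<in> carrier R" if "k < ?b (Suc t)" for t j k
      using free_carrier[OF is_cring mod_homD(1)[OF Mres(2) unit_vector_carrier[OF is_cring that]]] .
    have M_complex: "?d t (?d (Suc t) v) = \<zero>\<^bsub>free (?b t)\<^esub>" if "v \<in> carrier (free (?b (Suc (Suc t))))" for t v
    proof -
      have "?d (Suc t) v \<in> a_kernel (free (?b (Suc t))) (free (?b t)) (?d t)" using that Mres(5)[of t] by blast
      then show ?thesis by (simp add: a_kernel_def')
    qed
    have Tor1: "\<exists>z\<in>carrier (power_module \<omega> (?b (Suc (Suc i)))).
        w = mat_act \<omega> (?b (Suc (Suc i))) (?b (Suc i)) (diff_matrix M (Suc i)) z"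
      if "w \<in> carrier (power_module \<omega> (?b (Suc i)))"
        "mat_act \<omega> (?b (Suc i)) (?b i) (diff_matrix M i) w = (\<lambda>_. \<zero>\<^bsub>\<omega>\<^esub>)" for w
      using Tor_vanishing[OF M Mfin W _ that] assms(15) by simp
    have Tor2: "\<exists>z\<in>carrier (power_module \<omega> (?b (Suc (Suc (Suc i))))).
        w = mat_act \<omega> (?b (Suc (Suc (Suc i)))) (?b (Suc (Suc i))) (diff_matrix M (Suc (Suc i))) z"
      if "w \<in> carrier (power_module \<omega> (?b (Suc (Suc i))))"
        "mat_act \<omega> (?b (Suc (Suc i))) (?b (Suc i)) (diff_matrix M (Suc i)) w = (\<lambda>_. \<zero>\<^bsub>\<omega>\<^esub>)" for w
      using Tor_vanishing[OF M Mfin W _ that] assms(16) by simp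
    have \<delta>0: "?\<delta> 0 \<in> mod_hom R (free (?c 1)) (free (?c 0))"
      "?\<delta> 0 ` carrier (free (?c 1)) \<subseteq> m_free (?c 0)"
      using Wres(2,6)[of 0] by simp_all
    have A: "enat (?b i) * ?s \<le> enat (?b (Suc i) * ?c 1)"
    proof (rule syzygy_inequality[OF W \<epsilon>(1,2) \<delta>0(1) \<epsilon>(3) \<delta>0(2)])
      show "diff_matrix M i j k \<in> I" if "j < ?b i" "k < ?b (Suc i)" for j k
        using M_entry[of i] that by simp
      show "diff_matrix M (Suc i) k l \<in> carrier R" if "k < ?b (Suc i)" "l < ?b (Suc (Suc i))" for k l
        using M_carrier that by simp
      show "mat_act (self_module R) (?b (Suc i)) (?b i) (diff_matrix M i)
          (mat_act (self_module R) (?b (Suc (Suc i))) (?b (Suc i)) (diff_matrix M (Suc i)) v) = (\<lambda>_. \<zero>\<^bsub>R\<^esub>)"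
        if v: "v \<in> carrier (free (?b (Suc (Suc i))))" for v
        using mat_act_free[OF is_cring Mres(2) v]
          mat_act_free[OF is_cring Mres(2) mod_homD(1)[OF Mres(2) v]] M_complex[OF v]
        by (simp add: free_zero)
      let ?im = "mat_act (self_module R) (?b (Suc i)) (?b i) (diff_matrix M i) ` carrier (free (?b (Suc i)))"
      \<comment> \<open>The preceding minimal differential kills \<mm>I R^{b_i}, so exactness over R
        puts this module in the image of d_i.\<close>
      show "mI_free (?b i) \<subseteq> ?im"
      proof
        fix v assume v: "v \<in> mI_free (?b i)"
        then have "?d h v = \<zero>\<^bsub>free (?b h)\<^esub>"
          using minimal_map_kills[OF Mres(2,6), of v h] h by simp
        then have "v \<in> a_kernel (free (?b (Suc h))) (free (?b h)) (?d h)"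
          using v pow_sub_free_carrier h by (auto simp: a_kernel_def')
        then obtain u where u: "u \<in> carrier (free (?b (Suc i)))" "v = ?d i u"
          using Mres(5)[of h] h by auto
        then show "v \<in> ?im"
          using mat_act_free[OF is_cring Mres(2) u(1)] by (intro image_eqI[of _ _ u]) simp_all
      qed
    qed (rule Tor1)
    \<comment> \<open>The roles are exchanged: t is the transpose of d_{i+1}, with entries in I
      because M_{i+1} is I-free, and s is the transpose of d_i. Both complexes pass through the same
      middle term, so the right-hand side stays the same.\<close>
    have B: "enat (?b (Suc (Suc i))) * ?s \<le> enat (?b (Suc i) * ?c 1)"
    proof (rule syzygy_inequality[OF W \<epsilon>(1,2) \<delta>0(1) \<epsilon>(3) \<delta>0(2)])
      let ?t = "\<lambda>j k. ?d (Suc i) (unit_vector R j) k" and ?u = "\<lambda>k l. ?d i (unit_vector R k) l"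
      show "?t j k \<in> I" if "j < ?b (Suc (Suc i))" "k < ?b (Suc i)" for j k
        using M_entry[of "Suc i"] that by simp
      show "?u k l \<in> carrier R" if "k < ?b (Suc i)" "l < ?b i" for k l
        using M_carrier that by simp
      show "mat_act (self_module R) (?b (Suc i)) (?b (Suc (Suc i))) ?t
          (mat_act (self_module R) (?b i) (?b (Suc i)) ?u v) = (\<lambda>_. \<zero>\<^bsub>R\<^esub>)" if "v \<in> carrier (free (?b i))" for v
        by (rule transpose_complex[OF Mres(2) Mres(2) M_complex that])
      show "mI_free (?b (Suc (Suc i))) \<subseteq>
          mat_act (self_module R) (?b (Suc i)) (?b (Suc (Suc i))) ?t ` carrier (free (?b (Suc i)))"
        by (rule transpose_onto[OF can Mres(2) Mres(2,6) Tor2])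
      show "\<exists>z\<in>carrier (power_module \<omega> (?b i)). w = mat_act \<omega> (?b i) (?b (Suc i)) ?u z"
        if "w \<in> carrier (power_module \<omega> (?b (Suc i)))"
          "mat_act \<omega> (?b (Suc i)) (?b (Suc (Suc i))) ?t w = (\<lambda>_. \<zero>\<^bsub>\<omega>\<^esub>)" for w
        by (rule transpose_exact[OF canonical_injective[OF can] Mres(2) Mres(2) Mres(5) that])
    qed
    \<comment> \<open>Applied to the first two differentials of \<omega>; the second has entries in
      I because the first syzygy is I-free.\<close>
    have C: "enat (?c 1) * len R (self_module R) mI I \<le> enat (?c 2) + ?s"
    proof (rule betti_inequality[OF \<delta>0])
      show "?\<delta> 1 \<in> mod_hom R (free (?c 2)) (free (?c 1))"
        "?\<delta> 1 ` carrier (free (?c 2)) = a_kernel (free (?c 1)) (free (?c 0)) (?\<delta> 0)"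
        using Wres(2)[of 1] Wres(5)[of 0] by (simp_all add: numeral_2_eq_2)
      show "?\<delta> 1 ` carrier (free (?c 2)) \<subseteq> I_free (?c 1)"
        using syzygy_ideal_free_entries[OF W Wfin I_ideal one_notin_I, of 0] assms(18)
        by (simp add: numeral_2_eq_2)
    qed
    have D: "enat (?b (Suc i)) * ring_len + enat (?b i)
        \<le> enat (?b i) * ring_len + enat (?b (Suc (Suc i))) * ring_len"
      by (rule exact_length_bound[OF Mres(2,6) Mres(2,5)])
    have pos: "0 < ?b i" using betti_pos[OF M Mmin assms(11), of h] h by simp
    obtain l where l: "ring_len = enat l" using ring_finite_length by auto
    \<comment> \<open>The bound \<open>A\<close> makes s finite, as b_i > 0.\<close>
    obtain s where s: "?s = enat s" using A pos by (cases ?s) (auto simp: imult_is_infinity zero_enat_def)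
    have "enat 3 \<le> len R (self_module R) mI I"
      using betti_ideal_le assms(7) by (intro order_trans[of "enat 3", OF _ betti_ideal_le]) simp
    then have "enat (?c 1) * enat 3 \<le> enat (?c 2) + enat s"
      using C unfolding s by (meson mult_left_mono order_trans zero_le)
    \<comment> \<open>From 3 c_1 \<le> c_2 + s and c_2 \<le> c_1.\<close>
    then have s2: "2 * ?c 1 \<le> s" using assms(8) by simp
    \<comment> \<open>In this case c_1 > 0, so it can be cancelled.\<close>
    have double: "2 * k \<le> ?b (Suc i)" if "k * s \<le> ?b (Suc i) * ?c 1" for k
    proof -
      have "(2 * k) * ?c 1 \<le> k * s" using mult_le_mono2[OF s2, of k] by (simp add: ac_simps)
      then have "(2 * k) * ?c 1 \<le> ?b (Suc i) * ?c 1" using that by (rule order_trans)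
      then show ?thesis using False by simp
    qed
    have "2 * ?b i \<le> ?b (Suc i)" "2 * ?b (Suc (Suc i)) \<le> ?b (Suc i)"
      using A B unfolding s by (auto intro!: double)
    \<comment> \<open>The two bounds add up to b_i + b_{i+2} \<le> b_{i+1}, and the length count
      \<open>D\<close> then leaves b_i \<le> 0.\<close>
    then have "(?b i + ?b (Suc (Suc i))) * l \<le> ?b (Suc i) * l" by (intro mult_le_mono1) simp
    moreover have "?b (Suc i) * l + ?b i \<le> ?b i * l + ?b (Suc (Suc i)) * l" using D by (simp add: l)
    ultimately show ?thesis using pos by (simp add: algebra_simps)
  qed
qed

end
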